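(* Let $n$ be a positive integer and let $f:(0,\infty)\to[0,\infty)$ be an absolutely continuous non-increasing function such that the function $t\mapsto -t^n f'(t)$ is bounded and integrable on $(0,\infty)$, and such that the function $t\mapsto -t^{n-1}f'(t)$ is non-increasing on $(0,\infty)$. Then for every symmetric convex body $K\subset\mathbb{R}^n$, the function $x\mapsto f(\|x\|_K)$, defined for $x\in\mathbb{R}^n\setminus\{0\}$, is a positive-definite distribution on $\mathbb{R}^n$.
   Context: A symmetric convex body $K\subset\mathbb{R}^n$ is the closed unit ball of a norm on $\mathbb{R}^n$, and that norm is denoted $\|\cdot\|_K$. $|x|$ is the Euclidean norm and $(\cdot,\cdot)$ the inner product on $\mathbb{R}^n$. $\mathcal{S}$ is the Schwartz space on $\mathbb{R}^n$, and distributions are elements of its dual $\mathcal{S}'$ (tempered distributions). A locally integrable function $g$ defined almost everywhere on $\mathbb{R}^n$ is identified with the distribution $\langle g,\varphi\rangle=\int_{\mathbb{R}^n} g(x)\varphi(x)\,dx$. The Fourier transform of $\varphi\in\mathcal{S}$ is $\hat\varphi(\xi)=\int_{\mathbb{R}^n}\varphi(x)e^{-i(x,\xi)}\,dx$, and for a distribution $g$ it is defined by $\langle\hat g,\varphi\rangle=\langle g,\hat\varphi\rangle$. A distribution $g$ is positive-definite if it is the Fourier transform of a non-negative tempered measure $\mu$ on $\mathbb{R}^n$ (tempered: $\int_{\mathbb{R}^n}(1+|x|)^{-\beta}\,d\mu(x)<\infty$ for some $\beta>0$); for the even functions considered here this is equivalent to $\langle g,\hat\varphi\rangle\ge 0$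 for every non-negative $\varphi\in\mathcal{S}$. The derivative $f'$ of the absolutely continuous function $f$ exists almost everywhere, and the conditions on $f'$ are understood up to null sets. *)

theory Defs
  imports "HOL-Analysis.Analysis"
begin

section \<open>Symmetric convex bodies and their norms\<close>

definition is_norm :: "('a::real_vector \<Rightarrow> real) \<Rightarrow> bool" where
  "is_norm N \<longleftrightarrow>
     (\<forall>x. 0 \<le> N x) \<and> (\<forall>x. N x = 0 \<longleftrightarrow> x = 0) \<and>
     (\<forall>c x. N (c *\<^sub>R x) = \<bar>c\<bar> * N x) \<and> (\<forall>x y. N (x + y) \<le> N x + N y)"

definition symmetric_convex_body :: "'a::real_vector set \<Rightarrow> bool" where
  "symmetric_convex_body K \<longleftrightarrow> (\<exists>N. is_norm N \<and> K = {x. N x \<le> 1})"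

definition body_norm :: "'a::real_vector set \<Rightarrow> 'a \<Rightarrow> real" where
  "body_norm K = (THE N. is_norm N \<and> K = {x. N x \<le> 1})"

lemma is_norm_le_if_ball_subset:
  assumes N: "is_norm N" and M: "is_norm M" and sub: "{x. N x \<le> 1} \<subseteq> {x. M x \<le> 1}"
  shows "M x \<le> N x"
proof (cases "x = 0")
  case True
  then show ?thesis using N M unfolding is_norm_def by metis
next
  case False
  then have pos: "N x > 0" using N unfolding is_norm_def by (metis less_eq_real_def)
  then have "N ((1 / N x) *\<^sub>R x) = 1" using N False unfolding is_norm_def by simp
  then have "(1 / N x) *\<^sub>R x \<in> {x. N x \<le> 1}" by simp
  then have "M ((1 / N x) *\<^sub>R x) \<le> 1" using sub by blast
  moreover have "M ((1 / N x) *\<^sub>R x) = \<bar>1 / N x\<bar> * M x"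
    using M unfolding is_norm_def by blast
  ultimately show ?thesis using pos by (simp add: field_simps)
qed

text \<open>A norm is determined by its closed unit ball, so the description in \<^const>\<open>body_norm\<close>
  is proper.\<close>

lemma body_norm_unit_ball:
  assumes "is_norm N"
  shows "body_norm {x. N x \<le> 1} = N"
  unfolding body_norm_def
proof (rule the_equality)
  fix M assume M: "is_norm M \<and> {x. N x \<le> 1} = {x. M x \<le> 1}"
  show "M = N"
    using is_norm_le_if_ball_subset[of N M] is_norm_le_if_ball_subset[of M N] M assms
    by (intro ext antisym) auto
qed (use assms in simp)

section \<open>Absolute continuity\<close>

definition absolutely_continuous_on :: "real set \<Rightarrow> (real \<Rightarrow> real) \<Rightarrow> bool" where
  "absolutely_continuous_on S f \<longleftrightarrow>
     (\<forall>\<epsilon>>0. \<exists>\<delta>>0. \<forall>(m::nat) a b.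
        (\<forall>i<m. a i \<le> b i \<and> {a i..b i} \<subseteq> S) \<and>
        disjoint_family_on (\<lambda>i. {a i<..<b i}) {..<m} \<and>
        (\<Sum>i<m. b i - a i) < \<delta> \<longrightarrow>
        (\<Sum>i<m. \<bar>f (b i) - f (a i)\<bar>) < \<epsilon>)"

text \<open>On an open interval absolute continuity is meant on compact subintervals, so that the
  function may be unbounded at an end point.\<close>

definition locally_absolutely_continuous_on :: "real set \<Rightarrow> (real \<Rightarrow> real) \<Rightarrow> bool" where
  "locally_absolutely_continuous_on S f \<longleftrightarrow>
     (\<forall>a b. {a..b} \<subseteq> S \<longrightarrow> absolutely_continuous_on {a..b} f)"

section \<open>Schwartz functions and tempered distributions\<close>

definition partial_deriv ::
    "'n::finite \<Rightarrow> (real ^ 'n \<Rightarrow> complex) \<Rightarrow> real ^ 'n \<Rightarrow> complex" where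
  "partial_deriv i \<phi> x = vector_derivative (\<lambda>t. \<phi> (x + t *\<^sub>R axis i 1)) (at 0)"

text \<open>Multi-indices are represented by lists of coordinate directions.\<close>

fun iter_partial_deriv ::
    "'n::finite list \<Rightarrow> (real ^ 'n \<Rightarrow> complex) \<Rightarrow> real ^ 'n \<Rightarrow> complex" where
  "iter_partial_deriv [] \<phi> = \<phi>"
| "iter_partial_deriv (i # js) \<phi> = partial_deriv i (iter_partial_deriv js \<phi>)"

definition schwartz :: "(real ^ 'n::finite \<Rightarrow> complex) set" where
  "schwartz = {\<phi>. \<forall>js.
     (\<forall>x. iter_partial_deriv js \<phi> differentiable (at x)) \<and>
     (\<forall>k::nat. bounded (range (\<lambda>x. (1 + norm x) ^ k *\<^sub>R iter_partial_deriv js \<phi> x)))}"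

definition schwartz_seminorm ::
    "nat \<Rightarrow> 'n::finite list \<Rightarrow> (real ^ 'n \<Rightarrow> complex) \<Rightarrow> real" where
  "schwartz_seminorm k js \<phi> = (SUP x. (1 + norm x) ^ k * norm (iter_partial_deriv js \<phi> x))"

definition schwartz_topology :: "(real ^ 'n::finite \<Rightarrow> complex) topology" where
  "schwartz_topology = topology_generated_by
     {{\<psi> \<in> schwartz. schwartz_seminorm k js (\<lambda>x. \<psi> x - \<phi> x) < r} | k js \<phi> r.
        \<phi> \<in> schwartz \<and> 0 < r}"

lemma topspace_schwartz_topology: "topspace schwartz_topology = schwartz"
proof
  show "schwartz \<subseteq> topspace schwartz_topology"
  proof
    fix \<phi> :: "real ^ 'n \<Rightarrow> complex" assume \<phi>: "\<phi> \<in> schwartz"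
    then have "\<phi> \<in> {\<psi> \<in> schwartz. schwartz_seminorm 0 [] (\<lambda>x. \<psi> x - \<phi> x) < 1}"
      by (simp add: schwartz_seminorm_def)
    with \<phi> show "\<phi> \<in> topspace schwartz_topology"
      unfolding schwartz_topology_def topology_generated_by_topspace
      by (intro UnionI[of "{\<psi> \<in> schwartz. schwartz_seminorm 0 [] (\<lambda>x. \<psi> x - \<phi> x) < 1}"]
            CollectI exI[of _ 0] exI[of _ "[]"] exI[of _ \<phi>] exI[of _ "1::real"]) auto
  qed
qed (auto simp: schwartz_topology_def topology_generated_by_topspace)

text \<open>Distributions are functionals on all functions of which only the values on
  \<^const>\<open>schwartz\<close> matter; accordingly, equality of distributions is equality on
  \<^const>\<open>schwartz\<close>.\<close>

type_synonym 'n functional = "(real ^ 'n \<Rightarrow> complex) \<Rightarrow> complex"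

definition tempered_distribution :: "'n::finite functional \<Rightarrow> bool" where
  "tempered_distribution T \<longleftrightarrow>
     (\<forall>\<phi>\<in>schwartz. \<forall>\<psi>\<in>schwartz. T (\<lambda>x. \<phi> x + \<psi> x) = T \<phi> + T \<psi>) \<and>
     (\<forall>c. \<forall>\<phi>\<in>schwartz. T (\<lambda>x. c * \<phi> x) = c * T \<phi>) \<and>
     continuous_map schwartz_topology euclidean T"

definition function_distribution :: "(real ^ 'n::finite \<Rightarrow> real) \<Rightarrow> 'n functional" where
  "function_distribution g \<phi> = (LINT x|lebesgue. complex_of_real (g x) * \<phi> x)"

text \<open>The pairing of a locally integrable function with every Schwartz function must exist as an
  absolutely convergent integral: the Bochner integral of a non-integrable function is 0.\<close>

definition defines_tempered_distribution :: "(real ^ 'n::finite \<Rightarrow> real) \<Rightarrow> bool" where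
  "defines_tempered_distribution g \<longleftrightarrow>
     (\<forall>C. compact C \<longrightarrow> g absolutely_integrable_on C) \<and>
     (\<forall>\<phi>\<in>schwartz. integrable lebesgue (\<lambda>x. complex_of_real (g x) * \<phi> x)) \<and>
     tempered_distribution (function_distribution g)"

section \<open>Fourier transform and positive-definite distributions\<close>

definition fourier :: "(real ^ 'n::finite \<Rightarrow> complex) \<Rightarrow> real ^ 'n \<Rightarrow> complex" where
  "fourier \<phi> \<xi> = (LINT x|lborel. \<phi> x * exp (- (\<i> * complex_of_real (x \<bullet> \<xi>))))"

definition fourier_distribution :: "'n::finite functional \<Rightarrow> 'n functional" where
  "fourier_distribution T \<phi> = T (fourier \<phi>)"

definition tempered_measure :: "(real ^ 'n::finite) measure \<Rightarrow> bool" where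
  "tempered_measure \<mu> \<longleftrightarrow> sets \<mu> = sets borel \<and>
     (\<exists>\<beta>>0. (\<integral>\<^sup>+ x. ennreal ((1 + norm x) powr (- \<beta>)) \<partial>\<mu>) < \<infinity>)"

definition measure_distribution :: "(real ^ 'n::finite) measure \<Rightarrow> 'n functional" where
  "measure_distribution \<mu> \<phi> = (LINT x|\<mu>. \<phi> x)"

definition positive_definite_distribution :: "'n::finite functional \<Rightarrow> bool" where
  "positive_definite_distribution T \<longleftrightarrow> tempered_distribution T \<and>
     (\<exists>\<mu>. tempered_measure \<mu> \<and>
        (\<forall>\<phi>\<in>schwartz. T \<phi> = fourier_distribution (measure_distribution \<mu>) \<phi>))"

end

theory Submission
  imports Defs "HOL-Probability.Characteristic_Functions"
begin

text \<open>Let n be the dimension, N the norm with unit ball K, h(t) = - t^(n-1) f'(t) and L the limit of f at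
  infinity. Since f is locally absolutely continuous, f(t) - L is the integral of h(s) s^(1-n) over s > t
  (\<open>locally_absolutely_continuous_antimono_density\<close>). In other words, G(x) = f(N x) - L is a
  superposition of indicator functions of the balls s K with weights h(s) s^(1-n) ds. Its integral is
  vol(K) times the integral of s h(s), which is finite, so the Fourier transform of G is the bounded function
  \<open>H(\<xi>) = \<integral> G(x) cos (x \<bullet> \<xi>) dx\<close>, and the distribution f(N x) is the Fourier transform of
  the measure with a mass L at the origin and the density H / (2 \<pi>)^n. What has to be shown is that H is
  non-negative.

  Put c(\<xi>) for the integral of cos (x \<bullet> \<xi>) over K. Scaling the balls gives
  \<open>H(\<xi>) = \<integral> h(s) s c(s \<xi>) ds\<close>. As h is non-negative and non-increasing, it is itself a
  superposition of indicator functions of intervals from 0 to u, so it is enough that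
  s c(s \<xi>) has a non-negative integral from 0 to u (\<open>integral_antimono_times_nonneg\<close>). That integral equals
  the integral over K of \<open>W (x \<bullet> \<xi>)\<close>, where W(t) is the integral of s cos (s t) from 0 to u. The function W
  changes sign, but its integral over a symmetric interval from -r to r is 2 (1 - cos (u r)) / r, which
  is non-negative. By the Brunn-Minkowski theorem the slices of a symmetric convex body
  orthogonal to \<xi> shrink away from the origin, so the distribution of \<open>x \<bullet> \<xi>\<close> on K is a mixture of uniform
  distributions on such intervals, and the integral is non-negative.

  The consequence of the Brunn-Minkowski theorem that is needed here has a short direct proof
  (\<open>symmetrize_in_direction\<close>): Steiner symmetrization of K in the directions of an orthonormal
  basis of the complement of \<xi> changes neither the volumes of the slices nor the central symmetry. The
  resulting body is mirror symmetric in all these directions, hence, by central symmetry, in the direction \<xi>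
  as well, and its chords parallel to \<xi> are the intervals required.

  The analytic part consists of the fundamental theorem of calculus for monotone absolutely
  continuous functions, obtained from the Radon-Nikodym theorem and differentiation of integrals
  (\<open>absolutely_continuous_mono_density\<close>), and of Fourier inversion for Schwartz functions
  (\<open>fourier_inversion\<close>), which identifies the representing measure
  (\<open>integral_even_times_schwartz\<close>, \<open>positive_definite_constant_plus_integrable\<close>).\<close>

section \<open>Lebesgue measure: affine maps, lines and product integrals\<close>

lemma nn_integral_lborel_affine:
  fixes F :: "'a::euclidean_space \<Rightarrow> ennreal"
  assumes [measurable]: "F \<in> borel_measurable borel" and c: "c \<noteq> 0"
  shows "(\<integral>\<^sup>+x. F x \<partial>lborel) = ennreal (\<bar>c\<bar> ^ DIM('a)) * (\<integral>\<^sup>+x. F (t + c *\<^sub>R x) \<partial>lborel)"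
  by (subst lborel_affine[OF c, of t])
     (simp add: nn_integral_density nn_integral_distr nn_integral_cmult)

lemma lborel_integrable_affine:
  fixes F :: "'a::euclidean_space \<Rightarrow> 'b::{banach,second_countable_topology}"
  assumes "integrable lborel F" and c: "c \<noteq> 0"
  shows "integrable lborel (\<lambda>x. F (t + c *\<^sub>R x))"
proof -
  have [measurable]: "F \<in> borel_measurable borel" using borel_measurable_integrable[OF assms(1)] by simp
  have "integrable (density (distr lborel borel (\<lambda>x. t + c *\<^sub>R x)) (\<lambda>_. ennreal (\<bar>c\<bar> ^ DIM('a)))) F"
    using assms(1) unfolding lborel_affine[OF c, of t, symmetric] .
  then have "integrable (distr lborel borel (\<lambda>x. t + c *\<^sub>R x)) (\<lambda>x. (\<bar>c\<bar> ^ DIM('a)) *\<^sub>R F x)"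
    by (subst (asm) integrable_density) simp_all
  then have "integrable lborel (\<lambda>x. (\<bar>c\<bar> ^ DIM('a)) *\<^sub>R F (t + c *\<^sub>R x))"
    by (subst (asm) integrable_distr_eq) simp_all
  from integrable_scaleR_right[OF this, of "inverse (\<bar>c\<bar> ^ DIM('a))"] show ?thesis
    using c by simp
qed

lemma lborel_integral_affine:
  fixes F :: "'a::euclidean_space \<Rightarrow> 'b::{banach,second_countable_topology}"
  assumes [measurable]: "F \<in> borel_measurable borel" and c: "c \<noteq> 0"
  shows "(LINT x|lborel. F x) = (\<bar>c\<bar> ^ DIM('a)) *\<^sub>R (LINT x|lborel. F (t + c *\<^sub>R x))"
proof -
  have "(LINT x|lborel. F x) = (LINT x|density (distr lborel borel (\<lambda>x. t + c *\<^sub>R x)) (\<lambda>_. ennreal (\<bar>c\<bar> ^ DIM('a))). F x)"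
    unfolding lborel_affine[OF c, of t, symmetric] ..
  also have "\<dots> = (LINT x|distr lborel borel (\<lambda>x. t + c *\<^sub>R x). (\<bar>c\<bar> ^ DIM('a)) *\<^sub>R F x)"
    by (subst integral_density) simp_all
  also have "\<dots> = (LINT x|lborel. (\<bar>c\<bar> ^ DIM('a)) *\<^sub>R F (t + c *\<^sub>R x))"
    by (subst integral_distr) simp_all
  finally show ?thesis by simp
qed

lemma nn_integral_lborel_translate:
  fixes F :: "'a::euclidean_space \<Rightarrow> ennreal"
  assumes "F \<in> borel_measurable borel"
  shows "(\<integral>\<^sup>+x. F (c + x) \<partial>lborel) = (\<integral>\<^sup>+x. F x \<partial>lborel)"
  using nn_integral_lborel_affine[OF assms, of 1 c] by simp

text \<open>Tonelli's theorem along the lines in direction d, without a choice of coordinates. The factor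
  \<open>indicator {0..1} (x \<bullet> d)\<close> selects from each line a segment of length one: shifting x by - t d turns it into
  a function of t whose integral is 1.\<close>

lemma nn_integral_lborel_along_line:
  fixes F :: "'a::euclidean_space \<Rightarrow> ennreal"
  assumes [measurable]: "F \<in> borel_measurable borel" and d: "norm d = 1"
  shows "(\<integral>\<^sup>+x. F x \<partial>lborel) =
    (\<integral>\<^sup>+x. indicator {0..1} (x \<bullet> d) * (\<integral>\<^sup>+t. F (x + t *\<^sub>R d) \<partial>lborel) \<partial>lborel)"
proof -
  have dd: "d \<bullet> d = 1" using d by (simp add: norm_eq_sqrt_inner)
  have "(\<integral>\<^sup>+x. indicator {0..1} (x \<bullet> d) * (\<integral>\<^sup>+t. F (x + t *\<^sub>R d) \<partial>lborel) \<partial>lborel)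
    = (\<integral>\<^sup>+x. (\<integral>\<^sup>+t. indicator {0..1} (x \<bullet> d) * F (x + t *\<^sub>R d) \<partial>lborel) \<partial>lborel)"
    by (simp add: nn_integral_cmult)
  also have "\<dots> = (\<integral>\<^sup>+t. (\<integral>\<^sup>+x. indicator {0..1} (x \<bullet> d) * F (x + t *\<^sub>R d) \<partial>lborel) \<partial>lborel)"
    by (rule lborel_pair.Fubini') measurable
  also have "\<dots> = (\<integral>\<^sup>+t. (\<integral>\<^sup>+x. indicator {0..1} ((- (t *\<^sub>R d) + x) \<bullet> d) * F ((- (t *\<^sub>R d) + x) + t *\<^sub>R d) \<partial>lborel) \<partial>lborel)"
    by (intro nn_integral_cong nn_integral_lborel_translate[symmetric, where F="\<lambda>x. indicator {0..1} (x \<bullet> d) * F (x + _ *\<^sub>R d)"]) measurable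
  also have "\<dots> = (\<integral>\<^sup>+t. (\<integral>\<^sup>+x. indicator {0..1} (x \<bullet> d - t) * F x \<partial>lborel) \<partial>lborel)"
    by (simp add: inner_diff_left inner_simps dd)
  also have "\<dots> = (\<integral>\<^sup>+x. (\<integral>\<^sup>+t. indicator {0..1} (x \<bullet> d - t) * F x \<partial>lborel) \<partial>lborel)"
    by (rule lborel_pair.Fubini') measurable
  also have "\<dots> = (\<integral>\<^sup>+x. (\<integral>\<^sup>+t. F x * indicator {x \<bullet> d - 1 .. x \<bullet> d} t \<partial>lborel) \<partial>lborel)"
    by (intro nn_integral_cong) (auto split: split_indicator)
  also have "\<dots> = (\<integral>\<^sup>+x. F x \<partial>lborel)"
    by (simp add: nn_integral_cmult)
  finally show ?thesis by simp
qed

lemma nn_integral_lborel_le_if_lines_le: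
  fixes F G :: "'a::euclidean_space \<Rightarrow> ennreal"
  assumes [measurable]: "F \<in> borel_measurable borel" "G \<in> borel_measurable borel" and d: "norm d = 1"
    and le: "\<And>x. (\<integral>\<^sup>+t. F (x + t *\<^sub>R d) \<partial>lborel) \<le> (\<integral>\<^sup>+t. G (x + t *\<^sub>R d) \<partial>lborel)"
  shows "(\<integral>\<^sup>+x. F x \<partial>lborel) \<le> (\<integral>\<^sup>+x. G x \<partial>lborel)"
  unfolding nn_integral_lborel_along_line[OF assms(1) d] nn_integral_lborel_along_line[OF assms(2) d]
  by (intro nn_integral_mono mult_left_mono le) auto

lemma integrable_product_bounded_kernel:
  fixes F :: "'a::euclidean_space \<Rightarrow> 'c::{real_normed_field,banach,second_countable_topology}"
    and G :: "'b::euclidean_space \<Rightarrow> 'c" and u :: "'a \<times> 'b \<Rightarrow> 'c"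
  assumes F: "integrable lborel F" and G: "integrable lborel G"
    and u[measurable]: "u \<in> borel_measurable borel" and u1: "\<And>p. norm (u p) \<le> 1"
  shows "integrable (lborel \<Otimes>\<^sub>M lborel) (\<lambda>(x, y). F x * G y * u (x, y))"
proof -
  have [measurable]: "F \<in> borel_measurable borel" "G \<in> borel_measurable borel"
    using borel_measurable_integrable[OF F] borel_measurable_integrable[OF G] by simp_all
  have "u \<in> borel_measurable (borel \<Otimes>\<^sub>M borel)" using u by (simp add: borel_prod)
  then have [measurable]: "(\<lambda>p. u (fst p, snd p)) \<in> borel_measurable (lborel \<Otimes>\<^sub>M lborel)" by simp
  have "integrable (lborel \<Otimes>\<^sub>M lborel) (\<lambda>(x, y). F x * G y)"
  proof (rule lborel_pair.Fubini_integrable)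
    show "integrable lborel (\<lambda>x. LINT y|lborel. norm (case (x, y) of (x, y) \<Rightarrow> F x * G y))"
      using integrable_norm[OF F] by (simp add: norm_mult)
  qed (use G in simp_all)
  then show ?thesis
    by (rule Bochner_Integration.integrable_bound)
       (auto simp: case_prod_beta norm_mult intro!: AE_I2 mult_left_le u1)
qed

lemma Fubini_product_bounded_kernel:
  fixes F :: "'a::euclidean_space \<Rightarrow> 'c::{real_normed_field,banach,second_countable_topology}"
    and G :: "'b::euclidean_space \<Rightarrow> 'c" and u :: "'a \<times> 'b \<Rightarrow> 'c"
  assumes "integrable lborel F" "integrable lborel G"
    and "u \<in> borel_measurable borel" "\<And>p. norm (u p) \<le> 1"
  shows "(LINT x|lborel. F x * (LINT y|lborel. G y * u (x, y))) = (LINT y|lborel. G y * (LINT x|lborel. F x * u (x, y)))"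
proof -
  have "(LINT y|lborel. (LINT x|lborel. F x * G y * u (x, y))) = (LINT x|lborel. (LINT y|lborel. F x * G y * u (x, y)))"
    by (rule lborel_pair.Fubini_integral) (rule integrable_product_bounded_kernel[OF assms])
  moreover have "(LINT x|lborel. F x * G y * u (x, y)) = G y * (LINT x|lborel. F x * u (x, y))" for y
    unfolding integral_mult_right_zero[symmetric] by (intro Bochner_Integration.integral_cong) (simp_all add: ac_simps)
  moreover have "(LINT y|lborel. F x * G y * u (x, y)) = F x * (LINT y|lborel. G y * u (x, y))" for x
    unfolding integral_mult_right_zero[symmetric] by (intro Bochner_Integration.integral_cong) (simp_all add: ac_simps)
  ultimately show ?thesis by simp
qed

section \<open>Steiner symmetrization and the slices of a symmetric convex body\<close>

definition mirror :: "'a::euclidean_space \<Rightarrow> 'a \<Rightarrow> 'a" where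
  "mirror d x = x - (2 * (x \<bullet> d)) *\<^sub>R d"

lemma linear_mirror: "linear (mirror d)"
  by (rule linearI) (auto simp: mirror_def inner_simps algebra_simps)

lemma mirror_mirror: "norm d = 1 \<Longrightarrow> mirror d (mirror d x) = x"
  by (simp add: mirror_def inner_simps norm_eq_sqrt_inner algebra_simps)

lemma mirror_commute: "b \<bullet> d = 0 \<Longrightarrow> mirror d (mirror b x) = mirror b (mirror d x)"
  by (simp add: mirror_def inner_simps inner_commute algebra_simps)

text \<open>Steiner symmetrization along d. If a and b lie on one line in direction d, then the midpoint of a
  and the mirror image of b lies on that line, at half their signed distance from the
  hyperplane orthogonal to d; as a and b run through a chord of K, these points fill the interval of the same
  length centred at the hyperplane. Written as a linear image, the construction visibly preserves
  compactness and convexity.\<close>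

definition steiner :: "'a::euclidean_space \<Rightarrow> 'a set \<Rightarrow> 'a set" where
  "steiner d K = (\<lambda>(a, b). (1/2) *\<^sub>R (a + mirror d b)) `
     ((K \<times> K) \<inter> {(a, b). a - b = ((a - b) \<bullet> d) *\<^sub>R d})"

lemma compact_steiner:
  assumes "compact K" shows "compact (steiner d K)"
proof -
  have "continuous_on UNIV (\<lambda>p. (1/2) *\<^sub>R (fst p + mirror d (snd p)))"
    unfolding mirror_def by (intro continuous_intros)
  moreover have "closed {p. fst p - snd p = ((fst p - snd p) \<bullet> d) *\<^sub>R d}"
    by (intro closed_Collect_eq continuous_intros)
  ultimately show ?thesis
    unfolding steiner_def using assms
    by (intro compact_continuous_image compact_Int_closed compact_Times)
       (auto simp: case_prod_beta' intro: continuous_on_subset)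
qed

lemma convex_steiner:
  assumes "convex K" shows "convex (steiner d K)"
proof -
  have "linear (\<lambda>p. (1/2) *\<^sub>R (fst p + mirror d (snd p)))"
    unfolding mirror_def by (rule linearI) (auto simp: inner_simps algebra_simps)
  moreover have "subspace {p. fst p - snd p = ((fst p - snd p) \<bullet> d) *\<^sub>R d}"
  proof -
    have "linear (\<lambda>p. fst p - snd p - ((fst p - snd p) \<bullet> d) *\<^sub>R d)"
      by (rule linearI) (auto simp: inner_simps algebra_simps)
    from linear_subspace_vimage[OF this, of "{0}"] show ?thesis
      by (simp add: vimage_def)
  qed
  ultimately show ?thesis
    unfolding steiner_def using assms
    by (intro convex_linear_image convex_Int convex_Times) (auto simp: case_prod_beta' subspace_imp_convex)
qed

lemma steinerI:
  "a \<in> K \<Longrightarrow> b \<in> K \<Longrightarrow> a - b = ((a - b) \<bullet> d) *\<^sub>R d \<Longrightarrow> y = (1/2) *\<^sub>R (a + mirror d b) \<Longrightarrow> y \<in> steiner d K"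
  unfolding steiner_def by auto

lemma steinerE:
  assumes "y \<in> steiner d K"
  obtains a b where "a \<in> K" "b \<in> K" "a - b = ((a - b) \<bullet> d) *\<^sub>R d" "y = (1/2) *\<^sub>R (a + mirror d b)"
  using assms unfolding steiner_def by auto

lemma uminus_steiner:
  assumes "\<And>x. x \<in> K \<Longrightarrow> - x \<in> K" and "y \<in> steiner d K"
  shows "- y \<in> steiner d K"
  using assms(2)
proof (rule steinerE)
  fix a b assume *: "a \<in> K" "b \<in> K" "a - b = ((a - b) \<bullet> d) *\<^sub>R d" "y = (1/2) *\<^sub>R (a + mirror d b)"
  then have "- a - - b = ((- a - - b) \<bullet> d) *\<^sub>R d"
    by (metis (no_types, lifting) inner_minus_left minus_diff_minus scaleR_minus_left)
  then show ?thesis using *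
    by (intro steinerI[of "- a" K "- b"]) (auto simp: assms(1) mirror_def algebra_simps inner_simps)
qed

lemma mirror_steiner_self:
  assumes "norm d = 1" "y \<in> steiner d K"
  shows "mirror d y \<in> steiner d K"
  using assms(2)
proof (rule steinerE)
  fix a b assume *: "a \<in> K" "b \<in> K" "a - b = ((a - b) \<bullet> d) *\<^sub>R d" "y = (1/2) *\<^sub>R (a + mirror d b)"
  then have "b - a = ((b - a) \<bullet> d) *\<^sub>R d"
    by (metis (no_types, lifting) inner_minus_left minus_diff_eq scaleR_minus_left)
  then show ?thesis using *
    by (intro steinerI[of b K a])
       (simp_all add: mirror_mirror[OF assms(1)] linear_add[OF linear_mirror] linear_cmul[OF linear_mirror] add.commute)
qed

text \<open>This keeps the symmetries gained by earlier symmetrizations in orthogonal directions.\<close>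

lemma mirror_steiner_orthogonal:
  assumes "b \<bullet> d = 0" and K: "\<And>x. x \<in> K \<Longrightarrow> mirror b x \<in> K" and "y \<in> steiner d K"
  shows "mirror b y \<in> steiner d K"
  using assms(3)
proof (rule steinerE)
  fix p q assume *: "p \<in> K" "q \<in> K" "p - q = ((p - q) \<bullet> d) *\<^sub>R d" "y = (1/2) *\<^sub>R (p + mirror d q)"
  have 0: "d \<bullet> b = 0" using assms(1) by (simp add: inner_commute)
  have "mirror b p - mirror b q = mirror b (p - q)" by (simp add: linear_diff[OF linear_mirror])
  also have "\<dots> = p - q" using arg_cong[OF *(3), of "\<lambda>v. v \<bullet> b"] by (simp add: mirror_def 0)
  finally have eq: "mirror b p - mirror b q = p - q" .
  show ?thesis
    by (rule steinerI[of "mirror b p" K "mirror b q"])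
       (use * K in \<open>simp_all only: eq mirror_commute[OF assms(1)] linear_add[OF linear_mirror] linear_cmul[OF linear_mirror]\<close>)
qed

lemma line_section_compact_convex:
  fixes K :: "'a::euclidean_space set"
  assumes "compact K" "convex K" "norm d = 1"
  obtains \<alpha> \<beta> :: real where "{t. x + t *\<^sub>R d \<in> K} = {\<alpha>..\<beta>}"
proof -
  let ?S = "{t. x + t *\<^sub>R d \<in> K}"
  have "convex ?S"
  proof (rule convexI)
    fix s t u v :: real assume *: "s \<in> ?S" "t \<in> ?S" "0 \<le> u" "0 \<le> v" "u + v = 1"
    have "x + (u *\<^sub>R s + v *\<^sub>R t) *\<^sub>R d = u *\<^sub>R (x + s *\<^sub>R d) + v *\<^sub>R (x + t *\<^sub>R d)"
      using *(5) by (simp add: algebra_simps) (metis scaleR_left.add scaleR_one)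
    then show "u *\<^sub>R s + v *\<^sub>R t \<in> ?S"
      using * assms(2) by (auto simp: convex_def)
  qed
  moreover have "closed ?S"
  proof -
    have "?S = (\<lambda>t. x + t *\<^sub>R d) -` K" by auto
    moreover have "closed \<dots>"
      using assms(1) by (intro continuous_closed_vimage continuous_intros compact_imp_closed) auto
    ultimately show ?thesis by simp
  qed
  moreover have "bounded ?S"
  proof -
    obtain B where B: "\<And>y. y \<in> K \<Longrightarrow> norm y \<le> B"
      using compact_imp_bounded[OF assms(1)] unfolding bounded_iff by blast
    have "norm t \<le> B + norm x" if "t \<in> ?S" for t
    proof -
      have "norm t = norm (t *\<^sub>R d)" using assms(3) by simp
      also have "\<dots> \<le> norm (x + t *\<^sub>R d) + norm x" by (metis add_diff_cancel_left' norm_triangle_ineq4)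
      finally show ?thesis using B that by fastforce
    qed
    then show ?thesis unfolding bounded_iff by blast
  qed
  ultimately show ?thesis
    using that connected_compact_interval_1[of ?S] convex_connected compact_eq_bounded_closed by blast
qed

text \<open>With respect to the parameter t, the hyperplane orthogonal to d is met at \<open>- (x \<bullet> d)\<close>. A chord from \<open>\<alpha>\<close> to
  \<open>\<beta>\<close> contains two points with signed distance 2 c exactly if \<open>2 \<bar>c\<bar> \<le> \<beta> - \<alpha>\<close>.\<close>

lemma line_section_steiner:
  assumes K: "{t. x + t *\<^sub>R d \<in> K} = {\<alpha>..\<beta>}" and d: "norm d = 1"
  shows "{t. x + t *\<^sub>R d \<in> steiner d K} = {- (x \<bullet> d) - (\<beta> - \<alpha>) / 2 .. - (x \<bullet> d) + (\<beta> - \<alpha>) / 2}"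
proof -
  have dd: "d \<bullet> d = 1" using d by (simp add: norm_eq_sqrt_inner)
  have iff: "x + t *\<^sub>R d \<in> K \<longleftrightarrow> \<alpha> \<le> t \<and> t \<le> \<beta>" for t using K by auto
  have 1: "- (x \<bullet> d) - (\<beta> - \<alpha>) / 2 \<le> t \<and> t \<le> - (x \<bullet> d) + (\<beta> - \<alpha>) / 2"
    if "x + t *\<^sub>R d \<in> steiner d K" for t
    using that
  proof (rule steinerE)
    fix a b assume *: "a \<in> K" "b \<in> K" "a - b = ((a - b) \<bullet> d) *\<^sub>R d" "x + t *\<^sub>R d = (1/2) *\<^sub>R (a + mirror d b)"
    define s where "s = (a - b) \<bullet> d"
    have b: "b = a - s *\<^sub>R d" using *(3) unfolding s_def by (simp add: algebra_simps)
    have xt: "x + t *\<^sub>R d = a - (s / 2 + b \<bullet> d) *\<^sub>R d"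
    proof -
      have "a + mirror d b = 2 *\<^sub>R a - (s + 2 * (b \<bullet> d)) *\<^sub>R d"
        unfolding mirror_def by (subst b) (simp add: algebra_simps scaleR_2)
      then show ?thesis unfolding *(4) by (simp only: scaleR_diff_right) (simp add: algebra_simps)
    qed
    then have "(x + t *\<^sub>R d) \<bullet> d = (a - (s / 2 + b \<bullet> d) *\<^sub>R d) \<bullet> d" by simp
    then have "x \<bullet> d + t = s / 2" by (simp add: inner_simps dd s_def field_simps)
    moreover have "a = x + (t + s / 2 + b \<bullet> d) *\<^sub>R d" using xt by (simp add: algebra_simps)
    moreover have "b = x + (t - s / 2 + b \<bullet> d) *\<^sub>R d"
    proof -
      have "b = (x + t *\<^sub>R d) + (s / 2 + b \<bullet> d) *\<^sub>R d - s *\<^sub>R d" unfolding xt diff_add_cancel by (rule b)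
      also have "\<dots> = x + (t + (s / 2 + b \<bullet> d) - s) *\<^sub>R d"
        by (simp only: scaleR_left_distrib scaleR_left_diff_distrib add_diff_eq add.assoc)
      also have "t + (s / 2 + b \<bullet> d) - s = t - s / 2 + b \<bullet> d" by simp
      finally show ?thesis .
    qed
    ultimately show ?thesis using iff[of "t + s / 2 + b \<bullet> d"] iff[of "t - s / 2 + b \<bullet> d"] *(1,2)
      by (simp add: field_simps)
  qed
  have 2: "x + t *\<^sub>R d \<in> steiner d K"
    if "- (x \<bullet> d) - (\<beta> - \<alpha>) / 2 \<le> t" "t \<le> - (x \<bullet> d) + (\<beta> - \<alpha>) / 2" for t
  proof -
    \<comment> \<open>The two points of the chord at distance s from its midpoint on either side.\<close>
    define m where "m = (\<alpha> + \<beta>) / 2"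
    define s where "s = x \<bullet> d + t"
    define h where "h = (\<beta> - \<alpha>) / 2"
    have "2 * m = \<alpha> + \<beta>" "2 * h = \<beta> - \<alpha>" by (simp_all add: m_def h_def)
    moreover have "- h \<le> s" "s \<le> h"
      using that unfolding h_def[symmetric] s_def by linarith+
    ultimately have "\<alpha> \<le> m + s \<and> m + s \<le> \<beta>" "\<alpha> \<le> m - s \<and> m - s \<le> \<beta>"
      by linarith+
    then have "x + (m + s) *\<^sub>R d \<in> K" "x + (m - s) *\<^sub>R d \<in> K"
      unfolding iff .
    then show ?thesis
    proof (rule steinerI)
      have "x + (m + s) *\<^sub>R d - (x + (m - s) *\<^sub>R d) = ((m + s) - (m - s)) *\<^sub>R d"
        by (simp only: scaleR_left_diff_distrib add_diff_cancel_left)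
      also have "(m + s) - (m - s) = 2 * s" by simp
      finally have *: "x + (m + s) *\<^sub>R d - (x + (m - s) *\<^sub>R d) = (2 * s) *\<^sub>R d" .
      show "x + (m + s) *\<^sub>R d - (x + (m - s) *\<^sub>R d) = ((x + (m + s) *\<^sub>R d - (x + (m - s) *\<^sub>R d)) \<bullet> d) *\<^sub>R d"
        unfolding * by (simp add: dd)
      have "mirror d (x + (m - s) *\<^sub>R d) = x + ((m - s) - 2 * (x \<bullet> d + (m - s))) *\<^sub>R d"
      proof -
        have "(x + (m - s) *\<^sub>R d) \<bullet> d = x \<bullet> d + (m - s)"
          by (simp only: inner_add_left inner_scaleR_left dd mult_1_right)
        then show ?thesis
          unfolding mirror_def by (simp only: scaleR_left_diff_distrib[of "m - s"] add_diff_eq)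
      qed
      then have "x + (m + s) *\<^sub>R d + mirror d (x + (m - s) *\<^sub>R d)
          = 2 *\<^sub>R x + ((m + s) + ((m - s) - 2 * (x \<bullet> d + (m - s)))) *\<^sub>R d"
        by (simp only: scaleR_left_distrib scaleR_2 ac_simps)
      also have "(m + s) + ((m - s) - 2 * (x \<bullet> d + (m - s))) = 2 * t"
        by (simp add: s_def)
      finally have *: "x + (m + s) *\<^sub>R d + mirror d (x + (m - s) *\<^sub>R d) = 2 *\<^sub>R x + (2 * t) *\<^sub>R d" .
      show "x + t *\<^sub>R d = (1/2) *\<^sub>R (x + (m + s) *\<^sub>R d + mirror d (x + (m - s) *\<^sub>R d))"
        unfolding * by (simp add: scaleR_add_right)
    qed
  qed
  show ?thesis
    unfolding set_eq_iff mem_Collect_eq atLeastAtMost_iff using 1 2 by blast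
qed

text \<open>The condition \<open>x \<bullet> u \<in> T\<close> is constant along each line in direction d, and on each such line symmetrization
  preserves the length of the chord.\<close>

lemma emeasure_slab_steiner:
  fixes K :: "'a::euclidean_space set"
  assumes K: "compact K" "convex K" and d: "norm d = 1" and du: "d \<bullet> u = 0" and T[measurable]: "T \<in> sets borel"
  shows "emeasure lborel {x \<in> steiner d K. x \<bullet> u \<in> T} = emeasure lborel {x \<in> K. x \<bullet> u \<in> T}"
proof -
  have [measurable]: "K \<in> sets borel" "steiner d K \<in> sets borel"
    using K compact_steiner by (auto intro: borel_compact)
  have m: "{x \<in> A. x \<bullet> u \<in> T} \<in> sets borel" if [measurable]: "A \<in> sets borel" for A
    by measurable
  have line: "(\<integral>\<^sup>+t. indicator {x \<in> A. x \<bullet> u \<in> T} (x + t *\<^sub>R d) \<partial>lborel)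
      = indicator T (x \<bullet> u) * emeasure lborel {\<alpha>..\<beta>}" if "{t. x + t *\<^sub>R d \<in> A} = {\<alpha>..\<beta>}" for A x \<alpha> \<beta>
  proof -
    have "indicator {x \<in> A. x \<bullet> u \<in> T} (x + t *\<^sub>R d) = (indicator T (x \<bullet> u) * indicator {\<alpha>..\<beta>} t :: ennreal)" for t
      unfolding that[symmetric] by (auto simp: inner_simps du split: split_indicator)
    then show ?thesis by (simp add: nn_integral_cmult)
  qed
  have *: "(\<integral>\<^sup>+t. indicator {x \<in> steiner d K. x \<bullet> u \<in> T} (x + t *\<^sub>R d) \<partial>lborel)
    = (\<integral>\<^sup>+t. indicator {x \<in> K. x \<bullet> u \<in> T} (x + t *\<^sub>R d) \<partial>lborel)" for x
  proof -
    obtain \<alpha> \<beta> where ab: "{t. x + t *\<^sub>R d \<in> K} = {\<alpha>..\<beta>}"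
      using line_section_compact_convex[OF K d] by blast
    have "emeasure lborel {c - h / 2..c + h / 2} = (if 0 \<le> h then ennreal h else 0)" for c h :: real
      by (simp add: emeasure_lborel_Icc_eq)
    moreover have "emeasure lborel {\<alpha>..\<beta>} = (if 0 \<le> \<beta> - \<alpha> then ennreal (\<beta> - \<alpha>) else 0)"
      by (simp add: emeasure_lborel_Icc_eq)
    ultimately have len: "emeasure lborel {c - (\<beta> - \<alpha>) / 2..c + (\<beta> - \<alpha>) / 2} = emeasure lborel {\<alpha>..\<beta>}" for c
      by metis
    show ?thesis unfolding line[OF ab] line[OF line_section_steiner[OF ab d]] len ..
  qed
  have "(\<integral>\<^sup>+x. indicator {x \<in> steiner d K. x \<bullet> u \<in> T} x \<partial>lborel) = (\<integral>\<^sup>+x. indicator {x \<in> K. x \<bullet> u \<in> T} x \<partial>lborel)"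
    by (intro antisym nn_integral_lborel_le_if_lines_le[OF _ _ d]) (simp_all add: * m borel_measurable_indicator)
  then show ?thesis by (simp add: m)
qed

lemma iterated_steiner:
  fixes K :: "'a::euclidean_space set"
  assumes K: "compact K" "convex K" "\<And>x. x \<in> K \<Longrightarrow> - x \<in> K"
    and S: "finite S" "pairwise orthogonal S" "\<And>d. d \<in> S \<Longrightarrow> norm d = 1" "\<And>d. d \<in> S \<Longrightarrow> d \<bullet> u = 0"
  shows "\<exists>K'. compact K' \<and> convex K' \<and> (\<forall>x\<in>K'. - x \<in> K') \<and> (\<forall>d\<in>S. \<forall>x\<in>K'. mirror d x \<in> K') \<and>
    (\<forall>T\<in>sets borel. emeasure lborel {x \<in> K'. x \<bullet> u \<in> T} = emeasure lborel {x \<in> K. x \<bullet> u \<in> T})"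
  using S
proof (induction S)
  case empty
  show ?case using K by (intro exI[of _ K]) auto
next
  case (insert d S)
  have "pairwise orthogonal S" using insert.prems(1) by (rule pairwise_mono) auto
  with insert obtain K' where K': "compact K'" "convex K'" "\<And>x. x \<in> K' \<Longrightarrow> - x \<in> K'"
     "\<And>d x. d \<in> S \<Longrightarrow> x \<in> K' \<Longrightarrow> mirror d x \<in> K'"
     "\<And>T. T \<in> sets borel \<Longrightarrow> emeasure lborel {x \<in> K'. x \<bullet> u \<in> T} = emeasure lborel {x \<in> K. x \<bullet> u \<in> T}"
    by auto
  have d: "norm d = 1" "d \<bullet> u = 0" using insert.prems by auto
  have orth: "b \<bullet> d = 0" if "b \<in> S" for b
    using insert.prems(1) insert.hyps(2) that by (auto simp: pairwise_insert orthogonal_def)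
  have "\<forall>b\<in>insert d S. \<forall>x\<in>steiner d K'. mirror b x \<in> steiner d K'"
    using mirror_steiner_self[OF d(1)] mirror_steiner_orthogonal[OF orth K'(4)] by auto
  then show ?case
    using compact_steiner[OF K'(1)] convex_steiner[OF K'(2)] uminus_steiner[OF K'(3)]
      emeasure_slab_steiner[OF K'(1,2) d] K'(5)
    by (intro exI[of _ "steiner d K'"]) auto
qed

text \<open>The product of mirrors in orthogonal directions changes the sign of exactly the coordinates in
  these directions. For all directions of an orthonormal basis except one it is, up to the sign -1, the
  mirror in the remaining direction.\<close>

lemma mirrors_compose:
  fixes x :: "'a::euclidean_space"
  assumes "finite S" "pairwise orthogonal S" "\<And>d x. d \<in> S \<Longrightarrow> x \<in> K \<Longrightarrow> mirror d x \<in> K" "x \<in> K"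
  shows "x - 2 *\<^sub>R (\<Sum>d\<in>S. (x \<bullet> d) *\<^sub>R d) \<in> K"
  using assms
proof (induction S)
  case (insert d S)
  have "pairwise orthogonal S" using insert.prems(1) by (rule pairwise_mono) auto
  define y where "y = x - 2 *\<^sub>R (\<Sum>d\<in>S. (x \<bullet> d) *\<^sub>R d)"
  have "b \<bullet> d = 0" if "b \<in> S" for b
    using insert.prems(1) insert.hyps(2) that by (auto simp: pairwise_insert orthogonal_def)
  then have "y \<bullet> d = x \<bullet> d" by (simp add: y_def inner_simps inner_sum_left)
  moreover have "mirror d y \<in> K" using insert \<open>pairwise orthogonal S\<close> unfolding y_def by auto
  ultimately show ?case using insert.hyps by (simp add: mirror_def y_def algebra_simps)
qed auto

text \<open>This replaces the appeal to the Brunn-Minkowski theorem. The body obtained by symmetrizing K in the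
  directions of an orthonormal basis of the complement of u is invariant under these mirrors and under
  \<open>x \<mapsto> - x\<close>, and therefore under the mirror in direction u too.\<close>

lemma symmetrize_in_direction:
  fixes K :: "'a::euclidean_space set"
  assumes K: "compact K" "convex K" "\<And>x. x \<in> K \<Longrightarrow> - x \<in> K" and u: "norm u = 1"
  obtains K' where "compact K'" "convex K'" "\<And>x. x \<in> K' \<Longrightarrow> mirror u x \<in> K'"
    "\<And>T. T \<in> sets borel \<Longrightarrow> emeasure lborel {x \<in> K'. x \<bullet> u \<in> T} = emeasure lborel {x \<in> K. x \<bullet> u \<in> T}"
proof -
  obtain B where B: "u \<in> B" "pairwise orthogonal B" "\<And>x. x \<in> B \<Longrightarrow> norm x = 1"
    "independent B" "card B = DIM('a)" "span B = UNIV"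
    using vector_in_orthonormal_basis[OF u] by blast
  then have fin: "finite B" using independent_imp_finite by blast
  define S where "S = B - {u}"
  have S: "finite S" "pairwise orthogonal S" "\<And>d. d \<in> S \<Longrightarrow> norm d = 1" "\<And>d. d \<in> S \<Longrightarrow> d \<bullet> u = 0"
    using B fin by (auto simp: S_def pairwise_def orthogonal_def)
  obtain K' where K': "compact K'" "convex K'" "\<And>x. x \<in> K' \<Longrightarrow> - x \<in> K'"
     "\<And>d x. d \<in> S \<Longrightarrow> x \<in> K' \<Longrightarrow> mirror d x \<in> K'"
     "\<And>T. T \<in> sets borel \<Longrightarrow> emeasure lborel {x \<in> K'. x \<bullet> u \<in> T} = emeasure lborel {x \<in> K. x \<bullet> u \<in> T}"
    using iterated_steiner[OF K S] by auto
  have "mirror u x \<in> K'" if "x \<in> K'" for x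
  proof -
    have "(\<Sum>d\<in>B. (x \<bullet> d) *\<^sub>R d) = x"
      using orthonormal_basis_expand[OF B(2,3) _ fin, of x] B(6) by (simp add: inner_commute)
    then have "(\<Sum>d\<in>S. (x \<bullet> d) *\<^sub>R d) = x - (x \<bullet> u) *\<^sub>R u"
      using B(1) fin by (simp add: S_def sum_diff1)
    then have "- (x - 2 *\<^sub>R (\<Sum>d\<in>S. (x \<bullet> d) *\<^sub>R d)) = mirror u x"
      by (simp add: mirror_def scaleR_diff_right scaleR_2)
    moreover have "x - 2 *\<^sub>R (\<Sum>d\<in>S. (x \<bullet> d) *\<^sub>R d) \<in> K'"
      by (rule mirrors_compose[OF S(1,2) K'(4) that])
    ultimately show ?thesis using K'(3) by metis
  qed
  then show ?thesis using that K' by blast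
qed

lemma integral_nonneg_iff_nn_integral:
  fixes F :: "'a \<Rightarrow> real"
  assumes "integrable M F"
  shows "0 \<le> integral\<^sup>L M F \<longleftrightarrow> (\<integral>\<^sup>+x. ennreal (- F x) \<partial>M) \<le> (\<integral>\<^sup>+x. ennreal (F x) \<partial>M)"
proof -
  have f: "(\<integral>\<^sup>+x. ennreal (F x) \<partial>M) < (top :: ennreal)" "(\<integral>\<^sup>+x. ennreal (- F x) \<partial>M) < (top :: ennreal)"
    using assms by (auto simp: real_integrable_def less_top)
  have "enn2real (\<integral>\<^sup>+x. ennreal (- F x) \<partial>M) \<le> enn2real (\<integral>\<^sup>+x. ennreal (F x) \<partial>M) \<longleftrightarrow>
    (\<integral>\<^sup>+x. ennreal (- F x) \<partial>M) \<le> (\<integral>\<^sup>+x. ennreal (F x) \<partial>M)"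
    using f by (metis enn2real_mono enn2real_nonneg ennreal_enn2real ennreal_leI)
  then show ?thesis
    unfolding real_lebesgue_integral_def[OF assms] by simp
qed

lemma integrable_on_compact_continuous:
  fixes W :: "'a::euclidean_space \<Rightarrow> 'b::euclidean_space"
  assumes "compact K" "continuous_on UNIV W"
  shows "integrable lborel (\<lambda>x. indicator K x *\<^sub>R W x)"
  using borel_integrable_compact[OF assms(1)] assms(2) continuous_on_subset
  by (metis set_integrable_def subset_UNIV)

text \<open>By \<open>symmetrize_in_direction\<close> the chords of K in direction u may be assumed to be intervals that are
  symmetric with respect to the hyperplane \<open>x \<bullet> u = 0\<close>; on each of them the integral of W is non-negative.\<close>

lemma integral_slab_function_nonneg:
  fixes K :: "'a::euclidean_space set" and W :: "real \<Rightarrow> real"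
  assumes K: "compact K" "convex K" "\<And>x. x \<in> K \<Longrightarrow> - x \<in> K" and u: "norm u = 1"
    and W: "continuous_on UNIV W" and pos: "\<And>r. 0 \<le> r \<Longrightarrow> 0 \<le> integral {-r..r} W"
  shows "0 \<le> (LINT x|lborel. indicator K x * W (x \<bullet> u))"
proof -
  have uu: "u \<bullet> u = 1" using u by (simp add: norm_eq_sqrt_inner)
  obtain K' where K': "compact K'" "convex K'" "\<And>x. x \<in> K' \<Longrightarrow> mirror u x \<in> K'"
    "\<And>T. T \<in> sets borel \<Longrightarrow> emeasure lborel {x \<in> K'. x \<bullet> u \<in> T} = emeasure lborel {x \<in> K. x \<bullet> u \<in> T}"
    using symmetrize_in_direction[OF K u] by blast
  have [measurable]: "K \<in> sets borel" "K' \<in> sets borel" using K K' by (auto intro: borel_compact)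
  have [measurable]: "W \<in> borel_measurable borel" using W by (rule borel_measurable_continuous_onI)
  define M where "M A = distr (density lborel (\<lambda>x. ennreal (indicator A x))) borel (\<lambda>x::'a. x \<bullet> u)" for A
  have em: "emeasure (M A) T = emeasure lborel {x \<in> A. x \<bullet> u \<in> T}"
    if [measurable]: "A \<in> sets borel" "T \<in> sets borel" for A T
  proof -
    have "emeasure (M A) T = (\<integral>\<^sup>+x. ennreal (indicator A x) * indicator ((\<lambda>x. x \<bullet> u) -` T) x \<partial>lborel)"
      using measurable_sets_borel[of "\<lambda>x::'a. x \<bullet> u" borel T]
      unfolding M_def by (simp add: emeasure_distr emeasure_density)
    also have "\<dots> = (\<integral>\<^sup>+x. indicator {x \<in> A. x \<bullet> u \<in> T} x \<partial>lborel)"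
      by (intro nn_integral_cong) (auto split: split_indicator)
    also have "\<dots> = emeasure lborel {x \<in> A. x \<bullet> u \<in> T}"
      by (rule nn_integral_indicator) measurable
    finally show ?thesis .
  qed
  have "M K = M K'"
  proof (rule measure_eqI)
    fix T assume "T \<in> sets (M K)"
    then have "T \<in> sets borel" by (simp add: M_def)
    then show "emeasure (M K) T = emeasure (M K') T" by (simp add: em K')
  qed (simp add: M_def)
  moreover have M_int: "integral\<^sup>L (M A) W = (LINT x|lborel. indicator A x * W (x \<bullet> u))"
    if [measurable]: "A \<in> sets borel" for A
  proof -
    have "integral\<^sup>L (M A) W = integral\<^sup>L (density lborel (\<lambda>x. ennreal (indicator A x))) (\<lambda>x. W (x \<bullet> u))"
      unfolding M_def by (rule integral_distr) simp_all
    also have "\<dots> = (LINT x|lborel. indicator A x * W (x \<bullet> u))"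
      by (subst integral_density) (simp_all, measurable)
    finally show ?thesis .
  qed
  ultimately have "(LINT x|lborel. indicator K x * W (x \<bullet> u)) = (LINT x|lborel. indicator K' x * W (x \<bullet> u))"
    using M_int[of K] M_int[of K'] by simp
  also have "\<dots> \<ge> 0"
  proof -
    define F where "F x = indicator K' x * W (x \<bullet> u)" for x
    have [measurable]: "F \<in> borel_measurable borel" unfolding F_def by measurable
    have "continuous_on UNIV (\<lambda>x. W (x \<bullet> u))"
      by (intro continuous_on_compose2[OF W] continuous_intros) auto
    then have "integrable lborel F"
      using integrable_on_compact_continuous[OF K'(1), of "\<lambda>x. W (x \<bullet> u)"] unfolding F_def by simp
    moreover have "(\<integral>\<^sup>+x. ennreal (- F x) \<partial>lborel) \<le> (\<integral>\<^sup>+x. ennreal (F x) \<partial>lborel)"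
    proof (rule nn_integral_lborel_le_if_lines_le[OF _ _ u])
      fix x
      obtain \<alpha> \<beta> where ab: "{t. x + t *\<^sub>R u \<in> K'} = {\<alpha>..\<beta>}"
        using line_section_compact_convex[OF K'(1,2) u] by blast
      define p where "p = x \<bullet> u"
      have F: "F (x + t *\<^sub>R u) = indicator {\<alpha>..\<beta>} t * W (p + t)" for t
        unfolding ab[symmetric] F_def p_def by (auto simp: inner_simps uu split: split_indicator)
      have cont: "continuous_on UNIV (\<lambda>t. W (p + t))"
        by (intro continuous_on_compose2[OF W] continuous_intros) auto
      have int: "integrable lborel (\<lambda>t. F (x + t *\<^sub>R u))"
        unfolding F using integrable_on_compact_continuous[OF _ cont, of "{\<alpha>..\<beta>}"] by simp
      have "0 \<le> (LINT t|lborel. F (x + t *\<^sub>R u))"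
      proof (cases "\<alpha> \<le> \<beta>")
        case True
        have iff: "x + t *\<^sub>R u \<in> K' \<longleftrightarrow> \<alpha> \<le> t \<and> t \<le> \<beta>" for t using ab by auto
        have sym: "x + (- 2 * p - t) *\<^sub>R u \<in> K'" if "x + t *\<^sub>R u \<in> K'" for t
        proof -
          have "mirror u (x + t *\<^sub>R u) = x + (- 2 * p - t) *\<^sub>R u"
          proof -
            have "(x + t *\<^sub>R u) - (2 * ((x + t *\<^sub>R u) \<bullet> u)) *\<^sub>R u = x + (t - 2 * (p + t)) *\<^sub>R u"
              by (simp only: p_def inner_add_left inner_scaleR_left uu mult_1_right scaleR_left_diff_distrib[of t] add_diff_eq)
            also have "t - 2 * (p + t) = - 2 * p - t" by simp
            finally show ?thesis unfolding mirror_def .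
          qed
          then show ?thesis using K'(3)[OF that] by simp
        qed
        have "\<alpha> \<le> - 2 * p - t \<and> - 2 * p - t \<le> \<beta>" if "\<alpha> \<le> t" "t \<le> \<beta>" for t
        proof -
          have "x + t *\<^sub>R u \<in> K'" using that iff by simp
          from sym[OF this] show ?thesis unfolding iff .
        qed
        from this[of \<alpha>] this[of \<beta>] True have eq: "\<alpha> = - 2 * p - \<beta>" by linarith
        define r where "r = \<beta> + p"
        have "(LINT t|lborel. F (x + t *\<^sub>R u)) = (LBINT t:{\<alpha>..\<beta>}. W (p + t))"
          unfolding F set_lebesgue_integral_def by simp
        also have "\<dots> = integral {\<alpha>..\<beta>} (\<lambda>t. W (p + t))"
          by (intro set_borel_integral_eq_integral(2) borel_integrable_atLeastAtMost')
             (rule continuous_on_subset[OF cont], simp)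
        also have "\<dots> = integral {-r - p..r - p} (W \<circ> (\<lambda>t. t + p))"
        proof -
          have "\<alpha> = - r - p" "\<beta> = r - p" using eq by (simp_all add: r_def)
          then show ?thesis by (simp add: o_def add.commute[of p])
        qed
        also have "\<dots> = integral {- r - p + p..r - p + p} W"
          by (rule integral_shift) (rule continuous_on_subset[OF W], simp)
        also have "\<dots> \<ge> 0"
        proof -
          have "0 \<le> r" using True eq unfolding r_def by linarith
          then show ?thesis by (simp only: diff_add_cancel pos)
        qed
        finally show ?thesis .
      next
        case False
        then have "F (x + t *\<^sub>R u) = 0" for t unfolding F by simp
        then show ?thesis by simp
      qed
      then show "(\<integral>\<^sup>+t. ennreal (- F (x + t *\<^sub>R u)) \<partial>lborel) \<le> (\<integral>\<^sup>+t. ennreal (F (x + t *\<^sub>R u)) \<partial>lborel)"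
        by (rule integral_nonneg_iff_nn_integral[OF int, THEN iffD1])
    qed simp_all
    ultimately show ?thesis unfolding F_def[symmetric] using integral_nonneg_iff_nn_integral by blast
  qed
  finally show ?thesis .
qed

section \<open>The derivative of a monotone absolutely continuous function\<close>

lemma absolutely_continuous_on_imp_continuous_on:
  assumes "absolutely_continuous_on {a..b} F"
  shows "continuous_on {a..b} F"
proof (rule continuous_onI)
  fix x e :: real assume x: "x \<in> {a..b}" and e: "0 < e"
  obtain d where d: "0 < d" "\<forall>(m::nat) l u. (\<forall>i<m. l i \<le> u i \<and> {l i..u i} \<subseteq> {a..b}) \<and>
        disjoint_family_on (\<lambda>i. {l i<..<u i}) {..<m} \<and> (\<Sum>i<m. u i - l i) < d \<longrightarrow>
        (\<Sum>i<m. \<bar>F (u i) - F (l i)\<bar>) < e"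
    using assms[unfolded absolutely_continuous_on_def, THEN spec, THEN mp, OF e] by (elim exE conjE)
  have *: "\<bar>F v - F u\<bar> < e" if "u \<in> {a..b}" "v \<in> {a..b}" "u \<le> v" "v - u < d" for u v
    using d(2)[THEN spec[of _ 1], THEN spec[of _ "\<lambda>_. u"], THEN spec[of _ "\<lambda>_. v"]] that by (simp add: disjoint_family_on_def)
  have "dist (F x') (F x) \<le> e" if "x' \<in> {a..b}" "dist x' x < d" for x'
    using *[of x x'] *[of x' x] that x by (cases "x \<le> x'") (auto simp: dist_real_def)
  then show "\<exists>d>0. \<forall>x'\<in>{a..b}. dist x' x < d \<longrightarrow> dist (F x') (F x) \<le> e"
    using d(1) by blast
qed

text \<open>The definition of absolute continuity controls finitely many disjoint intervals of small total length. A null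
  set lies in an open set of small measure and is covered by countably many non-overlapping intervals inside that
  open set; continuity of the Stieltjes measure from below extends the bound to all of them.\<close>

lemma interval_measure_null_if_absolutely_continuous:
  assumes ab: "a < b" and ac: "absolutely_continuous_on {a..b} F"
    and G_mono: "\<And>x y. x \<le> y \<Longrightarrow> G x \<le> G y" and G_cont: "continuous_on UNIV G"
    and FG: "\<And>t. t \<in> {a..b} \<Longrightarrow> G t = F t"
    and N: "N \<in> null_sets lborel" "N \<subseteq> {a..b}"
  shows "emeasure (interval_measure G) N = 0"
proof -
  let ?\<nu> = "interval_measure G"
  have Ns: "N \<in> sets borel" using N(1) by auto
  have em: "emeasure ?\<nu> {c..d} = ennreal (G d - G c)" if "c \<le> d" for c d
    by (rule emeasure_interval_measure_Icc[OF that G_mono G_cont])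
  have "emeasure ?\<nu> N \<le> 0 + ennreal e" if e: "0 < e" for e :: real
  proof -
    obtain \<delta> where \<delta>: "0 < \<delta>" "\<forall>(m::nat) l u. (\<forall>i<m. l i \<le> u i \<and> {l i..u i} \<subseteq> {a..b}) \<and>
        disjoint_family_on (\<lambda>i. {l i<..<u i}) {..<m} \<and> (\<Sum>i<m. u i - l i) < \<delta> \<longrightarrow>
        (\<Sum>i<m. \<bar>F (u i) - F (l i)\<bar>) < e"
      using ac[unfolded absolutely_continuous_on_def, THEN spec, THEN mp, OF e] by (elim exE conjE)
    obtain U where U: "open U" "N \<subseteq> U" "emeasure lborel (U - N) < ennreal \<delta>"
      using outer_regular_lborel[OF Ns \<delta>(1)] by blast
    have "emeasure lborel U \<le> emeasure lborel (U - N) + emeasure lborel N"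
      using U(1) Ns by (intro order_trans[OF _ emeasure_subadditive] emeasure_mono) auto
    then have U_le: "emeasure lborel U < ennreal \<delta>"
      using U(3) N(1) by (simp add: null_setsD1)
    \<comment> \<open>The intervals of the covering lemma are each contained in g x for some x in N, hence in U.\<close>
    define g where "g x = (if x \<in> U then U else UNIV)" for x
    have g: "gauge g" using U(1) by (auto simp: gauge_def g_def)
    have cov: "N \<subseteq> cbox a b" "box a b \<noteq> {}" using N(2) ab by auto
    obtain \<D> where \<D>: "countable \<D>"  "\<Union>\<D> \<subseteq> cbox a b"
        "\<And>K. K \<in> \<D> \<Longrightarrow> interior K \<noteq> {} \<and> (\<exists>c d. K = cbox c d)"
        "pairwise (\<lambda>A B. interior A \<inter> interior B = {}) \<D>"
        "\<And>K. K \<in> \<D> \<Longrightarrow> \<exists>x \<in> N \<inter> K. K \<subseteq> g x" "N \<subseteq> \<Union>\<D>"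
      by (rule covering_lemma[OF cov g]) (rule that; assumption)
    have \<D>U: "K \<subseteq> U" if "K \<in> \<D>" for K
      using \<D>(5)[OF that] U(2) by (auto simp: g_def split: if_splits)
    have fin: "emeasure ?\<nu> (\<Union>\<D>0) \<le> ennreal e" if \<D>0: "finite \<D>0" "\<D>0 \<subseteq> \<D>" for \<D>0
    proof -
      obtain h where h: "bij_betw h {..<card \<D>0} \<D>0"
        using ex_bij_betw_nat_finite[OF \<D>0(1)] by (auto simp: atLeast0LessThan)
      let ?m = "card \<D>0"
      have hD: "h i \<in> \<D>" if "i < ?m" for i using h \<D>0(2) that by (auto simp: bij_betw_def)
      have "\<exists>c d. h i = {c..d} \<and> c < d" if "i < ?m" for i
        using \<D>(3)[OF hD[OF that]] by (auto simp: interior_cbox box_real)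
      then obtain l u where lu: "\<And>i. i < ?m \<Longrightarrow> h i = {l i..u i}" "\<And>i. i < ?m \<Longrightarrow> l i < u i"
        by metis
      have sub: "{l i..u i} \<subseteq> {a..b}" "{l i..u i} \<subseteq> U" if "i < ?m" for i
        using subset_trans[OF Union_upper[OF hD[OF that]] \<D>(2)] \<D>U[OF hD[OF that]] lu(1)[OF that] by simp_all
      have disj: "disjoint_family_on (\<lambda>i. {l i<..<u i}) {..<?m}"
        unfolding disjoint_family_on_def
      proof (intro ballI impI)
        fix i j assume ij: "i \<in> {..<?m}" "j \<in> {..<?m}" "i \<noteq> j"
        then have "h i \<noteq> h j" using h by (auto simp: bij_betw_def inj_on_def)
        then have "interior (h i) \<inter> interior (h j) = {}"
          using \<D>(4) hD ij by (auto simp: pairwise_def)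
        then show "{l i<..<u i} \<inter> {l j<..<u j} = {}"
          using ij lu(1) by (simp add: interior_atLeastAtMost_real)
      qed
      have "(\<Sum>i<?m. ennreal (u i - l i)) = (\<Sum>i<?m. emeasure lborel {l i<..<u i})"
        using lu(2) by (intro sum.cong) (auto simp: less_imp_le)
      also have "\<dots> = emeasure lborel (\<Union>i<?m. {l i<..<u i})"
        using disj by (intro sum_emeasure) auto
      also have "\<dots> \<le> emeasure lborel U"
      proof (intro emeasure_mono UN_least)
        fix i assume "i \<in> {..<?m}"
        then show "{l i<..<u i} \<subseteq> U" using sub(2)[of i] greaterThanLessThan_subseteq_atLeastAtMost_iff[of "l i" "u i" "l i" "u i"] by auto
      qed (use U(1) in auto)
      also note U_le
      finally have "(\<Sum>i<?m. ennreal (u i - l i)) < ennreal \<delta>" .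
      moreover have "0 \<le> (\<Sum>i<?m. u i - l i)"
        using lu(2) by (intro sum_nonneg) (auto simp: less_imp_le)
      moreover have "(\<Sum>i<?m. ennreal (u i - l i)) = ennreal (\<Sum>i<?m. u i - l i)"
        using lu(2) by (intro sum_ennreal) (auto simp: less_imp_le)
      ultimately have "(\<Sum>i<?m. u i - l i) < \<delta>"
        by (simp add: ennreal_less_iff)
      then have "(\<Sum>i<?m. \<bar>F (u i) - F (l i)\<bar>) < e"
        using lu(2) sub(1) disj
        by (intro \<delta>(2)[THEN spec, THEN spec, THEN spec, THEN mp] conjI allI impI) (auto intro: less_imp_le)
      moreover have "emeasure ?\<nu> (\<Union>\<D>0) \<le> (\<Sum>i<?m. emeasure ?\<nu> (h i))"
      proof -
        have "\<Union>\<D>0 = (\<Union>i<?m. h i)" using h by (auto simp: bij_betw_def)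
        then show ?thesis using lu(1) by (simp, intro emeasure_subadditive_finite) auto
      qed
      moreover have "(\<Sum>i<?m. emeasure ?\<nu> (h i)) = (\<Sum>i<?m. ennreal \<bar>F (u i) - F (l i)\<bar>)"
      proof (intro sum.cong refl)
        fix i assume "i \<in> {..<?m}"
        then have i: "i < ?m" by simp
        have lei: "l i \<le> u i" using lu(2)[OF i] by simp
        have "G (u i) = F (u i)" "G (l i) = F (l i)" using sub(1)[OF i] lei FG by auto
        moreover have "G (l i) \<le> G (u i)" using G_mono lei by blast
        ultimately show "emeasure ?\<nu> (h i) = ennreal \<bar>F (u i) - F (l i)\<bar>"
          unfolding lu(1)[OF i] em[OF lei] by simp
      qed
      moreover have "\<dots> = ennreal (\<Sum>i<?m. \<bar>F (u i) - F (l i)\<bar>)"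
        by (rule sum_ennreal) simp
      ultimately show ?thesis by (metis ennreal_leI less_imp_le order_trans)
    qed
    have Km: "K \<in> sets borel" if "K \<in> \<D>" for K using \<D>(3)[OF that] by auto
    have "emeasure ?\<nu> (\<Union>\<D>) \<le> ennreal e"
    proof (cases "\<D> = {}")
      case False
      define A where "A n = \<Union>(from_nat_into \<D> ` {..<n})" for n :: nat
      have inD: "from_nat_into \<D> i \<in> \<D>" for i using False by (rule from_nat_into)
      have Am: "A n \<in> sets ?\<nu>" for n unfolding A_def using Km inD by auto
      have UA: "(\<Union>n. A n) = \<Union>\<D>"
      proof
        show "\<Union>\<D> \<subseteq> (\<Union>n. A n)"
        proof
          fix x assume "x \<in> \<Union>\<D>"
          then obtain K where "K \<in> \<D>" "x \<in> K" by auto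
          then obtain i where "from_nat_into \<D> i = K" using from_nat_into_surj[OF \<D>(1)] by blast
          then have "x \<in> A (Suc i)" using \<open>x \<in> K\<close> by (auto simp: A_def)
          then show "x \<in> (\<Union>n. A n)" by blast
        qed
      qed (use inD in \<open>auto simp: A_def\<close>)
      have "emeasure ?\<nu> (\<Union>n. A n) = (SUP n. emeasure ?\<nu> (A n))"
        using Am by (intro SUP_emeasure_incseq[symmetric]) (auto simp: incseq_def A_def intro: less_le_trans)
      also have "\<dots> \<le> ennreal e"
        unfolding A_def using inD by (intro SUP_least fin) auto
      finally show ?thesis unfolding UA .
    qed simp
    moreover have "emeasure ?\<nu> N \<le> emeasure ?\<nu> (\<Union>\<D>)"
      using \<D>(6) by (rule emeasure_mono) (use \<D>(1) Km in \<open>auto intro!: sets.countable_Union\<close>)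
    ultimately show ?thesis by auto
  qed
  then show ?thesis by (metis ennreal_le_epsilon add_0 le_zero_eq)
qed

lemma AE_lborel_if_negligible:
  fixes P :: "'a::euclidean_space \<Rightarrow> bool"
  assumes "negligible N" "\<And>x. x \<notin> N \<Longrightarrow> P x"
  shows "AE x in lborel. P x"
proof -
  have "AE x in lebesgue. P x"
    using assms by (intro AE_I'[of N]) (auto simp: negligible_iff_null_sets)
  then show ?thesis by (simp add: AE_completion_iff)
qed

text \<open>The Stieltjes measure of F is absolutely continuous with respect to Lebesgue measure and has a
  Radon-Nikodym density q. The averages of q over intervals to the right of t converge to q t
  for almost every t, and the same result for the reflected function \<open>t \<mapsto> q (- t)\<close> deals with the intervals to
  the left.\<close>

lemma absolutely_continuous_mono_density:
  assumes ab: "a < b" and ac: "absolutely_continuous_on {a..b} F" and mono: "mono_on {a..b} F"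
  obtains q :: "real \<Rightarrow> real" where "q \<in> borel_measurable borel" "\<And>t. 0 \<le> q t"
    "(\<integral>\<^sup>+t\<in>{a..b}. ennreal (q t) \<partial>lborel) = ennreal (F b - F a)"
    "AE t in lborel. a < t \<and> t < b \<longrightarrow> (F has_real_derivative q t) (at t)"
proof -
  define G where "G t = F (max a (min b t))" for t
  have FG: "G t = F t" if "t \<in> {a..b}" for t using that by (simp add: G_def)
  have G_mono: "G x \<le> G y" if "x \<le> y" for x y
    unfolding G_def using ab that by (intro mono_onD[OF mono]) auto
  have G_cont: "continuous_on UNIV G" unfolding G_def
    by (rule continuous_on_compose2[OF absolutely_continuous_on_imp_continuous_on[OF ac]])
       (use ab in \<open>auto intro!: continuous_intros\<close>)
  \<comment> \<open>After the restriction only null sets inside \<open>{a..b}\<close> matter, where G agrees with F.\<close>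
  define \<nu> where "\<nu> = density (interval_measure G) (indicator {a..b})"
  have sets\<nu>: "sets \<nu> = sets borel" by (simp add: \<nu>_def)
  have em\<nu>: "emeasure \<nu> A = emeasure (interval_measure G) ({a..b} \<inter> A)" if "A \<in> sets borel" for A
    unfolding \<nu>_def using that by (intro emeasure_restricted) auto
  have "absolutely_continuous lborel \<nu>"
    unfolding absolutely_continuous_def
  proof
    fix N :: "real set" assume N: "N \<in> null_sets lborel"
    then have "{a..b} \<inter> N \<in> null_sets lborel" by (simp add: null_set_Int1)
    then have "emeasure (interval_measure G) ({a..b} \<inter> N) = 0"
      by (intro interval_measure_null_if_absolutely_continuous[OF ab ac G_mono G_cont FG]) auto
    then show "N \<in> null_sets \<nu>" using N by (auto simp: null_sets_def em\<nu> sets\<nu>)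
  qed
  then obtain q' where q'[measurable]: "q' \<in> borel_measurable borel" and dens: "density lborel q' = \<nu>"
    using sigma_finite_measure.Radon_Nikodym[OF sigma_finite_lborel, of \<nu>] sets\<nu> by auto
  have em_q': "(\<integral>\<^sup>+t\<in>A. q' t \<partial>lborel) = emeasure (interval_measure G) ({a..b} \<inter> A)" if "A \<in> sets borel" for A
    using that by (simp add: em\<nu>[symmetric] dens[symmetric] emeasure_density)
  have em_q'_Icc: "(\<integral>\<^sup>+t\<in>{c..d}. q' t \<partial>lborel) = ennreal (F d - F c)" if "a \<le> c" "c \<le> d" "d \<le> b" for c d
  proof -
    have "{a..b} \<inter> {c..d} = {c..d}" using that by auto
    then show ?thesis
      using that emeasure_interval_measure_Icc[of c d G, OF _ G_mono G_cont] by (simp add: em_q' FG)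
  qed
  have tot: "(\<integral>\<^sup>+t. q' t \<partial>lborel) = ennreal (F b - F a)"
    using em_q'[of UNIV] em_q'[of "{a..b}"] em_q'_Icc[of a b] ab by simp
  then have "AE t in lborel. q' t \<noteq> \<infinity>"
    by (intro nn_integral_PInf_AE) auto
  then have qq: "AE t in lborel. ennreal (enn2real (q' t)) = q' t"
    by eventually_elim (simp add: less_top)
  define q where "q t = enn2real (q' t)" for t
  have [measurable]: "q \<in> borel_measurable borel" unfolding q_def by measurable
  have q_Icc: "(\<integral>\<^sup>+t\<in>{c..d}. ennreal (q t) \<partial>lborel) = ennreal (F d - F c)" if "a \<le> c" "c \<le> d" "d \<le> b" for c d
    unfolding em_q'_Icc[OF that, symmetric] q_def
    by (rule nn_integral_cong_AE) (use qq in eventually_elim, simp)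
  have q_tot: "(\<integral>\<^sup>+t. ennreal (q t) \<partial>lborel) = ennreal (F b - F a)"
    unfolding tot[symmetric] q_def by (rule nn_integral_cong_AE) (use qq in eventually_elim, simp)
  have q_int: "integrable lborel q"
    by (rule integrableI_nonneg) (auto simp: q_tot, simp add: q_def)
  have q_on: "q integrable_on S" if "S \<in> sets borel" for S
  proof -
    have "set_integrable lborel S q"
      unfolding set_integrable_def using integrable_mult_indicator[OF _ q_int, of S] that by simp
    then show ?thesis by (rule set_borel_integral_eq_integral(1))
  qed
  have HK: "integral {c..d} q = F d - F c" if "a \<le> c" "c \<le> d" "d \<le> b" for c d
  proof -
    have Fcd: "F c \<le> F d" using that by (intro mono_onD[OF mono]) auto
    have "ennreal (integral {c..d} q) = (\<integral>\<^sup>+t\<in>{c..d}. ennreal (q t) \<partial>lborel)"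
      by (rule set_nn_integral_lborel_eq_integral[symmetric])
         (simp_all add: set_borel_measurable_def q_Icc[OF that], simp add: q_def)
    moreover have "0 \<le> integral {c..d} q"
      by (intro integral_nonneg q_on) (auto simp: q_def)
    ultimately show ?thesis using Fcd by (simp add: q_Icc[OF that])
  qed
  define r where "r t = q (- t)" for t
  have r_refl: "integral {-t..h - t} r = integral {t - h..t} q" for t h
    using Henstock_Kurzweil_Integration.integral_reflect_real[of t "t - h" q] by (simp add: r_def[abs_def])
  have "integrable lborel r"
    using lborel_integrable_real_affine[OF q_int, of "-1" 0] by (simp add: r_def[abs_def])
  then have r_on: "r integrable_on S" if "S \<in> sets borel" for S
    using integrable_mult_indicator[of S lborel r] that
    by (intro set_borel_integral_eq_integral(1)) (simp add: set_integrable_def)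
  have q_cbox: "q integrable_on cbox a b" for a b by (rule q_on) simp
  obtain N1 where N1: "negligible N1" "\<And>x e. \<lbrakk>x \<notin> N1; 0 < e\<rbrakk> \<Longrightarrow>
      \<exists>d>0. \<forall>h. 0 < h \<and> h < d \<longrightarrow> norm (integral (cbox x (x + h *\<^sub>R One)) q /\<^sub>R h ^ DIM(real) - q x) < e"
    by (rule integrable_ccontinuous_explicit[of q, OF q_cbox]) (rule that; assumption)
  have r_cbox: "r integrable_on cbox a b" for a b by (rule r_on) simp
  obtain N2 where N2: "negligible N2" "\<And>x e. \<lbrakk>x \<notin> N2; 0 < e\<rbrakk> \<Longrightarrow>
      \<exists>d>0. \<forall>h. 0 < h \<and> h < d \<longrightarrow> norm (integral (cbox x (x + h *\<^sub>R One)) r /\<^sub>R h ^ DIM(real) - r x) < e"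
    by (rule integrable_ccontinuous_explicit[of r, OF r_cbox]) (rule that; assumption)
  have "negligible (uminus ` N2)"
    by (rule negligible_differentiable_image_negligible[OF _ N2(1)]) (auto intro!: derivative_intros)
  then have neg: "negligible (N1 \<union> uminus ` N2)" using N1(1) by simp
  have deriv: "(F has_real_derivative q t) (at t)" if t: "t \<notin> N1 \<union> uminus ` N2" "a < t" "t < b" for t
    unfolding DERIV_def LIM_def
  proof (intro allI impI)
    fix e :: real assume e: "0 < e"
    have "- t \<notin> N2" using t(1) by force
    then obtain d2 where d2: "0 < d2"
        "\<And>h. 0 < h \<Longrightarrow> h < d2 \<Longrightarrow> \<bar>integral {t - h..t} q / h - q t\<bar> < e"
      using N2(2)[of "- t" e] e by (auto simp: r_refl r_def divide_inverse_commute)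
    obtain d1 where d1: "0 < d1"
        "\<And>h. 0 < h \<Longrightarrow> h < d1 \<Longrightarrow> \<bar>integral {t..t + h} q / h - q t\<bar> < e"
      using N1(2)[of t e] e t(1) by (auto simp: divide_inverse_commute)
    define d where "d = min (min d1 d2) (min (t - a) (b - t))"
    have d: "0 < d" "d \<le> d1" "d \<le> d2" "d \<le> t - a" "d \<le> b - t"
      using d1(1) d2(1) t by (auto simp: d_def)
    have "\<bar>(F (t + h) - F t) / h - q t\<bar> < e" if h: "h \<noteq> 0" "\<bar>h\<bar> < d" for h
    proof (cases "0 < h")
      case True
      then have "integral {t..t + h} q = F (t + h) - F t" using h d t by (intro HK) auto
      then show ?thesis using d1(2)[of h] True h d by simp
    next
      case False
      then have "integral {t - (-h)..t} q = F t - F (t - (-h))" using h d t by (intro HK) auto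
      moreover have "(F (t + h) - F t) / h = (F t - F (t + h)) / (- h)"
        by (simp add: minus_divide_right[symmetric] minus_divide_left)
      ultimately show ?thesis using d2(2)[of "- h"] False h d by simp
    qed
    then show "\<exists>s>0. \<forall>x. x \<noteq> 0 \<and> dist x 0 < s \<longrightarrow> dist ((F (t + x) - F t) / x) (q t) < e"
      using d(1) by (intro exI[of _ d]) (auto simp: dist_real_def)
  qed
  show ?thesis
  proof (rule that[of q])
    show "AE t in lborel. a < t \<and> t < b \<longrightarrow> (F has_real_derivative q t) (at t)"
      using neg by (rule AE_lborel_if_negligible) (use deriv in blast)
    show "set_nn_integral lborel {a..b} (\<lambda>t. ennreal (q t)) = ennreal (F b - F a)"
      using ab by (intro q_Icc) auto
    show "q \<in> borel_measurable borel" by measurable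
    show "0 \<le> q t" for t by (simp add: q_def)
  qed
qed

text \<open>The monotonicity of \<open>- (t ^ m) * deriv f t\<close> is known only outside a null set, and the sign of the derivative
  only where f is differentiable. The function h repairs this: it is the monotone extension of
  \<open>- (t ^ m) * deriv f t\<close> from the good points, so that it can be used pointwise and is Borel measurable.\<close>

lemma locally_absolutely_continuous_antimono_density:
  fixes f :: "real \<Rightarrow> real" and m :: nat
  assumes ac: "locally_absolutely_continuous_on {0<..} f" and noninc: "antimono_on {0<..} f"
    and Z: "Z \<in> null_sets lebesgue" and anti: "antimono_on ({0<..} - Z) (\<lambda>t. - (t ^ m) * deriv f t)"
  obtains h where "antimono_on {0<..} h" "\<And>t. 0 < t \<Longrightarrow> 0 \<le> h t"
    "\<And>a b. 0 < a \<Longrightarrow> a \<le> b \<Longrightarrow> (\<integral>\<^sup>+t\<in>{a..b}. ennreal (h t / t ^ m) \<partial>lborel) = ennreal (f a - f b)"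
    "AE t in lborel. 0 < t \<longrightarrow> h t = - (t ^ m) * deriv f t"
proof -
  have local: "\<exists>q. (\<integral>\<^sup>+t\<in>{a..b}. ennreal (q t) \<partial>lborel) = ennreal (f a - f b) \<and>
      (AE t in lborel. a < t \<and> t < b \<longrightarrow> 0 \<le> q t \<and> deriv f t = - q t)" if ab: "0 < a" "a < b" for a b
  proof -
    have "absolutely_continuous_on {a..b} f"
      using ac ab unfolding locally_absolutely_continuous_on_def by (metis atLeastAtMost_iff greaterThan_iff less_le_trans subsetI)
    then have "absolutely_continuous_on {a..b} (\<lambda>t. - f t)"
      unfolding absolutely_continuous_on_def by (simp add: abs_minus_commute)
    note ac_neg = this
    have mono_neg: "mono_on {a..b} (\<lambda>t. - f t)"
      using noninc ab by (auto simp: monotone_on_def)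
    obtain q where "q \<in> borel_measurable borel" and q: "\<And>t. 0 \<le> q t"
        "(\<integral>\<^sup>+t\<in>{a..b}. ennreal (q t) \<partial>lborel) = ennreal (- f b - - f a)"
        "AE t in lborel. a < t \<and> t < b \<longrightarrow> ((\<lambda>t. - f t) has_real_derivative q t) (at t)"
      by (rule absolutely_continuous_mono_density[OF ab(2) ac_neg mono_neg]) (rule that; assumption)
    have "deriv f t = - q t" if "((\<lambda>t. - f t) has_real_derivative q t) (at t)" for t
      using DERIV_minus[OF that] by (simp add: DERIV_imp_deriv)
    then have "AE t in lborel. a < t \<and> t < b \<longrightarrow> 0 \<le> q t \<and> deriv f t = - q t"
      using q(1,3) by auto
    then show ?thesis using q(2) by auto
  qed
  have "AE t in lborel. 1 / real (Suc k) < t \<and> t < real (Suc k) \<longrightarrow> deriv f t \<le> 0" for k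
  proof (cases "k = 0")
    case False
    then have "1 / real (Suc k) < 1" "1 < real (Suc k)" by simp_all
    then have "1 / real (Suc k) < real (Suc k)" by linarith
    then obtain q where "AE t in lborel. 1 / real (Suc k) < t \<and> t < real (Suc k) \<longrightarrow> 0 \<le> q t \<and> deriv f t = - q t"
      using local[of "1 / real (Suc k)" "real (Suc k)"] by auto
    then show ?thesis by eventually_elim auto
  qed auto
  then have AE1: "AE t in lborel. \<forall>k. 1 / real (Suc k) < t \<and> t < real (Suc k) \<longrightarrow> deriv f t \<le> 0"
    unfolding AE_all_countable by blast
  have "\<exists>k. 1 / real (Suc k) < t \<and> t < real (Suc k)" if "0 < t" for t
  proof -
    obtain k where k: "max t (1 / t) < real k" using reals_Archimedean2 by blast
    then have "1 / t < real (Suc k)" by simp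
    then have "1 / real (Suc k) < t" using that by (simp add: field_simps)
    then show ?thesis using k by (intro exI[of _ k]) auto
  qed
  with AE1 have AE2: "AE t in lborel. 0 < t \<longrightarrow> deriv f t \<le> 0" by (auto elim!: eventually_mono)
  have AE3: "AE t in lborel. t \<notin> Z"
    using Z AE_not_in[of Z lebesgue] by (simp add: AE_completion_iff)
  define D where "D = {t. 0 < t \<and> t \<notin> Z \<and> deriv f t \<le> 0}"
  have AED: "AE t in lborel. 0 < t \<longrightarrow> t \<in> D"
    using AE2 AE3 by eventually_elim (simp add: D_def)
  define h0 where "h0 t = - (t ^ m) * deriv f t" for t
  have h0: "0 \<le> h0 t" if "t \<in> D" for t
    using that by (simp add: D_def h0_def mult_nonneg_nonpos)
  have h0_anti: "h0 t \<le> h0 s" if "s \<in> D" "t \<in> D" "s \<le> t" for s t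
    using anti that by (auto simp: monotone_on_def D_def h0_def)
  have D_dense: "\<exists>s\<in>D. a < s \<and> s < b" if "0 \<le> a" "a < b" for a b
  proof (rule ccontr)
    assume "\<not> ?thesis"
    then have "AE t in lborel. t \<notin> {a<..<b}"
      using AED that by (auto elim!: eventually_mono)
    then have "{a<..<b} \<in> null_sets lborel"
      by (subst AE_iff_null_sets) auto
    then show False using that by (simp add: null_sets_def)
  qed
  \<comment> \<open>On D the supremum is attained at t itself, since h0 is non-increasing there.\<close>
  define h where "h t = Sup (h0 ` (D \<inter> {t..}))" for t
  have bdd: "bdd_above (h0 ` (D \<inter> {t..}))" if tpos: "0 < t" for t
  proof -
    obtain s where "s \<in> D" "s < t" using D_dense[OF order_refl tpos] by blast
    then show ?thesis by (intro bdd_aboveI[of _ "h0 s"]) (auto intro!: h0_anti)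
  qed
  have ne: "h0 ` (D \<inter> {t..}) \<noteq> {}" if tpos: "0 < t" for t
  proof -
    obtain s where "s \<in> D" "t < s" using D_dense[of t "t + 1", OF less_imp_le[OF tpos]] by force
    then show ?thesis by force
  qed
  have h_eq: "h t = h0 t" if "t \<in> D" for t
    unfolding h_def using that by (intro cSup_eq_maximum) (auto intro!: h0_anti)
  have h_nonneg: "0 \<le> h t" if tpos: "0 < t" for t
  proof -
    obtain s where s: "s \<in> D" "t < s" using D_dense[of t "t + 1", OF less_imp_le[OF tpos]] by force
    then have "h0 s \<le> h t" unfolding h_def by (intro cSup_upper bdd tpos) auto
    then show ?thesis using h0[OF s(1)] by linarith
  qed
  have h_anti: "antimono_on {0<..} h"
    by (intro monotone_onI) (auto simp: h_def intro!: cSup_subset_mono bdd ne)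
  have h_AE: "AE t in lborel. 0 < t \<longrightarrow> h t = - (t ^ m) * deriv f t"
    using AED by eventually_elim (auto simp: h_eq h0_def)
  have "(\<integral>\<^sup>+t\<in>{a..b}. ennreal (h t / t ^ m) \<partial>lborel) = ennreal (f a - f b)" if ab: "0 < a" "a \<le> b" for a b
  proof (cases "a = b")
    case True
    have "(\<integral>\<^sup>+t\<in>{b}. ennreal (h t / t ^ m) \<partial>lborel) = (\<integral>\<^sup>+t. ennreal (h b / b ^ m) * indicator {b} t \<partial>lborel)"
      by (intro nn_integral_cong) (auto split: split_indicator)
    then show ?thesis using True by (simp add: nn_integral_cmult)
  next
    case False
    then obtain q where q: "(\<integral>\<^sup>+t\<in>{a..b}. ennreal (q t) \<partial>lborel) = ennreal (f a - f b)"
      "AE t in lborel. a < t \<and> t < b \<longrightarrow> 0 \<le> q t \<and> deriv f t = - q t"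
      using local[of a b] ab by auto
    have "AE t in lborel. t \<noteq> a" "AE t in lborel. t \<noteq> b" by (rule AE_lborel_singleton)+
    then have "AE t in lborel. ennreal (h t / t ^ m) * indicator {a..b} t = ennreal (q t) * indicator {a..b} t"
      using q(2) h_AE
    proof eventually_elim
      case (elim t)
      show ?case
      proof (cases "t \<in> {a..b}")
        case True
        then have "h t = t ^ m * q t" "0 < t" using elim ab by auto
        then show ?thesis by simp
      qed simp
    qed
    then show ?thesis unfolding q(1)[symmetric] by (rule nn_integral_cong_AE)
  qed
  then show ?thesis using that h_anti h_nonneg h_AE by blast
qed

lemma borel_measurable_antimono_on_positive:
  fixes f :: "real \<Rightarrow> real"
  assumes "antimono_on {0<..} f"
  shows "(\<lambda>t. if 0 < t then f t else c) \<in> borel_measurable borel"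
proof -
  have "mono_on {0<..} (\<lambda>t. - f t)" using assms by (auto simp: monotone_on_def)
  then have "(\<lambda>t. - f t) \<in> borel_measurable (restrict_space borel {0<..})"
    by (rule borel_measurable_mono_on_fnc)
  then have "(\<lambda>t. - (- f t)) \<in> borel_measurable (restrict_space borel {0<..})"
    by (rule borel_measurable_uminus)
  then have "f \<in> borel_measurable (restrict_space borel {0<..})" by simp
  then have "(\<lambda>t. indicator {0<..} t *\<^sub>R f t) \<in> borel_measurable borel"
    by (subst (asm) borel_measurable_restrict_space_iff) simp_all
  then have "(\<lambda>t. indicator {0<..} t *\<^sub>R f t + indicator {..0} t * c) \<in> borel_measurable borel"
    by measurable
  also have "(\<lambda>t. indicator {0<..} t *\<^sub>R f t + indicator {..0} t * c) = (\<lambda>t. if 0 < t then f t else c)"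
    by (auto simp: fun_eq_iff)
  finally show ?thesis .
qed

section \<open>Gaussian functions and Fourier inversion\<close>

text \<open>The function \<open>exp (- (norm x)\<^sup>2 / 2)\<close>, written as a product over the coordinates, because
  its Fourier transform is computed coordinate by coordinate.\<close>

definition gauss :: "'a::euclidean_space \<Rightarrow> real" where
  "gauss x = (\<Prod>b\<in>Basis. exp (- (x \<bullet> b)\<^sup>2 / 2))"

lemma gauss_nonneg: "0 \<le> gauss x" unfolding gauss_def by (intro prod_nonneg) auto

lemma gauss_le_1: "gauss x \<le> 1" unfolding gauss_def by (intro prod_le_1) auto

lemma continuous_gauss: "continuous_on UNIV gauss"
  unfolding gauss_def by (intro continuous_intros) auto

lemma measurable_gauss [measurable]: "gauss \<in> borel_measurable borel"
  by (rule borel_measurable_continuous_onI[OF continuous_gauss])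

lemma std_normal_fourier:
  "integrable lborel (\<lambda>x. complex_of_real (exp (- x\<^sup>2 / 2)) * exp (\<i> * complex_of_real (x * s)))"
  "(LINT x|lborel. complex_of_real (exp (- x\<^sup>2 / 2)) * exp (\<i> * complex_of_real (x * s)))
     = complex_of_real (sqrt (2 * pi) * exp (- s\<^sup>2 / 2))"
proof -
  have eq: "complex_of_real (exp (- x\<^sup>2 / 2)) * exp (\<i> * complex_of_real (x * s))
      = complex_of_real (sqrt (2 * pi)) * (std_normal_density x *\<^sub>R iexp (s * x))" for x
    by (simp add: std_normal_density_def scaleR_conv_of_real mult.commute real_sqrt_mult)
  have "integrable std_normal_distribution (\<lambda>x. iexp (s * x))"
  proof -
    interpret prob_space std_normal_distribution by (rule prob_space_normal_density) simp
    show ?thesis by (rule integrable_const_bound[of _ 1]) auto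
  qed
  then have int: "integrable lborel (\<lambda>x. std_normal_density x *\<^sub>R iexp (s * x))"
    by (subst (asm) integrable_density) (simp_all add: normal_density_nonneg)
  then show "integrable lborel (\<lambda>x. complex_of_real (exp (- x\<^sup>2 / 2)) * exp (\<i> * complex_of_real (x * s)))"
    unfolding eq by (rule integrable_mult_right)
  have "(LINT x|lborel. std_normal_density x *\<^sub>R iexp (s * x)) = char std_normal_distribution s"
    unfolding char_def by (subst integral_density) (simp_all add: normal_density_nonneg)
  note * = this
  show "(LINT x|lborel. complex_of_real (exp (- x\<^sup>2 / 2)) * exp (\<i> * complex_of_real (x * s)))
     = complex_of_real (sqrt (2 * pi) * exp (- s\<^sup>2 / 2))"
    unfolding eq integral_mult_right_zero * char_std_normal_distribution by simp
qed

lemma gauss_fourier: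
  fixes \<xi> :: "'a::euclidean_space"
  shows "integrable lborel (\<lambda>x. complex_of_real (gauss x) * exp (\<i> * complex_of_real (x \<bullet> \<xi>)))"
    and "(LINT x|lborel. complex_of_real (gauss x) * exp (\<i> * complex_of_real (x \<bullet> \<xi>)))
     = complex_of_real (sqrt (2 * pi) ^ DIM('a) * gauss \<xi>)"
proof -
  interpret product_sigma_finite "\<lambda>b::'a. lborel :: real measure" ..
  let ?T = "\<lambda>f. (\<Sum>b\<in>Basis. f b *\<^sub>R b) :: 'a"
  let ?F = "\<lambda>x. complex_of_real (gauss x) * exp (\<i> * complex_of_real (x \<bullet> \<xi>))"
  let ?g = "\<lambda>b t. complex_of_real (exp (- t\<^sup>2 / 2)) * exp (\<i> * complex_of_real (t * (\<xi> \<bullet> b)))"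
  have T: "?T \<in> (\<Pi>\<^sub>M b\<in>Basis. lborel) \<rightarrow>\<^sub>M borel" by measurable
  have F: "?F \<in> borel_measurable borel" by measurable
  have FT: "?F (?T f) = (\<Prod>b\<in>Basis. ?g b (f b))" for f
  proof -
    have "?T f \<bullet> \<xi> = (\<Sum>b\<in>Basis. f b * (\<xi> \<bullet> b))"
      by (simp add: inner_sum_left inner_commute[of \<xi>])
    then have "exp (\<i> * complex_of_real (?T f \<bullet> \<xi>)) = (\<Prod>b\<in>Basis. exp (\<i> * complex_of_real (f b * (\<xi> \<bullet> b))))"
      by (simp add: exp_sum[symmetric] sum_distrib_left)
    moreover have "gauss (?T f) = (\<Prod>b\<in>Basis. exp (- (f b)\<^sup>2 / 2))"
      by (simp add: gauss_def)
    ultimately show ?thesis by (simp add: prod.distrib)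
  qed
  have "integrable (\<Pi>\<^sub>M b\<in>Basis. lborel) (\<lambda>f. \<Prod>b\<in>Basis. ?g b (f b))"
    by (intro product_integrable_prod std_normal_fourier) simp
  then show "integrable lborel ?F"
    unfolding lborel_eq[where 'a='a] using T F by (subst integrable_distr_eq) (simp_all only: FT)
  have "(LINT x|lborel. ?F x) = (LINT f|(\<Pi>\<^sub>M b\<in>Basis. lborel). ?F (?T f))"
    unfolding lborel_eq[where 'a='a] by (rule integral_distr[OF T F])
  also have "\<dots> = (\<Prod>b\<in>Basis. LINT t|lborel. ?g b t)"
    unfolding FT by (intro product_integral_prod std_normal_fourier) simp
  also have "\<dots> = (\<Prod>b\<in>(Basis::'a set). complex_of_real (sqrt (2 * pi) * exp (- (\<xi> \<bullet> b)\<^sup>2 / 2)))"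
    by (simp only: std_normal_fourier)
  also have "\<dots> = complex_of_real (sqrt (2 * pi) ^ DIM('a) * gauss \<xi>)"
    by (simp add: gauss_def prod.distrib flip: of_real_prod)
  finally show "(LINT x|lborel. ?F x) = complex_of_real (sqrt (2 * pi) ^ DIM('a) * gauss \<xi>)" .
qed

lemma integrable_gauss: "integrable lborel (gauss :: 'a::euclidean_space \<Rightarrow> real)"
  using gauss_fourier(1)[of "0::'a"] by (simp add: complex_of_real_integrable_eq)

lemma integral_gauss: "(LINT x|lborel. gauss (x::'a::euclidean_space)) = sqrt (2 * pi) ^ DIM('a)"
proof -
  have "complex_of_real (LINT x|lborel. gauss (x::'a)) = complex_of_real (sqrt (2 * pi) ^ DIM('a))"
    using gauss_fourier(2)[of "0::'a"] by (simp add: gauss_def[of "0::'a"])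
  then show ?thesis by (simp only: of_real_eq_iff)
qed

text \<open>The integral is regularized by the factor \<open>gauss (\<epsilon> *\<^sub>R \<xi>)\<close>. By Fubini's theorem and the known transform of
  the Gaussian function, the regularized integral is an average of \<open>\<phi> (x - \<epsilon> *\<^sub>R z)\<close> over z with a
  Gaussian weight. Dominated convergence applies on both sides as \<open>\<epsilon>\<close> tends to 0.\<close>

lemma fourier_inversion:
  fixes \<phi> :: "real ^ 'n::finite \<Rightarrow> complex"
  assumes cont: "continuous_on UNIV \<phi>" and bdd: "\<And>x. norm (\<phi> x) \<le> B"
    and int: "integrable lborel \<phi>" and int': "integrable lborel (fourier \<phi>)"
  shows "(LINT \<xi>|lborel. fourier \<phi> \<xi> * exp (\<i> * complex_of_real (x \<bullet> \<xi>)))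
     = complex_of_real ((2 * pi) ^ CARD('n)) * \<phi> x"
proof (rule LIMSEQ_unique)
  have [measurable]: "\<phi> \<in> borel_measurable borel" "fourier \<phi> \<in> borel_measurable borel"
    using borel_measurable_integrable[OF int] borel_measurable_integrable[OF int'] by simp_all
  define \<epsilon> where "\<epsilon> k = 1 / real (Suc k)" for k
  have \<epsilon>: "0 < \<epsilon> k" for k by (simp add: \<epsilon>_def)
  have \<epsilon>0: "\<epsilon> \<longlonglongrightarrow> 0" unfolding \<epsilon>_def using LIMSEQ_inverse_real_of_nat by (simp add: inverse_eq_divide)
  let ?I = "\<lambda>k. LINT \<xi>|lborel. (complex_of_real (gauss (\<epsilon> k *\<^sub>R \<xi>)) * fourier \<phi> \<xi>) * exp (\<i> * complex_of_real (x \<bullet> \<xi>))"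
  have gauss_lim: "(\<lambda>k. gauss (\<epsilon> k *\<^sub>R y)) \<longlonglongrightarrow> 1" for y :: "real ^ 'n"
  proof -
    have "(\<lambda>k. gauss (\<epsilon> k *\<^sub>R y)) \<longlonglongrightarrow> gauss (0 *\<^sub>R y)"
      by (intro isCont_tendsto_compose[where g=gauss] tendsto_intros \<epsilon>0)
         (use continuous_gauss[where 'a="real ^ 'n"] in \<open>simp add: continuous_on_eq_continuous_at\<close>)
    then show ?thesis by (simp add: gauss_def)
  qed
  show "?I \<longlonglongrightarrow> (LINT \<xi>|lborel. fourier \<phi> \<xi> * exp (\<i> * complex_of_real (x \<bullet> \<xi>)))"
  proof (rule integral_dominated_convergence)
    show "integrable lborel (\<lambda>\<xi>. norm (fourier \<phi> \<xi>))" using int' by simp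
    show "AE \<xi> in lborel. (\<lambda>k. (complex_of_real (gauss (\<epsilon> k *\<^sub>R \<xi>)) * fourier \<phi> \<xi>) * exp (\<i> * complex_of_real (x \<bullet> \<xi>)))
        \<longlonglongrightarrow> fourier \<phi> \<xi> * exp (\<i> * complex_of_real (x \<bullet> \<xi>))"
    proof (rule AE_I2)
      fix \<xi> :: "real ^ 'n"
      have "(\<lambda>k. (complex_of_real (gauss (\<epsilon> k *\<^sub>R \<xi>)) * fourier \<phi> \<xi>) * exp (\<i> * complex_of_real (x \<bullet> \<xi>)))
        \<longlonglongrightarrow> (complex_of_real 1 * fourier \<phi> \<xi>) * exp (\<i> * complex_of_real (x \<bullet> \<xi>))"
        by (intro tendsto_intros gauss_lim)
      then show "(\<lambda>k. (complex_of_real (gauss (\<epsilon> k *\<^sub>R \<xi>)) * fourier \<phi> \<xi>) * exp (\<i> * complex_of_real (x \<bullet> \<xi>)))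
        \<longlonglongrightarrow> fourier \<phi> \<xi> * exp (\<i> * complex_of_real (x \<bullet> \<xi>))" by simp
    qed
    show "AE \<xi> in lborel. norm ((complex_of_real (gauss (\<epsilon> k *\<^sub>R \<xi>)) * fourier \<phi> \<xi>) * exp (\<i> * complex_of_real (x \<bullet> \<xi>)))
        \<le> norm (fourier \<phi> \<xi>)" for k
      by (rule AE_I2) (simp add: norm_mult gauss_nonneg mult_left_le_one_le gauss_le_1)
  qed measurable
  have I: "?I k = complex_of_real (sqrt (2 * pi) ^ CARD('n)) *
      (LINT z|lborel. complex_of_real (gauss z) * \<phi> (x + (- \<epsilon> k) *\<^sub>R z))" for k
  proof -
    define e where "e = \<epsilon> k"
    have e: "0 < e" using \<epsilon> by (simp add: e_def)
    let ?G = "\<lambda>\<xi>::real ^ 'n. complex_of_real (gauss (e *\<^sub>R \<xi>)) * exp (\<i> * complex_of_real (x \<bullet> \<xi>))"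
    let ?u = "\<lambda>p::(real ^ 'n) \<times> (real ^ 'n). exp (- (\<i> * complex_of_real (snd p \<bullet> fst p)))"
    have "integrable lborel (\<lambda>\<xi>::real^'n. gauss (0 + e *\<^sub>R \<xi>))"
      using e by (intro lborel_integrable_affine integrable_gauss) simp
    then have intG: "integrable lborel ?G"
      by (rule Bochner_Integration.integrable_bound[OF _ _ AE_I2]) (auto simp: norm_mult gauss_nonneg)
    have inner: "(LINT \<xi>|lborel. ?G \<xi> * ?u (\<xi>, y)) =
        complex_of_real (inverse e ^ CARD('n) * (sqrt (2 * pi) ^ CARD('n) * gauss ((1/e) *\<^sub>R (x - y))))" for y
    proof -
      have kern: "?G \<xi> * ?u (\<xi>, y) = complex_of_real (gauss (e *\<^sub>R \<xi>)) * exp (\<i> * complex_of_real ((e *\<^sub>R \<xi>) \<bullet> ((1/e) *\<^sub>R (x - y))))" for \<xi>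
        using e by (simp add: mult.assoc exp_add[symmetric] inner_diff_right inner_commute algebra_simps)
      have "(LINT \<xi>|lborel. ?G \<xi> * ?u (\<xi>, y)) =
          (LINT \<xi>|lborel. complex_of_real (gauss (0 + e *\<^sub>R \<xi>)) * exp (\<i> * complex_of_real ((0 + e *\<^sub>R \<xi>) \<bullet> ((1/e) *\<^sub>R (x - y)))))"
        unfolding kern add_0 ..
      also have "\<dots> = inverse (e ^ CARD('n)) *\<^sub>R (LINT \<eta>|lborel. complex_of_real (gauss \<eta>) * exp (\<i> * complex_of_real (\<eta> \<bullet> ((1/e) *\<^sub>R (x - y)))))"
        by (subst lborel_integral_affine[where c=e and t="0::real^'n" and F="\<lambda>\<eta>. complex_of_real (gauss \<eta>) * exp (\<i> * complex_of_real (\<eta> \<bullet> ((1/e) *\<^sub>R (x - y))))"])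
           (use e in simp_all)
      finally show ?thesis unfolding gauss_fourier(2)
        by (simp add: scaleR_conv_of_real power_inverse)
    qed
    have "?I k = (LINT \<xi>|lborel. ?G \<xi> * (LINT y|lborel. \<phi> y * ?u (\<xi>, y)))"
      by (simp add: fourier_def e_def ac_simps)
    also have "\<dots> = (LINT y|lborel. \<phi> y * (LINT \<xi>|lborel. ?G \<xi> * ?u (\<xi>, y)))"
      by (rule Fubini_product_bounded_kernel[OF intG int])
         (simp_all, intro borel_measurable_continuous_onI continuous_intros)
    also have "\<dots> = (e ^ CARD('n)) *\<^sub>R (LINT z|lborel. \<phi> (x + (- e) *\<^sub>R z) *
        complex_of_real (inverse e ^ CARD('n) * (sqrt (2 * pi) ^ CARD('n) * gauss ((1/e) *\<^sub>R (x - (x + (- e) *\<^sub>R z))))))"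
      unfolding inner using e
      by (subst lborel_integral_affine[where c="- e" and t=x]) simp_all
    also have "\<dots> = (e ^ CARD('n)) *\<^sub>R (LINT z|lborel. complex_of_real (inverse e ^ CARD('n) * sqrt (2 * pi) ^ CARD('n)) *
        (complex_of_real (gauss z) * \<phi> (x + (- e) *\<^sub>R z)))"
      using e by (simp add: ac_simps)
    also have "\<dots> = complex_of_real (sqrt (2 * pi) ^ CARD('n)) *
      (LINT z|lborel. complex_of_real (gauss z) * \<phi> (x + (- e) *\<^sub>R z))"
      unfolding integral_mult_right_zero using e
      by (simp add: scaleR_conv_of_real power_inverse field_simps)
    finally show ?thesis unfolding e_def .
  qed
  have "(\<lambda>k. LINT z|lborel. complex_of_real (gauss z) * \<phi> (x + (- \<epsilon> k) *\<^sub>R z))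
      \<longlonglongrightarrow> (LINT z|lborel. complex_of_real (gauss (z::real^'n)) * \<phi> x)"
  proof (rule integral_dominated_convergence)
    show "integrable lborel (\<lambda>z::real^'n. gauss z * B)" by (intro integrable_mult_left integrable_gauss)
    show "AE z in lborel. (\<lambda>k. complex_of_real (gauss z) * \<phi> (x + (- \<epsilon> k) *\<^sub>R z)) \<longlonglongrightarrow> complex_of_real (gauss z) * \<phi> x"
    proof (rule AE_I2)
      fix z :: "real ^ 'n"
      have "(\<lambda>k. x + (- \<epsilon> k) *\<^sub>R z) \<longlonglongrightarrow> x + (- 0) *\<^sub>R z" by (intro tendsto_intros \<epsilon>0)
      then have "(\<lambda>k. \<phi> (x + (- \<epsilon> k) *\<^sub>R z)) \<longlonglongrightarrow> \<phi> x"
        using cont by (intro isCont_tendsto_compose[where g=\<phi>]) (simp_all add: continuous_on_eq_continuous_at)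
      then show "(\<lambda>k. complex_of_real (gauss z) * \<phi> (x + (- \<epsilon> k) *\<^sub>R z)) \<longlonglongrightarrow> complex_of_real (gauss z) * \<phi> x"
        by (rule tendsto_mult_left)
    qed
    show "AE z in lborel. norm (complex_of_real (gauss z) * \<phi> (x + (- \<epsilon> k) *\<^sub>R z)) \<le> gauss z * B" for k
      by (rule AE_I2) (simp add: norm_mult gauss_nonneg mult_left_mono bdd)
  qed measurable
  also have "(LINT z|lborel. complex_of_real (gauss (z::real^'n)) * \<phi> x) = complex_of_real (sqrt (2 * pi) ^ CARD('n)) * \<phi> x"
    by (simp add: integral_gauss)
  finally have "?I \<longlonglongrightarrow> complex_of_real (sqrt (2 * pi) ^ CARD('n)) * (complex_of_real (sqrt (2 * pi) ^ CARD('n)) * \<phi> x)"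
    unfolding I by (rule tendsto_mult_left)
  moreover have "complex_of_real (sqrt (2 * pi) ^ CARD('n)) * (complex_of_real (sqrt (2 * pi) ^ CARD('n)) * \<phi> x)
      = complex_of_real ((2 * pi) ^ CARD('n)) * \<phi> x"
  proof -
    have "sqrt (2 * pi) ^ CARD('n) * sqrt (2 * pi) ^ CARD('n) = (2 * pi) ^ CARD('n)"
      unfolding power_mult_distrib[symmetric] by simp
    then show ?thesis by (metis mult.assoc of_real_mult)
  qed
  ultimately show "?I \<longlonglongrightarrow> complex_of_real ((2 * pi) ^ CARD('n)) * \<phi> x"
    by (rule back_subst)
qed

section \<open>Norms and radial integrals\<close>

lemma is_normD:
  assumes "is_norm N"
  shows is_norm_nonneg: "0 \<le> N x" and is_norm_eq_0: "N x = 0 \<longleftrightarrow> x = 0"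
    and is_norm_scaleR: "N (c *\<^sub>R x) = \<bar>c\<bar> * N x" and is_norm_triangle: "N (x + y) \<le> N x + N y"
  using assms unfolding is_norm_def by blast+

lemma is_norm_norm: "is_norm norm"
  by (auto simp: is_norm_def norm_triangle_ineq)

lemma is_norm_zero: "is_norm N \<Longrightarrow> N 0 = 0" by (simp add: is_norm_eq_0)

lemma is_norm_minus: "is_norm N \<Longrightarrow> N (- x) = N x"
  using is_norm_scaleR[of N "-1" x] by simp

lemma is_norm_le_norm:
  fixes N :: "'a::euclidean_space \<Rightarrow> real"
  assumes N: "is_norm N"
  shows "N x \<le> (\<Sum>b\<in>Basis. N b) * norm x"
proof -
  have sum: "N (\<Sum>b\<in>A. (x \<bullet> b) *\<^sub>R b) \<le> (\<Sum>b\<in>A. \<bar>x \<bullet> b\<bar> * N b)" if "finite A" for A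
    using that
  proof (induction A)
    case (insert a A)
    have "N ((x \<bullet> a) *\<^sub>R a + (\<Sum>b\<in>A. (x \<bullet> b) *\<^sub>R b)) \<le> N ((x \<bullet> a) *\<^sub>R a) + N (\<Sum>b\<in>A. (x \<bullet> b) *\<^sub>R b)"
      by (rule is_norm_triangle[OF N])
    then show ?case using insert by (simp add: is_norm_scaleR[OF N])
  qed (simp add: is_norm_zero[OF N])
  have "N x \<le> (\<Sum>b\<in>Basis. \<bar>x \<bullet> b\<bar> * N b)"
    using sum[OF finite_Basis] by (simp add: euclidean_representation)
  also have "\<dots> \<le> (\<Sum>b\<in>Basis. norm x * N b)"
    by (intro sum_mono mult_right_mono Basis_le_norm is_norm_nonneg[OF N])
  finally show ?thesis by (simp add: sum_distrib_left mult.commute)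
qed

lemma continuous_on_is_norm:
  fixes N :: "'a::euclidean_space \<Rightarrow> real"
  assumes N: "is_norm N"
  shows "continuous_on UNIV N"
proof -
  define C where "C = (\<Sum>b\<in>Basis. N b)"
  have "0 \<le> C" unfolding C_def by (intro sum_nonneg is_norm_nonneg[OF N])
  have "N x - N y \<le> C * norm (x - y)" for x y
    using is_norm_triangle[OF N, of "x - y" y] is_norm_le_norm[OF N, of "x - y"] by (simp add: C_def)
  from this this[of y x for x y] have "\<bar>N x - N y\<bar> \<le> C * norm (x - y)" for x y
    by (metis abs_le_iff minus_diff_eq norm_minus_commute)
  then have "C-lipschitz_on UNIV N"
    using \<open>0 \<le> C\<close> by (auto simp: lipschitz_on_def dist_real_def dist_norm)
  then show ?thesis by (rule lipschitz_on_continuous_on)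
qed

lemma norm_le_is_norm:
  fixes N :: "'a::euclidean_space \<Rightarrow> real"
  assumes N: "is_norm N"
  obtains c where "0 < c" "\<And>x. c * norm x \<le> N x"
proof -
  obtain b :: 'a where "b \<in> Basis" using nonempty_Basis by blast
  then have "sphere (0::'a) 1 \<noteq> {}" by (auto intro!: exI[of _ b])
  then obtain y where y: "y \<in> sphere 0 1" "\<And>z. z \<in> sphere 0 1 \<Longrightarrow> N y \<le> N z"
    using continuous_attains_inf[of "sphere (0::'a) 1" N] continuous_on_subset[OF continuous_on_is_norm[OF N]]
    by (metis compact_sphere subset_UNIV)
  have "N y \<noteq> 0" using y(1) by (auto simp: is_norm_eq_0[OF N])
  then have pos: "0 < N y" using is_norm_nonneg[OF N, of y] by simp
  have "N y * norm x \<le> N x" for x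
  proof (cases "x = 0")
    case False
    have "N y \<le> N ((1 / norm x) *\<^sub>R x)" using False by (intro y(2)) simp
    then show ?thesis using False by (simp add: is_norm_scaleR[OF N] field_simps)
  qed (simp add: is_norm_zero[OF N])
  then show thesis using that pos by blast
qed

lemma unit_ball_is_norm:
  fixes N :: "'a::euclidean_space \<Rightarrow> real"
  assumes N: "is_norm N"
  shows "compact {x. N x \<le> 1}" "convex {x. N x \<le> 1}"
proof -
  obtain c where c: "0 < c" "\<And>x. c * norm x \<le> N x" by (rule norm_le_is_norm[OF N]) (rule that; assumption)
  have "norm x \<le> 1 / c" if "N x \<le> 1" for x
    using c(1) c(2)[of x] that by (simp add: field_simps)
  then have "bounded {x. N x \<le> 1}" unfolding bounded_iff by blast
  moreover have "closed {x. N x \<le> 1}"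
    by (intro closed_Collect_le continuous_on_is_norm[OF N] continuous_intros)
  ultimately show "compact {x. N x \<le> 1}" by (simp add: compact_eq_bounded_closed)
  show "convex {x. N x \<le> 1}"
  proof (rule convexI)
    fix x y :: 'a and u v :: real
    assume *: "x \<in> {x. N x \<le> 1}" "y \<in> {x. N x \<le> 1}" "0 \<le> u" "0 \<le> v" "u + v = 1"
    have "N (u *\<^sub>R x + v *\<^sub>R y) \<le> N (u *\<^sub>R x) + N (v *\<^sub>R y)" by (rule is_norm_triangle[OF N])
    also have "\<dots> = u * N x + v * N y" using *(3,4) by (simp add: is_norm_scaleR[OF N])
    also have "\<dots> \<le> u * 1 + v * 1" using * by (intro add_mono mult_left_mono) auto
    finally show "u *\<^sub>R x + v *\<^sub>R y \<in> {x. N x \<le> 1}" using *(5) by simp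
  qed
qed

lemma measurable_is_norm:
  fixes N :: "'a::euclidean_space \<Rightarrow> real"
  assumes "is_norm N" shows "N \<in> borel_measurable borel"
  by (rule borel_measurable_continuous_onI[OF continuous_on_is_norm[OF assms]])

lemma emeasure_ball_is_norm:
  fixes N :: "'a::euclidean_space \<Rightarrow> real"
  assumes N: "is_norm N" and s: "0 < s"
  shows "emeasure lborel {x. N x \<le> s} = ennreal (s ^ DIM('a)) * emeasure lborel {x. N x \<le> 1}"
proof -
  have [measurable]: "N \<in> borel_measurable borel" by (rule measurable_is_norm[OF N])
  have "emeasure lborel {x. N x \<le> s} = (\<integral>\<^sup>+x. indicator {x. N x \<le> s} x \<partial>lborel)" by simp
  also have "\<dots> = ennreal (\<bar>s\<bar> ^ DIM('a)) * (\<integral>\<^sup>+x. indicator {x. N x \<le> s} (0 + s *\<^sub>R x) \<partial>lborel)"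
    using s by (intro nn_integral_lborel_affine) simp_all
  also have "(\<integral>\<^sup>+x. indicator {x. N x \<le> s} (0 + s *\<^sub>R x) \<partial>lborel) = (\<integral>\<^sup>+x. indicator {x. N x \<le> 1} x \<partial>lborel)"
    using s by (intro nn_integral_cong) (simp add: indicator_def is_norm_scaleR[OF N])
  finally show ?thesis using s by simp
qed

text \<open>By Tonelli's theorem the left side is the integral of Q s times the volume of the ball
  \<open>{x. N x \<le> s}\<close>, which scales like the power \<open>DIM('a)\<close> of s.\<close>

lemma nn_integral_radial:
  fixes N :: "'a::euclidean_space \<Rightarrow> real" and Q :: "real \<Rightarrow> ennreal"
  assumes N: "is_norm N" and [measurable]: "Q \<in> borel_measurable borel"
  shows "(\<integral>\<^sup>+x. (\<integral>\<^sup>+s. Q s * indicator {s. 0 < s \<and> N x \<le> s} s \<partial>lborel) \<partial>lborel)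
    = emeasure lborel {x. N x \<le> 1} * (\<integral>\<^sup>+s. (ennreal (s ^ DIM('a)) * Q s) * indicator {0<..} s \<partial>lborel)"
proof -
  have [measurable]: "N \<in> borel_measurable borel" by (rule measurable_is_norm[OF N])
  have "(\<integral>\<^sup>+x. (\<integral>\<^sup>+s. Q s * indicator {s. 0 < s \<and> N x \<le> s} s \<partial>lborel) \<partial>lborel)
      = (\<integral>\<^sup>+s. (\<integral>\<^sup>+x. Q s * indicator {s. 0 < s \<and> N x \<le> s} s \<partial>lborel) \<partial>lborel)"
    unfolding indicator_def mem_Collect_eq by (rule lborel_pair.Fubini') measurable
  also have "\<dots> = (\<integral>\<^sup>+s. emeasure lborel {x. N x \<le> 1} * ((ennreal (s ^ DIM('a)) * Q s) * indicator {0<..} s) \<partial>lborel)"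
  proof (intro nn_integral_cong)
    fix s
    have "(\<integral>\<^sup>+x. Q s * indicator {s. 0 < s \<and> N x \<le> s} s \<partial>lborel)
      = (\<integral>\<^sup>+x. (Q s * indicator {0<..} s) * indicator {x. N x \<le> s} x \<partial>lborel)"
      by (intro nn_integral_cong) (auto split: split_indicator)
    also have "\<dots> = (Q s * indicator {0<..} s) * emeasure lborel {x. N x \<le> s}"
      by (simp add: nn_integral_cmult)
    also have "\<dots> = emeasure lborel {x. N x \<le> 1} * ((ennreal (s ^ DIM('a)) * Q s) * indicator {0<..} s)"
    proof (cases "0 < s")
      case True
      show ?thesis unfolding emeasure_ball_is_norm[OF N True] using True by (simp add: ac_simps)
    qed simp
    finally show "(\<integral>\<^sup>+x. Q s * indicator {s. 0 < s \<and> N x \<le> s} s \<partial>lborel) = \<dots>" .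
  qed
  also have "\<dots> = emeasure lborel {x. N x \<le> 1} * (\<integral>\<^sup>+s. (ennreal (s ^ DIM('a)) * Q s) * indicator {0<..} s \<partial>lborel)"
    by (rule nn_integral_cmult) measurable
  finally show ?thesis .
qed

lemma emeasure_unit_ball_finite:
  fixes N :: "'a::euclidean_space \<Rightarrow> real"
  assumes N: "is_norm N"
  shows "emeasure lborel {x. N x \<le> 1} < \<infinity>"
  by (rule emeasure_compact_finite[OF unit_ball_is_norm(1)[OF N]])

text \<open>The weight is compared with the integral of \<open>1 / (1 + s) ^ (DIM('a) + 2)\<close> over \<open>s \<ge> norm x\<close>, a radial function to
  which \<open>nn_integral_radial\<close> applies: the part of that integral within distance one of norm x
  already bounds the weight from above up to a constant factor.\<close>

lemma integrable_polynomial_decay: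
  "integrable lborel (\<lambda>x::'a::euclidean_space. 1 / (1 + norm x) ^ (DIM('a) + 2))"
proof -
  let ?n = "DIM('a)"
  define Q where "Q s = ennreal (1 / (1 + s) ^ (?n + 2))" for s :: real
  have [measurable]: "Q \<in> borel_measurable borel" unfolding Q_def by measurable
  have lower: "ennreal (1 / (1 + norm x) ^ (?n + 2)) \<le>
      ennreal (2 ^ (?n + 2)) * (\<integral>\<^sup>+s. Q s * indicator {s. 0 < s \<and> norm x \<le> s} s \<partial>lborel)" for x :: 'a
  proof -
    have "1 / (1 + norm x) ^ (?n + 2) \<le> 2 ^ (?n + 2) * (1 / (2 + norm x) ^ (?n + 2))"
    proof -
      have "(2 + norm x) ^ (?n + 2) \<le> (2 * (1 + norm x)) ^ (?n + 2)" by (intro power_mono) auto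
      then show ?thesis unfolding power_mult_distrib
        using zero_less_power[of "1 + norm x" "?n + 2"] zero_less_power[of "2 + norm x" "?n + 2"]
        by (simp add: divide_simps add_pos_nonneg mult.commute)
    qed
    moreover have "ennreal (1 / (2 + norm x) ^ (?n + 2)) \<le> (\<integral>\<^sup>+s. Q s * indicator {s. 0 < s \<and> norm x \<le> s} s \<partial>lborel)"
    proof -
      have "ennreal (1 / (2 + norm x) ^ (?n + 2)) =
          (\<integral>\<^sup>+s. ennreal (1 / (2 + norm x) ^ (?n + 2)) * indicator {norm x<..norm x + 1} s \<partial>lborel)"
        by (simp add: nn_integral_cmult)
      also have "\<dots> \<le> (\<integral>\<^sup>+s. Q s * indicator {s. 0 < s \<and> norm x \<le> s} s \<partial>lborel)"
      proof (intro nn_integral_mono)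
        fix s
        show "ennreal (1 / (2 + norm x) ^ (?n + 2)) * indicator {norm x<..norm x + 1} s
            \<le> Q s * indicator {s. 0 < s \<and> norm x \<le> s} s"
        proof (cases "s \<in> {norm x<..norm x + 1}")
          case True
          then have s: "norm x < s" "s \<le> norm x + 1" by auto
          then have s0: "0 < s" using le_less_trans[OF norm_ge_zero[of x]] by blast
          then have "(1 + s) ^ (?n + 2) \<le> (2 + norm x) ^ (?n + 2)" using s s0 by (intro power_mono) auto
          then have "1 / (2 + norm x) ^ (?n + 2) \<le> 1 / (1 + s) ^ (?n + 2)"
            using s0 by (intro divide_left_mono mult_pos_pos zero_less_power add_pos_nonneg) auto
          then have "ennreal (1 / (2 + norm x) ^ (?n + 2)) \<le> Q s" unfolding Q_def by (rule ennreal_leI)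
          then show ?thesis using s s0 by simp
        qed simp
      qed
      finally show ?thesis .
    qed
    ultimately show ?thesis
      by (smt (verit) ennreal_leI ennreal_mult' mult_left_mono order_trans zero_le zero_le_power)
  qed
  have "(\<integral>\<^sup>+x. ennreal (1 / (1 + norm (x::'a)) ^ (?n + 2)) \<partial>lborel)
      \<le> (\<integral>\<^sup>+x. ennreal (2 ^ (?n + 2)) * (\<integral>\<^sup>+s. Q s * indicator {s. 0 < s \<and> norm (x::'a) \<le> s} s \<partial>lborel) \<partial>lborel)"
    by (intro nn_integral_mono lower)
  also have "\<dots> = ennreal (2 ^ (?n + 2)) * (\<integral>\<^sup>+x. (\<integral>\<^sup>+s. Q s * indicator {s. 0 < s \<and> norm (x::'a) \<le> s} s \<partial>lborel) \<partial>lborel)"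
    unfolding indicator_def mem_Collect_eq by (rule nn_integral_cmult) measurable
  also have "\<dots> = ennreal (2 ^ (?n + 2)) * (emeasure lborel {x::'a. norm x \<le> 1} *
      (\<integral>\<^sup>+s. (ennreal (s ^ ?n) * Q s) * indicator {0<..} s \<partial>lborel))"
    by (subst nn_integral_radial[OF is_norm_norm]) simp_all
  also have "\<dots> \<le> ennreal (2 ^ (?n + 2)) * (emeasure lborel {x::'a. norm x \<le> 1} * 1)"
  proof (intro mult_left_mono)
    have "(\<integral>\<^sup>+s. (ennreal (s ^ ?n) * Q s) * indicator {0<..} s \<partial>lborel) \<le>
       (\<integral>\<^sup>+s. ennreal (1 / (1 + s)\<^sup>2) * indicator {0..} s \<partial>lborel)"
    proof (intro nn_integral_mono)
      fix s :: real
      show "(ennreal (s ^ ?n) * Q s) * indicator {0<..} s \<le> ennreal (1 / (1 + s)\<^sup>2) * indicator {0..} s"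
      proof (cases "0 < s")
        case True
        have "s ^ ?n * (1 / (1 + s) ^ (?n + 2)) \<le> (1 + s) ^ ?n * (1 / (1 + s) ^ (?n + 2))"
          using True by (intro mult_right_mono power_mono) auto
        also have "\<dots> = 1 / (1 + s)\<^sup>2" using True by (simp add: power_add power2_eq_square)
        finally show ?thesis using True by (simp add: Q_def ennreal_mult'[symmetric] ennreal_leI)
      qed simp
    qed
    also have "\<dots> = ennreal (0 - (- 1 / (1 + 0)))"
    proof (rule nn_integral_FTC_atLeast)
      show "((\<lambda>s::real. - 1 / (1 + s)) \<longlongrightarrow> 0) at_top"
        by (intro tendsto_divide_0[OF tendsto_const] filterlim_at_top_imp_at_infinity
            filterlim_tendsto_add_at_top[OF tendsto_const] filterlim_ident)
      show "((\<lambda>s. - 1 / (1 + s)) has_real_derivative 1 / (1 + s)\<^sup>2) (at s)" if "0 \<le> s" for s :: real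
        using that by (auto intro!: derivative_eq_intros simp: power2_eq_square)
    qed auto
    finally show "(\<integral>\<^sup>+s. (ennreal (s ^ ?n) * Q s) * indicator {0<..} s \<partial>lborel) \<le> 1" by simp
  qed auto
  also have "\<dots> < \<infinity>"
    using emeasure_unit_ball_finite[OF is_norm_norm[where 'a='a]] by (simp add: ennreal_mult_less_top)
  finally show ?thesis
    by (intro integrableI_nonneg) auto
qed

section \<open>Fourier transforms of Schwartz functions\<close>

lemma integrable_if_polynomial_decay:
  fixes F :: "'a::euclidean_space \<Rightarrow> 'b::{banach,second_countable_topology}"
  assumes "F \<in> borel_measurable borel" and bd: "\<And>x. (1 + norm x) ^ (DIM('a) + 2) * norm (F x) \<le> C"
  shows "integrable lborel F"
proof (rule Bochner_Integration.integrable_bound)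
  show "integrable lborel (\<lambda>x::'a. C * (1 / (1 + norm x) ^ (DIM('a) + 2)))"
    by (intro integrable_mult_right integrable_polynomial_decay)
  have "norm (F x) \<le> C * (1 / (1 + norm x) ^ (DIM('a) + 2))" for x
  proof -
    have "0 < (1 + norm x) ^ (DIM('a) + 2)" by (intro zero_less_power add_pos_nonneg) auto
    then show ?thesis using bd[of x] by (simp add: pos_le_divide_eq mult.commute)
  qed
  then show "AE x in lborel. norm (F x) \<le> norm (C * (1 / (1 + norm x) ^ (DIM('a) + 2)))"
    by (intro AE_I2) (smt (verit) real_norm_def)
qed (use assms in simp)

text \<open>Integrate \<open>\<Psi> (x + d) - \<Psi> x = \<integral> D (x + s d) ds\<close>, where s runs from 0 to 1, over all x. By
  translation invariance the left side gives 0 and the right side gives the integral of D.\<close>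

lemma integral_directional_derivative_eq_0:
  fixes \<Psi> D :: "'a::euclidean_space \<Rightarrow> complex"
  assumes int: "integrable lborel \<Psi>" and intD: "integrable lborel D" and cont: "continuous_on UNIV D"
    and deriv: "\<And>x. ((\<lambda>t. \<Psi> (x + t *\<^sub>R d)) has_vector_derivative D x) (at 0)"
  shows "(LINT x|lborel. D x) = 0"
proof -
  have [measurable]: "D \<in> borel_measurable borel" using cont by (rule borel_measurable_continuous_onI)
  have [measurable]: "\<Psi> \<in> borel_measurable borel" using borel_measurable_integrable[OF int] by simp
  have FTC: "(LINT s|lborel. indicator {0..1} s *\<^sub>R D (x + s *\<^sub>R d)) = \<Psi> (x + d) - \<Psi> x" for x
  proof -
    have der: "((\<lambda>t. \<Psi> (x + t *\<^sub>R d)) has_vector_derivative D (x + s *\<^sub>R d)) (at s)" for s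
    proof -
      have "((\<lambda>t. t - s) has_real_derivative 1) (at s)" by (auto intro!: derivative_eq_intros)
      moreover have "((\<lambda>t. \<Psi> ((x + s *\<^sub>R d) + t *\<^sub>R d)) has_vector_derivative D (x + s *\<^sub>R d)) (at (s - s))"
        using deriv[of "x + s *\<^sub>R d"] by simp
      ultimately have "((\<lambda>t. \<Psi> ((x + s *\<^sub>R d) + t *\<^sub>R d)) \<circ> (\<lambda>t. t - s) has_vector_derivative (1 *\<^sub>R D (x + s *\<^sub>R d))) (at s)"
        by (intro vector_diff_chain_at) (simp_all add: has_real_derivative_iff_has_vector_derivative)
      moreover have "(\<lambda>t. \<Psi> ((x + s *\<^sub>R d) + t *\<^sub>R d)) \<circ> (\<lambda>t. t - s) = (\<lambda>t. \<Psi> (x + t *\<^sub>R d))"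
        by (auto simp: scaleR_diff_left)
      ultimately show ?thesis by simp
    qed
    have "continuous_on {0..1} (\<lambda>s. D (x + s *\<^sub>R d))"
      by (intro continuous_on_compose2[OF cont] continuous_intros) auto
    from integral_FTC_Icc[OF zero_le_one has_vector_derivative_at_within[OF der] this]
    show ?thesis by simp
  qed
  have "integrable (lborel \<Otimes>\<^sub>M lborel) (\<lambda>(s, x). indicator {0..1::real} s *\<^sub>R D (x + s *\<^sub>R d))"
  proof (rule lborel_pair.Fubini_integrable)
    have shift: "(LINT x|lborel. norm (D (x + s *\<^sub>R d))) = (LINT x|lborel. norm (D x))" for s
      using lborel_integral_affine[of "\<lambda>x. norm (D x)" 1 "s *\<^sub>R d"] by (simp add: add.commute)
    have shift_int: "integrable lborel (\<lambda>x. D (x + s *\<^sub>R d))" for s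
      using lborel_integrable_affine[OF intD, of 1 "s *\<^sub>R d"] by (simp add: add.commute)
    show "integrable lborel (\<lambda>s. LINT x|lborel. norm (case (s, x) of (s, x) \<Rightarrow> indicator {0..1::real} s *\<^sub>R D (x + s *\<^sub>R d)))"
      by (simp add: shift)
    show "AE s in lborel. integrable lborel (\<lambda>x. case (s, x) of (s, x) \<Rightarrow> indicator {0..1::real} s *\<^sub>R D (x + s *\<^sub>R d))"
      using shift_int by simp
  qed measurable
  then have "(LINT x|lborel. (LINT s|lborel. indicator {0..1::real} s *\<^sub>R D (x + s *\<^sub>R d)))
      = (LINT s|lborel. (LINT x|lborel. indicator {0..1::real} s *\<^sub>R D (x + s *\<^sub>R d)))"
    by (rule lborel_pair.Fubini_integral)
  moreover have "(LINT x|lborel. D (x + s *\<^sub>R d)) = (LINT x|lborel. D x)" for s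
    using lborel_integral_affine[of D 1 "s *\<^sub>R d"] by (simp add: add.commute)
  ultimately have "(LINT x|lborel. \<Psi> (x + d) - \<Psi> x) = (LINT x|lborel. D x)"
    unfolding FTC by simp
  moreover have "(LINT x|lborel. \<Psi> (x + d) - \<Psi> x) = (LINT x|lborel. \<Psi> (x + d)) - (LINT x|lborel. \<Psi> x)"
    using lborel_integrable_affine[OF int, of 1 d] by (intro Bochner_Integration.integral_diff int) (simp add: add.commute)
  moreover have "(LINT x|lborel. \<Psi> (x + d)) = (LINT x|lborel. \<Psi> x)"
    using lborel_integral_affine[of \<Psi> 1 d] by (simp add: add.commute)
  ultimately show ?thesis by simp
qed

lemma iter_partial_deriv_append:
  "iter_partial_deriv (js @ ks) \<phi> = iter_partial_deriv js (iter_partial_deriv ks \<phi>)"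
  by (induction js) auto

lemma schwartz_iter_partial_deriv:
  assumes "\<phi> \<in> schwartz" shows "iter_partial_deriv ks \<phi> \<in> schwartz"
  using assms by (simp add: schwartz_def iter_partial_deriv_append[symmetric])

lemma schwartz_differentiable: "\<phi> \<in> schwartz \<Longrightarrow> \<phi> differentiable (at x)"
  unfolding schwartz_def by (metis (mono_tags, lifting) iter_partial_deriv.simps(1) mem_Collect_eq)

lemma schwartz_continuous: "\<phi> \<in> schwartz \<Longrightarrow> continuous_on UNIV \<phi>"
  by (simp add: continuous_at_imp_continuous_on differentiable_imp_continuous_within schwartz_differentiable)

lemma schwartz_measurable: "\<phi> \<in> schwartz \<Longrightarrow> \<phi> \<in> borel_measurable borel"
  by (rule borel_measurable_continuous_onI[OF schwartz_continuous])

lemma schwartz_bounded: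
  assumes "\<phi> \<in> schwartz"
  obtains C where "\<And>x. (1 + norm x) ^ k * norm (\<phi> x) \<le> C"
proof -
  have "\<forall>js. \<forall>k::nat. bounded (range (\<lambda>x. (1 + norm x) ^ k *\<^sub>R iter_partial_deriv js \<phi> x))"
    using assms unfolding schwartz_def by blast
  from this[THEN spec[of _ "[]"], THEN spec[of _ k]]
  have "bounded (range (\<lambda>x. (1 + norm x) ^ k *\<^sub>R \<phi> x))" by simp
  then obtain C where C: "\<forall>y\<in>range (\<lambda>x. (1 + norm x) ^ k *\<^sub>R \<phi> x). norm y \<le> C" unfolding bounded_iff by blast
  have "(1 + norm x) ^ k * norm (\<phi> x) \<le> C" for x
  proof -
    have "norm ((1 + norm x) ^ k *\<^sub>R \<phi> x) \<le> C" using C by blast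
    moreover have "norm ((1 + norm x) ^ k *\<^sub>R \<phi> x) = (1 + norm x) ^ k * norm (\<phi> x)"
      by (simp add: power_abs)
    ultimately show ?thesis by simp
  qed
  then show thesis by (rule that)
qed

lemma schwartz_integrable:
  assumes "\<phi> \<in> schwartz" shows "integrable lborel \<phi>"
proof -
  obtain C where "\<And>x. (1 + norm x) ^ (DIM(real ^ 'a) + 2) * norm (\<phi> x) \<le> C"
    by (rule schwartz_bounded[OF assms]) (rule that; assumption)
  then show ?thesis by (rule integrable_if_polynomial_decay[OF schwartz_measurable[OF assms]])
qed

lemma partial_deriv_has_vector_derivative:
  assumes "\<phi> \<in> schwartz"
  shows "((\<lambda>t. \<phi> (x + t *\<^sub>R axis i 1)) has_vector_derivative partial_deriv i \<phi> x) (at 0)"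
proof -
  have "(\<lambda>t::real. x + t *\<^sub>R axis i 1) differentiable (at 0)"
    by (auto intro!: derivative_intros)
  then have "(\<lambda>t::real. \<phi> (x + t *\<^sub>R axis i 1)) differentiable (at 0)"
    by (rule differentiable_compose[OF schwartz_differentiable[OF assms]])
  then show ?thesis unfolding partial_deriv_def by (rule vector_derivative_works[THEN iffD1])
qed

lemma integrable_times_unimodular:
  fixes F :: "'a::euclidean_space \<Rightarrow> complex"
  assumes F: "integrable lborel F" and [measurable]: "r \<in> borel_measurable borel"
  shows "integrable lborel (\<lambda>x. F x * exp (- (\<i> * complex_of_real (r x))))"
proof -
  have [measurable]: "F \<in> borel_measurable borel" using borel_measurable_integrable[OF F] by simp
  show ?thesis
    by (rule Bochner_Integration.integrable_bound[OF F]) (auto simp: norm_mult)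
qed

lemma norm_fourier_le: "norm (fourier \<phi> \<xi>) \<le> (LINT x|lborel. norm (\<phi> x))"
proof -
  have "norm (fourier \<phi> \<xi>) \<le> (LINT x|lborel. norm (\<phi> x * exp (- (\<i> * complex_of_real (x \<bullet> \<xi>)))))"
    unfolding fourier_def by (rule integral_norm_bound)
  then show ?thesis by (simp add: norm_mult)
qed

text \<open>Integration by parts: the partial derivative of \<open>\<phi> x * exp (- \<i> (x \<bullet> \<xi>))\<close> has integral 0.\<close>

lemma fourier_partial_deriv:
  fixes \<phi> :: "real ^ 'n::finite \<Rightarrow> complex"
  assumes \<phi>: "\<phi> \<in> schwartz"
  shows "fourier (partial_deriv j \<phi>) \<xi> = \<i> * complex_of_real (\<xi> $ j) * fourier \<phi> \<xi>"
proof -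
  let ?e = "\<lambda>x. exp (- (\<i> * complex_of_real (x \<bullet> \<xi>)))"
  let ?D = "\<lambda>x. partial_deriv j \<phi> x * ?e x - \<i> * complex_of_real (\<xi> $ j) * (\<phi> x * ?e x)"
  have p: "partial_deriv j \<phi> \<in> schwartz" using schwartz_iter_partial_deriv[OF \<phi>, of "[j]"] by simp
  have int: "integrable lborel (\<lambda>x. \<phi> x * ?e x)" "integrable lborel (\<lambda>x. partial_deriv j \<phi> x * ?e x)"
    by (intro integrable_times_unimodular schwartz_integrable \<phi> p; simp)+
  have "(LINT x|lborel. ?D x) = 0"
  proof (rule integral_directional_derivative_eq_0[where d="axis j 1"])
    show "integrable lborel (\<lambda>x. \<phi> x * ?e x)" by (rule int)
    show "integrable lborel ?D" by (intro Bochner_Integration.integrable_diff integrable_mult_right int)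
    show "continuous_on UNIV ?D"
      by (intro continuous_intros schwartz_continuous \<phi> p)
    fix x
    have e: "((\<lambda>t. ?e (x + t *\<^sub>R axis j 1)) has_vector_derivative (- \<i> * complex_of_real (\<xi> $ j) * ?e x)) (at 0)"
    proof -
      have "?e (x + t *\<^sub>R axis j 1) = ?e x * exp (t *\<^sub>R (- (\<i> * complex_of_real (\<xi> $ j))))" for t
      proof -
        have "(x + t *\<^sub>R axis j 1) \<bullet> \<xi> = x \<bullet> \<xi> + t * \<xi> $ j" by (simp add: inner_add_left inner_axis')
        then show ?thesis by (simp add: exp_add[symmetric] scaleR_conv_of_real algebra_simps)
      qed
      moreover have "((\<lambda>t. ?e x * exp (t *\<^sub>R (- (\<i> * complex_of_real (\<xi> $ j))))) has_vector_derivative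
          ?e x * ((- (\<i> * complex_of_real (\<xi> $ j))) * exp (0 *\<^sub>R (- (\<i> * complex_of_real (\<xi> $ j)))))) (at 0)"
        by (intro has_vector_derivative_mult_right exp_scaleR_has_vector_derivative_left)
      ultimately show ?thesis by (simp add: mult.commute)
    qed
    show "((\<lambda>t. \<phi> (x + t *\<^sub>R axis j 1) * ?e (x + t *\<^sub>R axis j 1)) has_vector_derivative ?D x) (at 0)"
      using has_vector_derivative_mult[OF partial_deriv_has_vector_derivative[OF \<phi>, of x j] e]
      by (simp add: algebra_simps)
  qed
  moreover have "(LINT x|lborel. ?D x) = fourier (partial_deriv j \<phi>) \<xi> - \<i> * complex_of_real (\<xi> $ j) * fourier \<phi> \<xi>"
    unfolding fourier_def
    by (subst Bochner_Integration.integral_diff) (use int in \<open>simp_all only: integral_mult_right_zero integrable_mult_right\<close>)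
  ultimately show ?thesis by simp
qed

lemma fourier_iter_partial_deriv:
  fixes \<phi> :: "real ^ 'n::finite \<Rightarrow> complex"
  assumes \<phi>: "\<phi> \<in> schwartz"
  shows "fourier (iter_partial_deriv (replicate m j) \<phi>) \<xi> = (\<i> * complex_of_real (\<xi> $ j)) ^ m * fourier \<phi> \<xi>"
proof (induction m)
  case (Suc m)
  show ?case
    using fourier_partial_deriv[OF schwartz_iter_partial_deriv[OF \<phi>], of j "replicate m j" \<xi>] Suc
    by (simp add: mult.assoc)
qed simp

text \<open>Powers of single coordinates are what derivatives in a single direction produce under the Fourier
  transform, so this reduces the decay of a transform to such derivatives.\<close>

lemma one_plus_norm_power_le:
  fixes \<xi> :: "real ^ 'n::finite"
  shows "(1 + norm \<xi>) ^ m \<le> (1 + real CARD('n)) ^ m * (1 + (\<Sum>j\<in>UNIV. \<bar>\<xi> $ j\<bar> ^ m))"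
proof -
  define M where "M = Max (range (\<lambda>j. \<bar>\<xi> $ j\<bar>))"
  have le: "\<bar>\<xi> $ j\<bar> \<le> M" for j unfolding M_def by (intro Max_ge) auto
  have "M \<in> range (\<lambda>j. \<bar>\<xi> $ j\<bar>)" unfolding M_def by (intro Max_in) auto
  then obtain i where i: "M = \<bar>\<xi> $ i\<bar>" by auto
  have "norm \<xi> \<le> (\<Sum>j\<in>UNIV. \<bar>\<xi> $ j\<bar>)" by (rule norm_le_l1_cart)
  also have "\<dots> \<le> (\<Sum>j\<in>(UNIV::'n set). max 1 M)" by (intro sum_mono) (use le in \<open>simp add: le_max_iff_disj\<close>)
  finally have "1 + norm \<xi> \<le> (1 + real CARD('n)) * max 1 M" by (simp add: algebra_simps)
  then have "(1 + norm \<xi>) ^ m \<le> ((1 + real CARD('n)) * max 1 M) ^ m" by (intro power_mono) auto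
  also have "\<dots> = (1 + real CARD('n)) ^ m * (max 1 M) ^ m" by (rule power_mult_distrib)
  also have "(max 1 M) ^ m \<le> 1 + (\<Sum>j\<in>UNIV. \<bar>\<xi> $ j\<bar> ^ m)"
  proof (cases "M \<le> 1")
    case True
    then show ?thesis by (simp add: max_def sum_nonneg)
  next
    case False
    then have "(max 1 M) ^ m = \<bar>\<xi> $ i\<bar> ^ m" by (simp add: max_def i)
    also have "\<dots> \<le> (\<Sum>j\<in>UNIV. \<bar>\<xi> $ j\<bar> ^ m)" by (intro member_le_sum) auto
    finally show ?thesis by simp
  qed
  finally show ?thesis by (simp add: mult_left_mono)
qed

lemma measurable_fourier:
  assumes "integrable lborel \<phi>"
  shows "fourier \<phi> \<in> borel_measurable borel"
proof -
  have [measurable]: "\<phi> \<in> borel_measurable borel" using borel_measurable_integrable[OF assms] by simp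
  have "(\<lambda>\<xi>. LINT x|lborel. \<phi> x * exp (- (\<i> * complex_of_real (x \<bullet> \<xi>)))) \<in> borel_measurable borel"
    by measurable
  then show ?thesis unfolding fourier_def[abs_def] .
qed

lemma fourier_schwartz_integrable:
  fixes \<phi> :: "real ^ 'n::finite \<Rightarrow> complex"
  assumes \<phi>: "\<phi> \<in> schwartz"
  shows "integrable lborel (fourier \<phi>)"
proof -
  let ?m = "DIM(real ^ 'n) + 2"
  define A where "A j = (LINT x|lborel. norm (iter_partial_deriv (replicate ?m j) \<phi> x))" for j
  define B where "B = (LINT x|lborel. norm (\<phi> x))"
  have "(1 + norm \<xi>) ^ ?m * norm (fourier \<phi> \<xi>) \<le> (1 + real CARD('n)) ^ ?m * (B + (\<Sum>j\<in>UNIV. A j))" for \<xi>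
  proof -
    have "\<bar>\<xi> $ j\<bar> ^ ?m * norm (fourier \<phi> \<xi>) \<le> A j" for j
    proof -
      have "\<bar>\<xi> $ j\<bar> ^ ?m * norm (fourier \<phi> \<xi>) = norm (fourier (iter_partial_deriv (replicate ?m j) \<phi>) \<xi>)"
        unfolding fourier_iter_partial_deriv[OF \<phi>] by (simp only: norm_mult norm_power norm_ii norm_of_real mult_1)
      also have "\<dots> \<le> A j" unfolding A_def by (rule norm_fourier_le)
      finally show ?thesis .
    qed
    then have "(\<Sum>j\<in>UNIV. \<bar>\<xi> $ j\<bar> ^ ?m * norm (fourier \<phi> \<xi>)) \<le> (\<Sum>j\<in>UNIV. A j)" by (intro sum_mono)
    moreover have "norm (fourier \<phi> \<xi>) \<le> B" unfolding B_def by (rule norm_fourier_le)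
    ultimately have *: "(1 + (\<Sum>j\<in>UNIV. \<bar>\<xi> $ j\<bar> ^ ?m)) * norm (fourier \<phi> \<xi>) \<le> B + (\<Sum>j\<in>UNIV. A j)"
      by (simp only: distrib_right sum_distrib_right mult_1)
    have "(1 + norm \<xi>) ^ ?m * norm (fourier \<phi> \<xi>)
        \<le> ((1 + real CARD('n)) ^ ?m * (1 + (\<Sum>j\<in>UNIV. \<bar>\<xi> $ j\<bar> ^ ?m))) * norm (fourier \<phi> \<xi>)"
      by (intro mult_right_mono one_plus_norm_power_le norm_ge_zero)
    also have "\<dots> \<le> (1 + real CARD('n)) ^ ?m * (B + (\<Sum>j\<in>UNIV. A j))"
      unfolding mult.assoc by (intro mult_left_mono *) simp
    finally show ?thesis .
  qed
  then show ?thesis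
    by (rule integrable_if_polynomial_decay[OF measurable_fourier[OF schwartz_integrable[OF \<phi>]]])
qed

text \<open>Replace \<open>\<phi> x\<close> by the inversion formula and apply Fubini's theorem; since G is even, only the cosine
  part of the exponential contributes.\<close>

lemma integral_even_times_schwartz:
  fixes \<phi> :: "real ^ 'n::finite \<Rightarrow> complex" and G :: "real ^ 'n \<Rightarrow> real"
  assumes \<phi>: "\<phi> \<in> schwartz" and G: "integrable lborel G" and even: "\<And>x. G (- x) = G x"
  shows "(LINT x|lborel. complex_of_real (G x) * \<phi> x)
     = (LINT \<xi>|lborel. complex_of_real (inverse ((2 * pi) ^ CARD('n)) * (LINT x|lborel. G x * cos (x \<bullet> \<xi>))) * fourier \<phi> \<xi>)"
proof -
  have [measurable]: "G \<in> borel_measurable borel" using borel_measurable_integrable[OF G] by simp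
  let ?u = "\<lambda>p::(real ^ 'n) \<times> (real ^ 'n). exp (\<i> * complex_of_real (fst p \<bullet> snd p))"
  have Gc: "integrable lborel (\<lambda>x. complex_of_real (G x))" using G by (simp add: complex_of_real_integrable_eq)
  obtain B where B: "\<And>x. (1 + norm x) ^ 0 * norm (\<phi> x) \<le> B"
    by (rule schwartz_bounded[OF \<phi>]) (rule that; assumption)
  have inv: "complex_of_real (inverse ((2 * pi) ^ CARD('n))) * (LINT \<xi>|lborel. fourier \<phi> \<xi> * ?u (x, \<xi>)) = \<phi> x" for x
  proof -
    have nz: "complex_of_real ((2 * pi) ^ CARD('n)) \<noteq> 0" by simp
    have "(LINT \<xi>|lborel. fourier \<phi> \<xi> * ?u (x, \<xi>)) = complex_of_real ((2 * pi) ^ CARD('n)) * \<phi> x"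
      using fourier_inversion[OF schwartz_continuous[OF \<phi>] _ schwartz_integrable[OF \<phi>] fourier_schwartz_integrable[OF \<phi>], of B x] B
      by simp
    then show ?thesis
      by (simp only: of_real_inverse mult.assoc[symmetric] left_inverse[OF nz] mult_1)
  qed
  have cos_part: "(LINT x|lborel. complex_of_real (G x) * ?u (x, \<xi>)) = complex_of_real (LINT x|lborel. G x * cos (x \<bullet> \<xi>))" for \<xi>
  proof -
    have i: "integrable lborel (\<lambda>x. G x * cos (x \<bullet> \<xi>))" "integrable lborel (\<lambda>x. G x * sin (x \<bullet> \<xi>))"
      by (rule Bochner_Integration.integrable_bound[OF G]; auto simp: abs_mult mult_left_le)+
    have "(LINT x|lborel. G x * sin (x \<bullet> \<xi>)) = (LINT x|lborel. G (0 + (-1) *\<^sub>R x) * sin ((0 + (-1) *\<^sub>R x) \<bullet> \<xi>))"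
      by (subst lborel_integral_affine[where c="-1" and t=0]) simp_all
    also have "\<dots> = - (LINT x|lborel. G x * sin (x \<bullet> \<xi>))" by (simp add: even)
    finally have "(LINT x|lborel. G x * sin (x \<bullet> \<xi>)) = 0" by simp
    then have "(LINT x|lborel. complex_of_real (G x * cos (x \<bullet> \<xi>)) + \<i> * complex_of_real (G x * sin (x \<bullet> \<xi>)))
        = complex_of_real (LINT x|lborel. G x * cos (x \<bullet> \<xi>))"
      using i by (subst Bochner_Integration.integral_add)
        (simp_all only: integral_mult_right_zero integral_complex_of_real integrable_mult_right complex_of_real_integrable_eq of_real_0 mult_zero_right add_0_right)
    moreover have "complex_of_real (G x) * ?u (x, \<xi>) = complex_of_real (G x * cos (x \<bullet> \<xi>)) + \<i> * complex_of_real (G x * sin (x \<bullet> \<xi>))" for x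
      by (simp add: cis_conv_exp[symmetric] complex_eq_iff)
    ultimately show ?thesis by simp
  qed
  have "(LINT x|lborel. complex_of_real (G x) * \<phi> x)
      = (LINT x|lborel. complex_of_real (inverse ((2 * pi) ^ CARD('n))) * (complex_of_real (G x) * (LINT \<xi>|lborel. fourier \<phi> \<xi> * ?u (x, \<xi>))))"
    unfolding mult.left_commute[of "complex_of_real (inverse ((2 * pi) ^ CARD('n)))"] inv ..
  also have "\<dots> = complex_of_real (inverse ((2 * pi) ^ CARD('n))) * (LINT x|lborel. complex_of_real (G x) * (LINT \<xi>|lborel. fourier \<phi> \<xi> * ?u (x, \<xi>)))"
    by (rule integral_mult_right_zero)
  also have "(LINT x|lborel. complex_of_real (G x) * (LINT \<xi>|lborel. fourier \<phi> \<xi> * ?u (x, \<xi>)))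
      = (LINT \<xi>|lborel. fourier \<phi> \<xi> * (LINT x|lborel. complex_of_real (G x) * ?u (x, \<xi>)))"
    by (rule Fubini_product_bounded_kernel[OF Gc fourier_schwartz_integrable[OF \<phi>]])
       (simp_all, intro borel_measurable_continuous_onI continuous_intros)
  also have "complex_of_real (inverse ((2 * pi) ^ CARD('n))) * \<dots>
      = (LINT \<xi>|lborel. complex_of_real (inverse ((2 * pi) ^ CARD('n))) * (fourier \<phi> \<xi> * (LINT x|lborel. complex_of_real (G x) * ?u (x, \<xi>))))"
    by (rule integral_mult_right_zero[symmetric])
  also have "\<dots> = (LINT \<xi>|lborel. complex_of_real (inverse ((2 * pi) ^ CARD('n)) * (LINT x|lborel. G x * cos (x \<bullet> \<xi>))) * fourier \<phi> \<xi>)"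
    unfolding cos_part by (intro Bochner_Integration.integral_cong refl) (simp only: of_real_mult ac_simps)
  finally show ?thesis .
qed

section \<open>The Fourier transform of a radial superposition of balls is non-negative\<close>

text \<open>After interchanging the integrals both of them are elementary, and the value is
  \<open>2 * (1 - cos (u * a * r)) / (a\<^sup>2 * r)\<close>.\<close>

lemma integral_cosine_kernel_nonneg:
  fixes a u r :: real
  assumes a: "0 < a" and u: "0 \<le> u" and r: "0 \<le> r"
  shows "0 \<le> integral {-r..r} (\<lambda>\<tau>. integral {0..u} (\<lambda>s. s * cos (s * (a * \<tau>))))"
proof (cases "r = 0")
  case False
  then have r: "0 < r" using r by simp
  have "integral {-r..r} (\<lambda>\<tau>. integral {0..u} (\<lambda>s. s * cos (s * (a * \<tau>))))
      = integral {0..u} (\<lambda>s. integral {-r..r} (\<lambda>\<tau>. s * cos (s * (a * \<tau>))))"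
  proof -
    have "continuous_on (cbox (-r, 0) (r, u)) (\<lambda>(\<tau>, s). s * cos (s * (a * \<tau>)))"
      unfolding case_prod_beta' by (intro continuous_intros)
    from integral_swap_continuous[OF this] show ?thesis unfolding box_real .
  qed
  also have "\<dots> = integral {0..u} (\<lambda>s. 2 / a * sin (s * (a * r)))"
  proof (intro Henstock_Kurzweil_Integration.integral_cong)
    fix s
    have "((\<lambda>\<tau>. s * cos (s * (a * \<tau>))) has_integral (sin (s * (a * r)) / a - sin (s * (a * (- r))) / a)) {-r..r}"
      using r a by (intro fundamental_theorem_of_calculus)
        (auto intro!: derivative_eq_intros simp flip: has_real_derivative_iff_has_vector_derivative)
    then have "integral {-r..r} (\<lambda>\<tau>. s * cos (s * (a * \<tau>))) = sin (s * (a * r)) / a - sin (s * (a * (- r))) / a"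
      by (rule integral_unique)
    then show "integral {-r..r} (\<lambda>\<tau>. s * cos (s * (a * \<tau>))) = 2 / a * sin (s * (a * r))"
      by simp
  qed
  also have "\<dots> = (- 2 / (a * (a * r)) * cos (u * (a * r))) - (- 2 / (a * (a * r)) * cos (0 * (a * r)))"
    using r a u by (intro integral_unique fundamental_theorem_of_calculus)
        (auto intro!: derivative_eq_intros simp flip: has_real_derivative_iff_has_vector_derivative)
  also have "\<dots> = 2 / (a * (a * r)) * (1 - cos (u * (a * r)))"
    by (simp only: right_diff_distrib mult_zero_left cos_zero mult_1_right minus_divide_left[symmetric] mult_minus_left)
  also have "\<dots> \<ge> 0" using r a by simp
  finally show ?thesis .
qed simp

text \<open>By Fubini's theorem this is the integral over K of a function of the single variable \<open>x \<bullet> \<xi>\<close>, whose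
  integrals over symmetric intervals are computed in the preceding lemma.\<close>

lemma integral_scaled_ball_fourier_nonneg:
  fixes K :: "'a::euclidean_space set"
  assumes K: "compact K" "convex K" "\<And>x. x \<in> K \<Longrightarrow> - x \<in> K" and u: "0 \<le> u"
  shows "0 \<le> (LINT s|lborel. (indicator {0<..u} s * s) * (LINT x|lborel. indicator K x * cos (s * (x \<bullet> \<xi>))))"
proof (cases "\<xi> = 0")
  case True
  then show ?thesis by (auto intro!: Bochner_Integration.integral_nonneg simp: indicator_def)
next
  case False
  define a where "a = norm \<xi>"
  define e where "e = (1 / a) *\<^sub>R \<xi>"
  have a: "0 < a" using False by (simp add: a_def)
  have e: "norm e = 1" using a by (simp add: e_def a_def)
  have \<xi>: "x \<bullet> \<xi> = a * (x \<bullet> e)" for x using a by (simp add: e_def)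
  have [measurable]: "K \<in> sets borel" using K(1) by (rule borel_compact)
  define W where "W \<tau> = integral {0..u} (\<lambda>s. s * cos (s * (a * \<tau>)))" for \<tau>
  have cont: "continuous_on UNIV W"
  proof -
    have "continuous_on (UNIV \<times> cbox 0 u) (\<lambda>(\<tau>, s). s * cos (s * (a * \<tau>)))"
      by (simp add: case_prod_beta') (intro continuous_intros)
    then show ?thesis unfolding W_def box_real(2)[symmetric] by (rule integral_continuous_on_param)
  qed
  have intF: "integrable lborel (\<lambda>s. indicator {0<..u} s * s)"
  proof (rule Bochner_Integration.integrable_bound)
    show "integrable lborel (\<lambda>s. indicator {0..u} s * s)"
      using borel_integrable_atLeastAtMost[of 0 u "\<lambda>s. s"] by (simp add: mult.commute)
  qed (auto split: split_indicator)
  have intK: "integrable lborel (\<lambda>x. indicator K x :: real)"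
    using emeasure_compact_finite[OF K(1)] by (simp add: integrable_indicator_iff)
  have W_eq: "(LINT s|lborel. (indicator {0<..u} s * s) * cos (s * (x \<bullet> \<xi>))) = W (x \<bullet> e)" for x
  proof -
    have "(LINT s|lborel. (indicator {0<..u} s * s) * cos (s * (x \<bullet> \<xi>)))
        = (LINT s|lborel. indicator {0..u} s *\<^sub>R (s * cos (s * (a * (x \<bullet> e)))))"
      unfolding \<xi> by (intro Bochner_Integration.integral_cong) (auto split: split_indicator)
    also have "\<dots> = (LBINT s:{0..u}. s * cos (s * (a * (x \<bullet> e))))"
      by (simp only: set_lebesgue_integral_def)
    also have "\<dots> = W (x \<bullet> e)" unfolding W_def
      by (intro set_borel_integral_eq_integral(2) borel_integrable_atLeastAtMost' continuous_intros)
    finally show ?thesis .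
  qed
  have "(LINT s|lborel. (indicator {0<..u} s * s) * (LINT x|lborel. indicator K x * cos (s * (x \<bullet> \<xi>))))
      = (LINT x|lborel. indicator K x * (LINT s|lborel. (indicator {0<..u} s * s) * cos (s * (x \<bullet> \<xi>))))"
    using Fubini_product_bounded_kernel[OF intF intK, of "\<lambda>p. cos (fst p * (snd p \<bullet> \<xi>))"]
    by (simp add: borel_measurable_continuous_onI continuous_intros)
  also have "\<dots> = (LINT x|lborel. indicator K x * W (x \<bullet> e))" unfolding W_eq ..
  also have "\<dots> \<ge> 0"
    by (rule integral_slab_function_nonneg[OF K e cont]; simp only: W_def[abs_def])
       (rule integral_cosine_kernel_nonneg[OF a u])
  finally show ?thesis .
qed

text \<open>By the layer cake formula h is the integral over y > 0 of the indicator functions of \<open>{s. y < h s}\<close>. Each of these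
  sets is empty or, up to its right end point, an interval \<open>{0<..u}\<close>; it is bounded because h takes arbitrarily
  small values.\<close>

lemma integral_antimono_times_nonneg:
  fixes h w :: "real \<Rightarrow> real"
  assumes anti: "antimono_on {0<..} h" and h0: "\<And>s. 0 < s \<Longrightarrow> 0 \<le> h s" "\<And>s. s \<le> 0 \<Longrightarrow> h s = 0"
    and [measurable]: "h \<in> borel_measurable borel" "w \<in> borel_measurable borel"
    and lim: "\<And>y. 0 < y \<Longrightarrow> \<exists>s>0. h s \<le> y"
    and int: "integrable lborel (\<lambda>s. h s * w s)"
    and pos: "\<And>u. 0 \<le> u \<Longrightarrow> 0 \<le> (LINT s|lborel. indicator {0<..u} s * w s)"
  shows "0 \<le> (LINT s|lborel. h s * w s)"
proof -
  define S where "S y = {s. 0 < y \<and> y < h s}" for y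
  have h_nonneg: "0 \<le> h s" for s using h0 by (cases "0 < s") auto
  have layer: "(LINT y|lborel. indicator (S y) s * c) = h s * c" for s c
  proof -
    have "(LINT y|lborel. indicator (S y) s * c) = (LINT y|lborel. indicator {0<..<h s} y * c)"
      by (intro Bochner_Integration.integral_cong) (auto simp: S_def split: split_indicator)
    then show ?thesis using h_nonneg by simp
  qed
  have [measurable]: "Measurable.pred (borel \<Otimes>\<^sub>M borel) (\<lambda>p. snd p \<in> S (fst p))"
    "Measurable.pred (borel \<Otimes>\<^sub>M borel) (\<lambda>p. fst p \<in> S (snd p))"
    unfolding S_def mem_Collect_eq by measurable
  have pair: "integrable (lborel \<Otimes>\<^sub>M lborel) (\<lambda>(s, y). indicator (S y) s * w s)"
  proof (rule lborel_pair.Fubini_integrable)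
    show "(\<lambda>(s, y). indicator (S y) s * w s) \<in> borel_measurable (lborel \<Otimes>\<^sub>M lborel)"
      unfolding indicator_def case_prod_beta' by measurable
    have "norm (indicator (S y) s * w s) = indicator (S y) s * norm (w s)" for s y
      by (simp add: abs_mult)
    then show "integrable lborel (\<lambda>s. LINT y|lborel. norm (case (s, y) of (s, y) \<Rightarrow> indicator (S y) s * w s))"
      using integrable_norm[OF int] h_nonneg layer[of _ 1] by (simp add: abs_mult)
    show "AE s in lborel. integrable lborel (\<lambda>y. case (s, y) of (s, y) \<Rightarrow> indicator (S y) s * w s)"
    proof (rule AE_I2)
      fix s
      have "(\<lambda>y. indicator (S y) s * w s) = (\<lambda>y. indicator {0<..<h s} y * w s)"
        by (auto simp: S_def fun_eq_iff split: split_indicator)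
      then show "integrable lborel (\<lambda>y. case (s, y) of (s, y) \<Rightarrow> indicator (S y) s * w s)"
        using h_nonneg[of s] by (simp add: integrable_indicator_iff)
    qed
  qed
  have level: "0 \<le> (LINT s|lborel. indicator (S y) s * w s)" for y
  proof (cases "0 < y \<and> S y \<noteq> {}")
    case True
    then obtain s1 where s1: "s1 \<in> S y" by blast
    obtain s2 where s2: "0 < s2" "h s2 \<le> y" using lim True by blast
    have Spos: "0 < s" if "s \<in> S y" for s
      using that h0(2)[of s] by (force simp: S_def not_less)
    have down: "s \<in> S y" if "0 < s" "s \<le> s'" "s' \<in> S y" for s s'
      using monotone_onD[OF anti, of s s'] that Spos[OF that(3)] by (auto simp: S_def)
    have bound: "s \<le> s2" if "s \<in> S y" for s
      using down[OF s2(1) _ that] s2(2) by (force simp: S_def)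
    define u where "u = Sup (S y)"
    have bdd: "bdd_above (S y)" using bound by (auto simp: bdd_above_def)
    have le_u: "s \<le> u" if "s \<in> S y" for s unfolding u_def by (rule cSup_upper[OF that bdd])
    have u: "0 \<le> u" using le_u[OF s1] Spos[OF s1] by simp
    have mem: "s \<in> S y" if s: "0 < s" "s < u" for s
    proof -
      have "\<exists>s'\<in>S y. s < s'"
        using s(2) s1 less_cSup_iff[OF _ bdd, of s] unfolding u_def by blast
      then show ?thesis using down[OF s(1)] less_imp_le by blast
    qed
    have "AE s in lborel. s \<noteq> u" by (rule AE_lborel_singleton)
    then have "AE s in lborel. indicator (S y) s * w s = indicator {0<..u} s * w s"
    proof eventually_elim
      case (elim s)
      then have "s \<in> S y \<longleftrightarrow> s \<in> {0<..u}"
        using mem[of s] le_u[of s] Spos[of s] by auto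
      then show ?case by (simp add: indicator_def)
    qed
    moreover have "S y \<in> sets borel" unfolding S_def by measurable
    ultimately have "(LINT s|lborel. indicator (S y) s * w s) = (LINT s|lborel. indicator {0<..u} s * w s)"
      by (intro integral_cong_AE) auto
    then show ?thesis using pos[OF u] by simp
  next
    case False
    then have "S y = {}" by (auto simp: S_def)
    then show ?thesis by simp
  qed
  have "(LINT y|lborel. (LINT s|lborel. indicator (S y) s * w s)) = (LINT s|lborel. (LINT y|lborel. indicator (S y) s * w s))"
    by (rule lborel_pair.Fubini_integral[OF pair])
  also have "\<dots> = (LINT s|lborel. h s * w s)" unfolding layer ..
  finally have "(LINT s|lborel. h s * w s) = (LINT y|lborel. (LINT s|lborel. indicator (S y) s * w s))"
    by (rule sym)
  then show ?thesis using level by (simp add: Bochner_Integration.integral_nonneg)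
qed

text \<open>The hypothesis \<open>layers\<close> presents G as a superposition of indicator functions of the balls
  \<open>{x. N x \<le> s}\<close> with the weight \<open>h s / s ^ m\<close>. Scaling to the unit ball contributes the factor
  \<open>s ^ Suc m\<close>, so that \<open>h s * s\<close> remains both in the total mass and in the Fourier transform.\<close>

lemma radial_layers:
  fixes N :: "'a::euclidean_space \<Rightarrow> real" and h :: "real \<Rightarrow> real" and G :: "'a \<Rightarrow> real"
  assumes N: "is_norm N" and m: "DIM('a) = Suc m"
    and anti: "antimono_on {0<..} h" and h0: "\<And>s. 0 < s \<Longrightarrow> 0 \<le> h s" "\<And>s. s \<le> 0 \<Longrightarrow> h s = 0"
    and h[measurable]: "h \<in> borel_measurable borel"
    and fin: "(\<integral>\<^sup>+s. ennreal (s * h s) \<partial>lborel) < \<infinity>"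
    and G[measurable]: "G \<in> borel_measurable borel" and G0: "\<And>x. 0 \<le> G x"
    and layers: "\<And>x. x \<noteq> 0 \<Longrightarrow> ennreal (G x) = (\<integral>\<^sup>+s. ennreal (h s / s ^ m) * indicator {s. 0 < s \<and> N x \<le> s} s \<partial>lborel)"
  shows integrable_radial_layers: "integrable lborel G"
    and fourier_radial_layers_nonneg: "0 \<le> (LINT x|lborel. G x * cos (x \<bullet> \<xi>))"
proof -
  let ?p = "\<lambda>x. \<integral>\<^sup>+s. ennreal (h s / s ^ m) * indicator {s. 0 < s \<and> N x \<le> s} s \<partial>lborel"
  have [measurable]: "N \<in> borel_measurable borel" by (rule measurable_is_norm[OF N])
  have h_nonneg: "0 \<le> h s" for s using h0 by (cases "0 < s") auto
  have AE0: "AE x in lborel. x \<noteq> (0::'a)" by (rule AE_lborel_singleton)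
  have "(\<integral>\<^sup>+x. ?p x \<partial>lborel)
      = emeasure lborel {x. N x \<le> 1} * (\<integral>\<^sup>+s. (ennreal (s ^ DIM('a)) * ennreal (h s / s ^ m)) * indicator {0<..} s \<partial>lborel)"
    by (rule nn_integral_radial[OF N]) measurable
  also have "(\<integral>\<^sup>+s. (ennreal (s ^ DIM('a)) * ennreal (h s / s ^ m)) * indicator {0<..} s \<partial>lborel) = (\<integral>\<^sup>+s. ennreal (s * h s) \<partial>lborel)"
  proof (intro nn_integral_cong)
    fix s
    show "(ennreal (s ^ DIM('a)) * ennreal (h s / s ^ m)) * indicator {0<..} s = ennreal (s * h s)"
      using h0[of s] by (cases "0 < s") (simp_all add: m ennreal_mult'[symmetric])
  qed
  finally have total: "(\<integral>\<^sup>+x. ?p x \<partial>lborel) < \<infinity>"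
    using emeasure_unit_ball_finite[OF N] fin by (simp add: ennreal_mult_less_top)
  have "(\<integral>\<^sup>+x. ennreal (G x) \<partial>lborel) = (\<integral>\<^sup>+x. ?p x \<partial>lborel)"
    using AE0 by (intro nn_integral_cong_AE) (auto simp: layers)
  then show "integrable lborel G"
    using total G0 by (intro integrableI_nonneg) simp_all
  \<comment> \<open>Otherwise \<open>s * h s\<close> would be at least y on \<open>{1..}\<close> and could not have a finite integral.\<close>
  have lim: "\<exists>s>0. h s \<le> y" if y: "0 < y" for y
  proof (rule ccontr)
    assume "\<not> ?thesis"
    then have hy: "y < h s" if "0 < s" for s using that by (auto simp: not_le)
    obtain r where r: "0 \<le> r" "(\<integral>\<^sup>+s. ennreal (s * h s) \<partial>lborel) = ennreal r"
      using fin by (cases "\<integral>\<^sup>+s. ennreal (s * h s) \<partial>lborel" rule: ennreal_cases) auto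
    define k where "k = (r + 1) / y"
    have k: "0 \<le> k" "y * k = r + 1" using r(1) y by (simp_all add: k_def)
    have "ennreal (r + 1) = ennreal y * ennreal k" using k y by (simp flip: ennreal_mult')
    also have "\<dots> = (\<integral>\<^sup>+s. ennreal y * indicator {1..1 + k} s \<partial>lborel)"
      using k by (simp add: nn_integral_cmult)
    also have "\<dots> \<le> (\<integral>\<^sup>+s. ennreal (s * h s) \<partial>lborel)"
    proof (intro nn_integral_mono)
      fix s :: real
      show "ennreal y * indicator {1..1 + k} s \<le> ennreal (s * h s)"
      proof (cases "s \<in> {1..1 + k}")
        case True
        then have "1 * y \<le> s * h s" using hy[of s] y by (intro mult_mono) auto
        then show ?thesis using True by (simp add: ennreal_leI)
      qed simp
    qed
    finally have "r + 1 \<le> r" unfolding r(2) using r(1) by (subst (asm) ennreal_le_iff) auto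
    then show False by simp
  qed
  define K where "K = {x. N x \<le> 1}"
  have K: "compact K" "convex K" "\<And>x. x \<in> K \<Longrightarrow> - x \<in> K"
    using unit_ball_is_norm[OF N] by (auto simp: K_def is_norm_minus[OF N])
  have [measurable]: "K \<in> sets borel" using K(1) by (rule borel_compact)
  define J where "J x s = (h s / s ^ m) * indicator {s. 0 < s \<and> N x \<le> s} s * cos (x \<bullet> \<xi>)" for x s
  have [measurable]: "(\<lambda>p. J (fst p) (snd p)) \<in> borel_measurable (borel \<Otimes>\<^sub>M borel)"
    unfolding J_def indicator_def mem_Collect_eq by measurable
  have J: "integrable (lborel \<Otimes>\<^sub>M lborel) (\<lambda>(x, s). J x s)"
  proof (rule integrableI_bounded)
    have "(\<integral>\<^sup>+p. ennreal (norm (case p of (x, s) \<Rightarrow> J x s)) \<partial>(lborel \<Otimes>\<^sub>M lborel)) = (\<integral>\<^sup>+x. (\<integral>\<^sup>+s. ennreal (norm (J x s)) \<partial>lborel) \<partial>lborel)"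
      by (subst lborel.nn_integral_fst[symmetric]) (simp_all add: case_prod_beta')
    also have "\<dots> \<le> (\<integral>\<^sup>+x. ?p x \<partial>lborel)"
    proof (intro nn_integral_mono)
      fix x s
      have "\<bar>h s / s ^ m * cos (x \<bullet> \<xi>)\<bar> \<le> h s / s ^ m" if "0 < s"
      proof -
        have q: "0 \<le> h s / s ^ m" using that h_nonneg[of s] by simp
        show ?thesis unfolding abs_mult abs_of_nonneg[OF q] by (rule mult_left_le[OF abs_cos_le_one q])
      qed
      then show "ennreal (norm (J x s)) \<le> ennreal (h s / s ^ m) * indicator {s. 0 < s \<and> N x \<le> s} s"
        by (auto simp: J_def intro!: ennreal_leI split: split_indicator)
    qed
    finally show "(\<integral>\<^sup>+p. ennreal (norm (case p of (x, s) \<Rightarrow> J x s)) \<partial>(lborel \<Otimes>\<^sub>M lborel)) < \<infinity>"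
      using total by simp
  qed (simp add: case_prod_beta')
  have J_s: "(LINT s|lborel. J x s) = G x * cos (x \<bullet> \<xi>)" if x: "x \<noteq> 0" for x
  proof -
    have "(LINT s|lborel. (h s / s ^ m) * indicator {s. 0 < s \<and> N x \<le> s} s)
        = enn2real (\<integral>\<^sup>+s. ennreal ((h s / s ^ m) * indicator {s. 0 < s \<and> N x \<le> s} s) \<partial>lborel)"
    proof (rule integral_eq_nn_integral)
      show "(\<lambda>s. (h s / s ^ m) * indicator {s. 0 < s \<and> N x \<le> s} s) \<in> borel_measurable lborel"
        unfolding indicator_def mem_Collect_eq by measurable
      show "AE s in lborel. 0 \<le> (h s / s ^ m) * indicator {s. 0 < s \<and> N x \<le> s} s"
        using h_nonneg by (intro AE_I2) (auto split: split_indicator)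
    qed
    also have "(\<integral>\<^sup>+s. ennreal ((h s / s ^ m) * indicator {s. 0 < s \<and> N x \<le> s} s) \<partial>lborel) = ?p x"
      by (intro nn_integral_cong) (auto split: split_indicator)
    also have "\<dots> = ennreal (G x)" by (rule layers[OF x, symmetric])
    finally have "(LINT s|lborel. (h s / s ^ m) * indicator {s. 0 < s \<and> N x \<le> s} s) = G x"
      using G0 by simp
    then show ?thesis unfolding J_def integral_mult_left_zero by simp
  qed
  define w where "w s = indicator {0<..} s * s * (LINT x|lborel. indicator K x * cos (s * (x \<bullet> \<xi>)))" for s
  have J_x: "(LINT x|lborel. J x s) = h s * w s" for s
  proof (cases "0 < s")
    case True
    have "(LINT x|lborel. J x s) = (LINT x|lborel. (h s / s ^ m) * (indicator {x. N x \<le> s} x * cos (x \<bullet> \<xi>)))"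
      using True by (intro Bochner_Integration.integral_cong) (auto simp: J_def split: split_indicator)
    also have "\<dots> = (h s / s ^ m) * (LINT x|lborel. indicator {x. N x \<le> s} x * cos (x \<bullet> \<xi>))"
      by (rule integral_mult_right_zero)
    also have "(LINT x|lborel. indicator {x. N x \<le> s} x * cos (x \<bullet> \<xi>))
        = (\<bar>s\<bar> ^ DIM('a)) *\<^sub>R (LINT x|lborel. indicator {x. N x \<le> s} (0 + s *\<^sub>R x) * cos ((0 + s *\<^sub>R x) \<bullet> \<xi>))"
      using True by (intro lborel_integral_affine) simp_all
    also have "(LINT x|lborel. indicator {x. N x \<le> s} (0 + s *\<^sub>R x) * cos ((0 + s *\<^sub>R x) \<bullet> \<xi>))
        = (LINT x|lborel. indicator K x * cos (s * (x \<bullet> \<xi>)))"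
      using True by (intro Bochner_Integration.integral_cong) (auto simp: K_def is_norm_scaleR[OF N] indicator_def)
    finally show ?thesis using True by (simp add: w_def m)
  next
    case False
    then show ?thesis by (simp add: J_def w_def)
  qed
  have "(LINT s|lborel. (LINT x|lborel. J x s)) = (LINT x|lborel. (LINT s|lborel. J x s))"
    by (rule lborel_pair.Fubini_integral[OF J])
  also have "\<dots> = (LINT x|lborel. G x * cos (x \<bullet> \<xi>))"
    using AE0 by (intro integral_cong_AE) (auto simp: J_s)
  finally have "(LINT x|lborel. G x * cos (x \<bullet> \<xi>)) = (LINT s|lborel. h s * w s)"
    unfolding J_x by (rule sym)
  also have "\<dots> \<ge> 0"
  proof (rule integral_antimono_times_nonneg[OF anti h0 h _ lim])
    show "w \<in> borel_measurable borel" unfolding w_def by measurable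
    show "integrable lborel (\<lambda>s. h s * w s)"
      using lborel_pair.integrable_snd[OF J] unfolding J_x .
    show "0 \<le> (LINT s|lborel. indicator {0<..u} s * w s)" if u: "0 \<le> u" for u
    proof -
      have w_eq: "indicator {0<..u} s * w s = (indicator {0<..u} s * s) * (LINT x|lborel. indicator K x * cos (s * (x \<bullet> \<xi>)))" for s
        by (auto simp: w_def split: split_indicator)
      show ?thesis unfolding w_eq by (rule integral_scaled_ball_fourier_nonneg[OF K u])
    qed
  qed
  finally show "0 \<le> (LINT x|lborel. G x * cos (x \<bullet> \<xi>))" .
qed

section \<open>Tempered functions and their representing measures\<close>

text \<open>The sum of the two measures is realized as an image measure: on two copies of the space, one carries the
  density g and the other the constant density L on a cube of volume one, and the map collapses
  the second copy to the origin. All integrals then follow from the rules for densities, images and products.\<close>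

lemma density_plus_point_mass:
  fixes g :: "'a::euclidean_space \<Rightarrow> real" and L :: real
  assumes g[measurable]: "g \<in> borel_measurable borel" and g0: "\<And>x. 0 \<le> g x" and L: "0 \<le> L"
  obtains \<mu> :: "'a measure" where "sets \<mu> = sets borel"
    "\<And>F. F \<in> borel_measurable borel \<Longrightarrow> (\<integral>\<^sup>+x. F x \<partial>\<mu>) = (\<integral>\<^sup>+x. ennreal (g x) * F x \<partial>lborel) + ennreal L * F 0"
    "\<And>F::'a \<Rightarrow> complex. F \<in> borel_measurable borel \<Longrightarrow> integrable lborel (\<lambda>x. g x *\<^sub>R F x) \<Longrightarrow>
      (LINT x|\<mu>. F x) = (LINT x|lborel. g x *\<^sub>R F x) + L *\<^sub>R F 0"
proof -
  let ?B = "count_space (UNIV :: bool set)"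
  let ?P = "lborel \<Otimes>\<^sub>M ?B :: ('a \<times> bool) measure"
  interpret B: sigma_finite_measure ?B by (rule sigma_finite_measure_count_space_finite) simp
  interpret P: pair_sigma_finite "lborel :: 'a measure" ?B ..
  define cube where "cube = cbox 0 (One :: 'a)"
  have [measurable]: "cube \<in> sets borel" by (simp add: cube_def)
  have cube: "emeasure lborel cube = 1" unfolding cube_def by (subst emeasure_lborel_cbox) simp_all
  define D where "D p = (if snd p then g (fst p) else L * indicator cube (fst p))" for p :: "'a \<times> bool"
  define X where "X p = (if snd p then fst p else 0)" for p :: "'a \<times> bool"
  have [measurable]: "D \<in> borel_measurable ?P" unfolding D_def by measurable
  have [measurable]: "X \<in> ?P \<rightarrow>\<^sub>M borel" unfolding X_def by measurable
  have D0: "0 \<le> D p" for p using g0 L by (simp add: D_def)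
  define \<mu> where "\<mu> = distr (density ?P (\<lambda>p. ennreal (D p))) borel X"
  have nn: "(\<integral>\<^sup>+x. F x \<partial>\<mu>) = (\<integral>\<^sup>+x. ennreal (g x) * F x \<partial>lborel) + ennreal L * F 0"
    if [measurable]: "F \<in> borel_measurable borel" for F
  proof -
    have "(\<integral>\<^sup>+x. F x \<partial>\<mu>) = (\<integral>\<^sup>+p. ennreal (D p) * F (X p) \<partial>?P)"
      unfolding \<mu>_def by (subst nn_integral_distr) (simp_all add: nn_integral_density)
    also have "\<dots> = (\<integral>\<^sup>+x. (\<integral>\<^sup>+b. ennreal (D (x, b)) * F (X (x, b)) \<partial>?B) \<partial>lborel)"
      by (subst B.nn_integral_fst[symmetric]) simp_all
    also have "\<dots> = (\<integral>\<^sup>+x. ennreal (g x) * F x + ennreal L * F 0 * indicator cube x \<partial>lborel)"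
      by (intro nn_integral_cong)
         (auto simp: nn_integral_count_space_finite UNIV_bool D_def X_def split: split_indicator)
    also have "\<dots> = (\<integral>\<^sup>+x. ennreal (g x) * F x \<partial>lborel) + ennreal L * F 0"
      by (subst nn_integral_add) (simp_all add: nn_integral_cmult cube)
    finally show ?thesis .
  qed
  have int: "(LINT x|\<mu>. F x) = (LINT x|lborel. g x *\<^sub>R F x) + L *\<^sub>R F 0"
    if [measurable]: "F \<in> borel_measurable borel" and F: "integrable lborel (\<lambda>x. g x *\<^sub>R F x)" for F :: "'a \<Rightarrow> complex"
  proof -
    have icube: "integrable lborel (\<lambda>x. indicator cube x *\<^sub>R (L *\<^sub>R F 0))"
      by (intro integrable_scaleR_left) (simp add: integrable_indicator_iff cube)
    have "(LINT x|\<mu>. F x) = (LINT p|density ?P (\<lambda>p. ennreal (D p)). F (X p))"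
      unfolding \<mu>_def by (rule integral_distr) simp_all
    also have "\<dots> = (LINT p|?P. D p *\<^sub>R F (X p))"
      by (rule integral_density) (simp_all add: D0)
    also have "\<dots> = (LINT x|lborel. (LINT b|?B. D (x, b) *\<^sub>R F (X (x, b))))"
    proof (rule P.integral_fst'[symmetric], rule P.Fubini_integrable)
      have "(LINT b|?B. norm (D (x, b) *\<^sub>R F (X (x, b)))) = norm (g x *\<^sub>R F x) + norm (indicator cube x *\<^sub>R (L *\<^sub>R F 0))" for x
        by (auto simp: lebesgue_integral_count_space_finite UNIV_bool D_def X_def split: split_indicator)
      then show "integrable lborel (\<lambda>x. LINT b|?B. norm (D (x, b) *\<^sub>R F (X (x, b))))"
        by (simp only:) (intro Bochner_Integration.integrable_add integrable_norm F icube)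
    qed (simp_all add: integrable_count_space)
    also have "\<dots> = (LINT x|lborel. g x *\<^sub>R F x + indicator cube x *\<^sub>R (L *\<^sub>R F 0))"
      by (intro Bochner_Integration.integral_cong)
         (auto simp: lebesgue_integral_count_space_finite UNIV_bool D_def X_def split: split_indicator)
    also have "\<dots> = (LINT x|lborel. g x *\<^sub>R F x) + (LINT x|lborel. indicator cube x *\<^sub>R (L *\<^sub>R F 0))"
      by (rule Bochner_Integration.integral_add[OF F icube])
    also have "(LINT x|lborel. indicator cube x *\<^sub>R (L *\<^sub>R F 0)) = L *\<^sub>R F 0"
      by (subst integral_scaleR_left) (simp_all add: integrable_indicator_iff cube measure_def)
    finally show ?thesis .
  qed
  show ?thesis
    by (rule that[of \<mu>]) (simp add: \<mu>_def, rule nn, assumption, rule int, assumption+)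
qed

lemma schwartz_diff_bound:
  fixes \<phi> \<psi> :: "real ^ 'n::finite \<Rightarrow> complex"
  assumes "\<phi> \<in> schwartz" "\<psi> \<in> schwartz"
  shows "(1 + norm x) ^ k * norm (\<psi> x - \<phi> x) \<le> schwartz_seminorm k [] (\<lambda>x. \<psi> x - \<phi> x)"
proof -
  obtain A where A: "\<And>x. (1 + norm x) ^ k * norm (\<phi> x) \<le> A"
    by (rule schwartz_bounded[OF assms(1)]) (rule that; assumption)
  obtain B where B: "\<And>x. (1 + norm x) ^ k * norm (\<psi> x) \<le> B"
    by (rule schwartz_bounded[OF assms(2)]) (rule that; assumption)
  have "(1 + norm x) ^ k * norm (\<psi> x - \<phi> x) \<le> B + A" for x
  proof -
    have "(1 + norm x) ^ k * norm (\<psi> x - \<phi> x) \<le> (1 + norm x) ^ k * (norm (\<psi> x) + norm (\<phi> x))"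
      by (intro mult_left_mono norm_triangle_ineq4) simp
    then show ?thesis using A[of x] B[of x] by (simp add: distrib_left)
  qed
  then have "bdd_above (range (\<lambda>x. (1 + norm x) ^ k * norm (\<psi> x - \<phi> x)))"
    by (intro bdd_aboveI[of _ "B + A"]) auto
  then show ?thesis
    unfolding schwartz_seminorm_def iter_partial_deriv.simps by (rule cSUP_upper[OF UNIV_I])
qed

text \<open>The pairing with g is bounded by a constant times the seminorm with weight \<open>(1 + norm x) ^ k\<close> and no derivatives;
  a linear functional bounded by a single seminorm is continuous.\<close>

lemma defines_tempered_distribution_if_integrable:
  fixes g :: "real ^ 'n::finite \<Rightarrow> real"
  assumes g[measurable]: "g \<in> borel_measurable borel"
    and int: "integrable lborel (\<lambda>x. g x / (1 + norm x) ^ k)"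
  shows "defines_tempered_distribution g"
proof -
  define M where "M = (LINT x|lborel. \<bar>g x / (1 + norm x) ^ k\<bar>)"
  have pos: "0 < (1 + norm x) ^ k" for x :: "real ^ 'n" by (intro zero_less_power add_pos_nonneg) auto
  have dominated: "norm (complex_of_real (g x) * \<psi> x) \<le> C * \<bar>g x / (1 + norm x) ^ k\<bar>"
    if "\<And>x. (1 + norm x) ^ k * norm (\<psi> x) \<le> C" for \<psi> C x
  proof -
    have "norm (complex_of_real (g x) * \<psi> x) = \<bar>g x / (1 + norm x) ^ k\<bar> * ((1 + norm x) ^ k * norm (\<psi> x))"
    proof -
      have "a * b = a / P * (P * b)" if "P \<noteq> 0" for a b P :: real using that by simp
      from this[OF less_imp_neq[OF pos, symmetric]] show ?thesis
        unfolding norm_mult norm_of_real abs_divide abs_of_pos[OF pos] .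
    qed
    also have "\<dots> \<le> \<bar>g x / (1 + norm x) ^ k\<bar> * C" by (intro mult_left_mono that) simp
    finally show ?thesis by (simp add: mult.commute)
  qed
  have int\<phi>: "integrable lborel (\<lambda>x. complex_of_real (g x) * \<phi> x)" if \<phi>: "\<phi> \<in> schwartz" for \<phi>
  proof -
    have [measurable]: "\<phi> \<in> borel_measurable borel" by (rule schwartz_measurable[OF \<phi>])
    obtain C where C: "\<And>x. (1 + norm x) ^ k * norm (\<phi> x) \<le> C"
      by (rule schwartz_bounded[OF \<phi>]) (rule that; assumption)
    show ?thesis
    proof (rule Bochner_Integration.integrable_bound)
      show "integrable lborel (\<lambda>x. C * \<bar>g x / (1 + norm x) ^ k\<bar>)"
        using int by (intro integrable_mult_right integrable_abs)
      show "AE x in lborel. norm (complex_of_real (g x) * \<phi> x) \<le> norm (C * \<bar>g x / (1 + norm x) ^ k\<bar>)"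
        by (intro AE_I2 order_trans[OF dominated[OF C]]) (simp only: real_norm_def abs_ge_self)
    qed measurable
  qed
  have meas: "(\<lambda>x. complex_of_real (g x) * \<phi> x) \<in> borel_measurable lborel" if "\<phi> \<in> schwartz" for \<phi>
    using borel_measurable_integrable[OF int\<phi>[OF that]] .
  have T: "function_distribution g \<phi> = (LINT x|lborel. complex_of_real (g x) * \<phi> x)" if "\<phi> \<in> schwartz" for \<phi>
    unfolding function_distribution_def by (rule integral_completion[OF meas[OF that]])
  have local: "g absolutely_integrable_on C" if C: "compact C" for C
  proof -
    obtain R where R: "\<And>x. x \<in> C \<Longrightarrow> norm x \<le> R"
      using compact_imp_bounded[OF C] unfolding bounded_iff by blast
    have [measurable]: "C \<in> sets borel" using C by (rule borel_compact)
    have "integrable lborel (\<lambda>x. indicator C x *\<^sub>R g x)"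
    proof (rule Bochner_Integration.integrable_bound)
      show "integrable lborel (\<lambda>x. (1 + \<bar>R\<bar>) ^ k * \<bar>g x / (1 + norm x) ^ k\<bar>)"
        using int by (intro integrable_mult_right integrable_abs)
      show "AE x in lborel. norm (indicator C x *\<^sub>R g x) \<le> norm ((1 + \<bar>R\<bar>) ^ k * \<bar>g x / (1 + norm x) ^ k\<bar>)"
      proof (rule AE_I2)
        fix x
        show "norm (indicator C x *\<^sub>R g x) \<le> norm ((1 + \<bar>R\<bar>) ^ k * \<bar>g x / (1 + norm x) ^ k\<bar>)"
        proof (cases "x \<in> C")
          case True
          have "(1 + norm x) ^ k \<le> (1 + \<bar>R\<bar>) ^ k" using R[OF True] by (intro power_mono) auto
          then have "(1 + norm x) ^ k * \<bar>g x / (1 + norm x) ^ k\<bar> \<le> (1 + \<bar>R\<bar>) ^ k * \<bar>g x / (1 + norm x) ^ k\<bar>"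
            by (rule mult_right_mono) simp
          moreover have "1 + norm x \<noteq> 0" using norm_ge_zero[of x] by linarith
          ultimately show ?thesis using True by (simp add: abs_divide abs_mult)
        qed simp
      qed
    qed measurable
    then show ?thesis unfolding set_integrable_def by (subst integrable_completion) simp_all
  qed
  have "tempered_distribution (function_distribution g)"
    unfolding tempered_distribution_def
  proof (intro conjI ballI allI)
    fix \<phi> \<psi> :: "real ^ 'n \<Rightarrow> complex" assume *: "\<phi> \<in> schwartz" "\<psi> \<in> schwartz"
    have "function_distribution g (\<lambda>x. \<phi> x + \<psi> x) = (LINT x|lebesgue. complex_of_real (g x) * \<phi> x + complex_of_real (g x) * \<psi> x)"
      unfolding function_distribution_def by (simp add: distrib_left)
    also have "\<dots> = function_distribution g \<phi> + function_distribution g \<psi>"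
      unfolding function_distribution_def
      by (intro Bochner_Integration.integral_add) (subst integrable_completion[OF meas]; intro * int\<phi>)+
    finally show "function_distribution g (\<lambda>x. \<phi> x + \<psi> x) = function_distribution g \<phi> + function_distribution g \<psi>" .
  next
    fix c :: complex and \<phi> :: "real ^ 'n \<Rightarrow> complex"
    have "function_distribution g (\<lambda>x. c * \<phi> x) = (LINT x|lebesgue. c * (complex_of_real (g x) * \<phi> x))"
      unfolding function_distribution_def by (simp add: mult.left_commute)
    also have "\<dots> = c * function_distribution g \<phi>"
      unfolding function_distribution_def by (rule integral_mult_right_zero)
    finally show "function_distribution g (\<lambda>x. c * \<phi> x) = c * function_distribution g \<phi>" .
  next
    let ?T = "function_distribution g"
    have M0: "0 \<le> M" unfolding M_def by (intro Bochner_Integration.integral_nonneg) simp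
    have lip: "norm (?T \<psi> - ?T \<phi>) \<le> M * schwartz_seminorm k [] (\<lambda>x. \<psi> x - \<phi> x)"
      if "\<phi> \<in> schwartz" "\<psi> \<in> schwartz" for \<phi> \<psi>
    proof -
      let ?p = "schwartz_seminorm k [] (\<lambda>x. \<psi> x - \<phi> x)"
      have "?T \<psi> - ?T \<phi> = (LINT x|lborel. complex_of_real (g x) * (\<psi> x - \<phi> x))"
        unfolding T[OF that(1)] T[OF that(2)] right_diff_distrib
        by (rule Bochner_Integration.integral_diff[symmetric]) (intro int\<phi> that)+
      also have "norm \<dots> \<le> (LINT x|lborel. ?p * \<bar>g x / (1 + norm x) ^ k\<bar>)"
      proof (rule order_trans[OF integral_norm_bound integral_mono])
        show "integrable lborel (\<lambda>x. norm (complex_of_real (g x) * (\<psi> x - \<phi> x)))"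
          unfolding right_diff_distrib
          by (intro integrable_norm Bochner_Integration.integrable_diff int\<phi> that)
        show "integrable lborel (\<lambda>x. ?p * \<bar>g x / (1 + norm x) ^ k\<bar>)"
          using int by (intro integrable_mult_right integrable_abs)
        show "norm (complex_of_real (g x) * (\<psi> x - \<phi> x)) \<le> ?p * \<bar>g x / (1 + norm x) ^ k\<bar>" for x
          by (rule dominated) (rule schwartz_diff_bound[OF that])
      qed
      also have "\<dots> = M * ?p" unfolding integral_mult_right_zero M_def by (rule mult.commute)
      finally show ?thesis .
    qed
    show "continuous_map schwartz_topology euclidean ?T"
      unfolding continuous_map_def topspace_schwartz_topology
    proof (intro conjI allI impI)
      fix U :: "complex set" assume "openin euclidean U"
      then have U: "open U" by simp
      show "openin schwartz_topology {\<phi> \<in> schwartz. ?T \<phi> \<in> U}"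
      proof (subst openin_subopen, intro ballI)
        fix \<phi> assume "\<phi> \<in> {\<phi> \<in> schwartz. ?T \<phi> \<in> U}"
        then have \<phi>: "\<phi> \<in> schwartz" "?T \<phi> \<in> U" by auto
        obtain e where e: "0 < e" "ball (?T \<phi>) e \<subseteq> U" using U \<phi>(2) by (rule openE)
        define r where "r = e / (1 + M)"
        have r: "0 < r" using e(1) M0 by (simp add: r_def add_pos_nonneg)
        define V where "V = {\<psi> \<in> schwartz. schwartz_seminorm k [] (\<lambda>x. \<psi> x - \<phi> x) < r}"
        have "openin schwartz_topology V"
          unfolding schwartz_topology_def
          by (rule topology_generated_by_Basis) (use \<phi>(1) r in \<open>auto simp: V_def\<close>)
        moreover have "\<phi> \<in> V" using \<phi>(1) r by (simp add: V_def schwartz_seminorm_def)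
        moreover have "V \<subseteq> {\<phi> \<in> schwartz. ?T \<phi> \<in> U}"
        proof
          fix \<psi> assume "\<psi> \<in> V"
          then have \<psi>: "\<psi> \<in> schwartz" "schwartz_seminorm k [] (\<lambda>x. \<psi> x - \<phi> x) < r" by (auto simp: V_def)
          have "norm (?T \<psi> - ?T \<phi>) \<le> M * r"
            using lip[OF \<phi>(1) \<psi>(1)] mult_left_mono[OF less_imp_le[OF \<psi>(2)] M0] by linarith
          also have "\<dots> < e" using e(1) M0 by (simp add: r_def field_simps add_pos_nonneg)
          finally have "?T \<psi> \<in> ball (?T \<phi>) e" by (simp add: dist_norm norm_minus_commute)
          then show "\<psi> \<in> {\<phi> \<in> schwartz. ?T \<phi> \<in> U}" using e(2) \<psi>(1) by blast
        qed
        ultimately show "\<exists>T. openin schwartz_topology T \<and> \<phi> \<in> T \<and> T \<subseteq> {\<phi> \<in> schwartz. ?T \<phi> \<in> U}"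
          by blast
      qed
    qed simp
  qed
  moreover have "integrable lebesgue (\<lambda>x. complex_of_real (g x) * \<phi> x)" if "\<phi> \<in> schwartz" for \<phi>
    by (subst integrable_completion[OF meas[OF that]]) (rule int\<phi>[OF that])
  ultimately show ?thesis unfolding defines_tempered_distribution_def using local by blast
qed

text \<open>The representing measure has a mass L at the origin, whose Fourier transform is the constant L, and the
  density \<open>inverse ((2 * pi) ^ CARD('n)) * (LINT x|lborel. G x * cos (x \<bullet> \<xi>))\<close>. This density is non-negative by
  hypothesis and bounded by the integral of \<open>\<bar>G\<bar>\<close>, so the measure is tempered.\<close>

lemma positive_definite_constant_plus_integrable:
  fixes g G :: "real ^ 'n::finite \<Rightarrow> real"
  assumes g[measurable]: "g \<in> borel_measurable borel" and L: "0 \<le> L"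
    and gG: "AE x in lborel. g x = L + G x"
    and G: "integrable lborel G" and even: "\<And>x. G (- x) = G x"
    and pos: "\<And>\<xi>. 0 \<le> (LINT x|lborel. G x * cos (x \<bullet> \<xi>))"
  shows "defines_tempered_distribution g \<and> positive_definite_distribution (function_distribution g)"
proof -
  let ?k = "DIM(real ^ 'n) + 2"
  have [measurable]: "G \<in> borel_measurable borel" using borel_measurable_integrable[OF G] by simp
  have decay: "integrable lborel (\<lambda>x::real ^ 'n. 1 / (1 + norm x) ^ ?k)" by (rule integrable_polynomial_decay)
  have ge1: "1 \<le> (1 + norm x) ^ ?k" for x :: "real ^ 'n" by (rule one_le_power) simp
  have intg: "integrable lborel (\<lambda>x. g x / (1 + norm x) ^ ?k)"
  proof -
    have "integrable lborel (\<lambda>x. G x / (1 + norm x) ^ ?k)"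
    proof (rule Bochner_Integration.integrable_bound[OF G _ AE_I2])
      fix x
      have "\<bar>G x\<bar> * 1 \<le> \<bar>G x\<bar> * (1 + norm x) ^ ?k" by (intro mult_left_mono ge1) simp
      then show "norm (G x / (1 + norm x) ^ ?k) \<le> norm (G x)"
        using ge1[of x] by (simp add: abs_divide pos_divide_le_eq)
    qed measurable
    then have "integrable lborel (\<lambda>x. L * (1 / (1 + norm x) ^ ?k) + G x / (1 + norm x) ^ ?k)"
      by (intro Bochner_Integration.integrable_add integrable_mult_right decay)
    then show ?thesis
      by (rule integrable_cong_AE_imp) (measurable, use gG in \<open>eventually_elim, simp add: add_divide_distrib\<close>)
  qed
  have tempered: "defines_tempered_distribution g"
    by (rule defines_tempered_distribution_if_integrable[OF g intg])
  define c where "c = inverse ((2 * pi) ^ CARD('n))"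
  define H where "H \<xi> = c * (LINT x|lborel. G x * cos (x \<bullet> \<xi>))" for \<xi>
  have c0: "0 \<le> c" by (simp add: c_def)
  have H0: "0 \<le> H \<xi>" for \<xi> unfolding H_def using c0 pos by (rule mult_nonneg_nonneg)
  have H[measurable]: "H \<in> borel_measurable borel" unfolding H_def by measurable
  define B where "B = c * (LINT x|lborel. \<bar>G x\<bar>)"
  have HB: "H \<xi> \<le> B" for \<xi>
  proof -
    have "(LINT x|lborel. G x * cos (x \<bullet> \<xi>)) \<le> (LINT x|lborel. \<bar>G x\<bar>)"
    proof (rule integral_mono)
      show "integrable lborel (\<lambda>x. G x * cos (x \<bullet> \<xi>))"
        by (rule Bochner_Integration.integrable_bound[OF G]) (auto simp: abs_mult mult_left_le)
      show "G x * cos (x \<bullet> \<xi>) \<le> \<bar>G x\<bar>" for x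
        using abs_ge_self[of "G x * cos (x \<bullet> \<xi>)"] mult_left_le[OF abs_cos_le_one[of "x \<bullet> \<xi>"] abs_ge_zero[of "G x"]]
        by (simp add: abs_mult)
    qed (use G in simp)
    then show ?thesis unfolding H_def B_def using c0 by (rule mult_left_mono)
  qed
  obtain \<mu> :: "(real ^ 'n) measure" where \<mu>: "sets \<mu> = sets borel"
    "\<And>F. F \<in> borel_measurable borel \<Longrightarrow> (\<integral>\<^sup>+x. F x \<partial>\<mu>) = (\<integral>\<^sup>+x. ennreal (H x) * F x \<partial>lborel) + ennreal L * F 0"
    "\<And>F::real ^ 'n \<Rightarrow> complex. F \<in> borel_measurable borel \<Longrightarrow> integrable lborel (\<lambda>x. H x *\<^sub>R F x) \<Longrightarrow>
      (LINT x|\<mu>. F x) = (LINT x|lborel. H x *\<^sub>R F x) + L *\<^sub>R F 0"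
    by (rule density_plus_point_mass[OF H H0 L]) (rule that; assumption)
  have "tempered_measure \<mu>"
    unfolding tempered_measure_def
  proof (intro conjI exI[of _ "real ?k"])
    have powr: "(1 + norm x) powr (- real ?k) = 1 / (1 + norm x) ^ ?k" for x :: "real ^ 'n"
      by (simp only: powr_minus powr_realpow[OF add_pos_nonneg[OF zero_less_one norm_ge_zero]] inverse_eq_divide)
    have "(\<integral>\<^sup>+x. ennreal (H x) * ennreal (1 / (1 + norm x) ^ ?k) \<partial>lborel)
        \<le> (\<integral>\<^sup>+x. ennreal B * ennreal (1 / (1 + norm (x::real ^ 'n)) ^ ?k) \<partial>lborel)"
      by (intro nn_integral_mono mult_right_mono ennreal_leI HB) simp
    also have "\<dots> = ennreal B * (\<integral>\<^sup>+x. ennreal (1 / (1 + norm (x::real ^ 'n)) ^ ?k) \<partial>lborel)"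
      by (rule nn_integral_cmult) measurable
    also have "(\<integral>\<^sup>+x. ennreal (1 / (1 + norm (x::real ^ 'n)) ^ ?k) \<partial>lborel) = ennreal (LINT x|lborel. 1 / (1 + norm (x::real ^ 'n)) ^ ?k)"
      by (rule nn_integral_eq_integral[OF decay]) simp
    also have "ennreal B * \<dots> < \<infinity>" by (simp only: ennreal_mult_less_top infinity_ennreal_def) simp
    finally have "(\<integral>\<^sup>+x. ennreal (H x) * ennreal (1 / (1 + norm x) ^ ?k) \<partial>lborel) < \<infinity>" .
    moreover have "(\<integral>\<^sup>+x. ennreal ((1 + norm x) powr (- real ?k)) \<partial>\<mu>)
        = (\<integral>\<^sup>+x. ennreal (H x) * ennreal (1 / (1 + norm x) ^ ?k) \<partial>lborel) + ennreal L * ennreal (1 / (1 + norm (0::real^'n)) ^ ?k)"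
      unfolding powr by (rule \<mu>(2)) measurable
    ultimately show "(\<integral>\<^sup>+x. ennreal ((1 + norm x) powr (- real ?k)) \<partial>\<mu>) < \<infinity>"
      by (simp add: ennreal_mult_less_top)
  qed (use \<mu>(1) in simp_all)
  moreover have "function_distribution g \<phi> = fourier_distribution (measure_distribution \<mu>) \<phi>" if \<phi>: "\<phi> \<in> schwartz" for \<phi>
  proof -
    have [measurable]: "\<phi> \<in> borel_measurable borel" by (rule schwartz_measurable[OF \<phi>])
    have int\<phi>: "integrable lborel \<phi>" by (rule schwartz_integrable[OF \<phi>])
    have int\<phi>': "integrable lborel (fourier \<phi>)" by (rule fourier_schwartz_integrable[OF \<phi>])
    have [measurable]: "fourier \<phi> \<in> borel_measurable borel" by (rule measurable_fourier[OF int\<phi>])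
    obtain C where C: "\<And>x. (1 + norm x) ^ 0 * norm (\<phi> x) \<le> C"
      by (rule schwartz_bounded[OF \<phi>]) (rule that; assumption)
    have intG\<phi>: "integrable lborel (\<lambda>x. complex_of_real (G x) * \<phi> x)"
    proof (rule Bochner_Integration.integrable_bound[OF _ _ AE_I2])
      show "integrable lborel (\<lambda>x. \<bar>G x\<bar> * C)" using G by (intro integrable_mult_left integrable_abs)
      show "norm (complex_of_real (G x) * \<phi> x) \<le> norm (\<bar>G x\<bar> * C)" for x
        using mult_left_mono[OF _ abs_ge_zero[of "G x"], of "norm (\<phi> x)" C] C[of x] by (simp add: norm_mult)
    qed measurable
    have intH: "integrable lborel (\<lambda>\<xi>. H \<xi> *\<^sub>R fourier \<phi> \<xi>)"
    proof (rule Bochner_Integration.integrable_bound[OF _ _ AE_I2])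
      show "integrable lborel (\<lambda>\<xi>. B *\<^sub>R fourier \<phi> \<xi>)" by (intro integrable_scaleR_right int\<phi>')
      show "norm (H \<xi> *\<^sub>R fourier \<phi> \<xi>) \<le> norm (B *\<^sub>R fourier \<phi> \<xi>)" for \<xi>
        using H0[of \<xi>] HB[of \<xi>] by (simp add: mult_right_mono)
    qed measurable
    have "function_distribution g \<phi> = (LINT x|lborel. complex_of_real (g x) * \<phi> x)"
      unfolding function_distribution_def by (rule integral_completion) measurable
    also have "\<dots> = (LINT x|lborel. complex_of_real L * \<phi> x + complex_of_real (G x) * \<phi> x)"
      by (rule integral_cong_AE) (measurable, use gG in \<open>eventually_elim, simp add: distrib_right\<close>)
    also have "\<dots> = complex_of_real L * (LINT x|lborel. \<phi> x) + (LINT x|lborel. complex_of_real (G x) * \<phi> x)"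
      by (subst Bochner_Integration.integral_add) (simp_all add: int\<phi> intG\<phi>)
    also have "(LINT x|lborel. \<phi> x) = fourier \<phi> 0" by (simp add: fourier_def)
    also have "(LINT x|lborel. complex_of_real (G x) * \<phi> x) = (LINT \<xi>|lborel. H \<xi> *\<^sub>R fourier \<phi> \<xi>)"
      unfolding integral_even_times_schwartz[OF \<phi> G even] by (simp only: H_def c_def scaleR_conv_of_real)
    also have "complex_of_real L * fourier \<phi> 0 + (LINT \<xi>|lborel. H \<xi> *\<^sub>R fourier \<phi> \<xi>) = (LINT \<xi>|\<mu>. fourier \<phi> \<xi>)"
      unfolding \<mu>(3)[OF measurable_fourier[OF int\<phi>] intH] scaleR_conv_of_real by (rule add.commute)
    finally show ?thesis unfolding fourier_distribution_def measure_distribution_def .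
  qed
  ultimately show ?thesis
    using tempered unfolding positive_definite_distribution_def defines_tempered_distribution_def by blast
qed

section \<open>Monotone functions of a norm\<close>

theorem theorem3:
  fixes f :: "real \<Rightarrow> real" and K :: "(real ^ 'n::finite) set"
  assumes nonneg: "\<And>t. 0 < t \<Longrightarrow> 0 \<le> f t"
    and abs_cont: "locally_absolutely_continuous_on {0<..} f"
    and noninc: "antimono_on {0<..} f"
    and bounded: "\<exists>C. AE t in lebesgue. 0 < t \<longrightarrow> \<bar>- (t ^ CARD('n)) * deriv f t\<bar> \<le> C"
    and integrable: "(\<lambda>t. - (t ^ CARD('n)) * deriv f t) absolutely_integrable_on {0<..}"
    and noninc_deriv: "\<exists>Z \<in> null_sets lebesgue.
          antimono_on ({0<..} - Z) (\<lambda>t. - (t ^ (CARD('n) - 1)) * deriv f t)"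
    and body: "symmetric_convex_body K"
  shows "defines_tempered_distribution (\<lambda>x. f (body_norm K x)) \<and>
         positive_definite_distribution (function_distribution (\<lambda>x. f (body_norm K x)))"
proof -
  obtain N where N: "is_norm N" and K: "K = {x. N x \<le> 1}"
    using body unfolding symmetric_convex_body_def by blast
  have body_norm: "body_norm K = N" unfolding K by (rule body_norm_unit_ball[OF N])
  have [measurable]: "N \<in> borel_measurable borel" by (rule measurable_is_norm[OF N])
  have Npos: "0 < N x" if "x \<noteq> 0" for x
    using is_norm_nonneg[OF N, of x] is_norm_eq_0[OF N, of x] that by linarith
  define m where "m = CARD('n) - 1"
  have card: "CARD('n) = Suc m" using zero_less_card_finite[where 'a='n] by (simp add: m_def)
  obtain Z where Z: "Z \<in> null_sets lebesgue" "antimono_on ({0<..} - Z) (\<lambda>t. - (t ^ m) * deriv f t)"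
    using noninc_deriv unfolding m_def by blast
  obtain h0 where h0: "antimono_on {0<..} h0" "\<And>t. 0 < t \<Longrightarrow> 0 \<le> h0 t"
    "\<And>a b. 0 < a \<Longrightarrow> a \<le> b \<Longrightarrow> (\<integral>\<^sup>+t\<in>{a..b}. ennreal (h0 t / t ^ m) \<partial>lborel) = ennreal (f a - f b)"
    "AE t in lborel. 0 < t \<longrightarrow> h0 t = - (t ^ m) * deriv f t"
    by (rule locally_absolutely_continuous_antimono_density[OF abs_cont noninc Z]) (rule that; assumption)
  define h where "h t = (if 0 < t then h0 t else 0)" for t
  have h[measurable]: "h \<in> borel_measurable borel"
    unfolding h_def by (rule borel_measurable_antimono_on_positive[OF h0(1)])
  have h_anti: "antimono_on {0<..} h" using h0(1) by (auto simp: monotone_on_def h_def)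
  have h_nonneg: "0 \<le> h t" for t using h0(2) by (simp add: h_def)
  have h_Icc: "(\<integral>\<^sup>+t\<in>{a..b}. ennreal (h t / t ^ m) \<partial>lborel) = ennreal (f a - f b)" if "0 < a" "a \<le> b" for a b
    unfolding h0(3)[OF that, symmetric] using that
    by (intro nn_integral_cong) (auto simp: h_def split: split_indicator)
  have fin: "(\<integral>\<^sup>+t. ennreal (t * h t) \<partial>lborel) < \<infinity>"
  proof -
    have "integrable lebesgue (\<lambda>t. indicator {0<..} t *\<^sub>R (- (t ^ CARD('n)) * deriv f t))"
      using integrable unfolding set_integrable_def .
    then have "(\<integral>\<^sup>+t. ennreal (norm (indicator {0<..} t *\<^sub>R (- (t ^ CARD('n)) * deriv f t))) \<partial>lebesgue) < \<infinity>"
      by (simp add: integrable_iff_bounded)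
    also have "(\<integral>\<^sup>+t. ennreal (norm (indicator {0<..} t *\<^sub>R (- (t ^ CARD('n)) * deriv f t))) \<partial>lebesgue)
        = (\<integral>\<^sup>+t. ennreal (t * h t) \<partial>lebesgue)"
    proof (rule nn_integral_cong_AE)
      have "AE t in lebesgue. 0 < t \<longrightarrow> h0 t = - (t ^ m) * deriv f t" using h0(4) by (rule AE_completion)
      then show "AE t in lebesgue. ennreal (norm (indicator {0<..} t *\<^sub>R (- (t ^ CARD('n)) * deriv f t))) = ennreal (t * h t)"
      proof eventually_elim
        case (elim t)
        show ?case
        proof (cases "0 < t")
          case True
          then have "- (t ^ CARD('n)) * deriv f t = t * h t" using elim by (simp add: card h_def)
          then show ?thesis using True h_nonneg[of t] by simp
        next
          case False
          then show ?thesis by (simp add: h_def)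
        qed
      qed
    qed
    also have "\<dots> = (\<integral>\<^sup>+t. ennreal (t * h t) \<partial>lborel)" by (rule nn_integral_completion) measurable
    finally show ?thesis .
  qed
  define L where "L = Inf (f ` {0<..})"
  have bdd: "bdd_below (f ` {0<..})" using nonneg by (intro bdd_belowI[of _ 0]) auto
  have L0: "0 \<le> L" unfolding L_def using nonneg by (intro cInf_greatest) auto
  have Lf: "L \<le> f t" if "0 < t" for t unfolding L_def using that by (intro cInf_lower bdd) auto
  have f_lim: "(\<lambda>k. f (t + real k)) \<longlonglongrightarrow> L" if t: "0 < t" for t
  proof (rule LIMSEQ_I)
    fix e :: real assume "0 < e"
    then obtain s where s: "0 < s" "f s < L + e"
      using cInf_lessD[of "f ` {0<..}" "L + e"] unfolding L_def by auto
    obtain k0 :: nat where k0: "s \<le> real k0" using real_arch_simple by blast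
    have "norm (f (t + real k) - L) < e" if "k0 \<le> k" for k
    proof -
      have "s \<le> t + real k" using k0 t that by linarith
      then have "f (t + real k) \<le> f s" using monotone_onD[OF noninc, of s "t + real k"] s(1) by simp
      moreover have "L \<le> f (t + real k)" using t by (intro Lf) simp
      ultimately show ?thesis using s(2) by simp
    qed
    then show "\<exists>k0. \<forall>k\<ge>k0. norm (f (t + real k) - L) < e" by blast
  qed
  have tail: "ennreal (f t - L) = (\<integral>\<^sup>+s. ennreal (h s / s ^ m) * indicator {t..} s \<partial>lborel)" if t: "0 < t" for t
  proof (rule LIMSEQ_unique)
    let ?D = "density lborel (\<lambda>s. ennreal (h s / s ^ m))"
    have UN: "(\<Union>k. {t..t + real k}) = {t..}"
    proof (intro equalityI subsetI)
      fix s assume s: "s \<in> {t..}"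
      obtain k :: nat where "s - t \<le> real k" using real_arch_simple by blast
      then show "s \<in> (\<Union>k. {t..t + real k})" using s by (intro UN_I[of k]) auto
    qed auto
    have "(\<lambda>k. emeasure ?D {t..t + real k}) \<longlonglongrightarrow> emeasure ?D (\<Union>k. {t..t + real k})"
      by (rule Lim_emeasure_incseq) (auto simp: incseq_def)
    then show "(\<lambda>k. emeasure ?D {t..t + real k}) \<longlonglongrightarrow> (\<integral>\<^sup>+s. ennreal (h s / s ^ m) * indicator {t..} s \<partial>lborel)"
      unfolding UN by (simp add: emeasure_density)
    have "emeasure ?D {t..t + real k} = ennreal (f t - f (t + real k))" for k
      using h_Icc[OF t, of "t + real k"] by (simp add: emeasure_density)
    moreover have "(\<lambda>k. ennreal (f t - f (t + real k))) \<longlonglongrightarrow> ennreal (f t - L)"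
      by (intro tendsto_ennrealI tendsto_diff tendsto_const f_lim t)
    ultimately show "(\<lambda>k. emeasure ?D {t..t + real k}) \<longlonglongrightarrow> ennreal (f t - L)" by simp
  qed
  define G where "G x = (if 0 < N x then f (N x) else L) - L" for x
  have f_meas[measurable]: "(\<lambda>t. if 0 < t then f t else c) \<in> borel_measurable borel" for c
    by (rule borel_measurable_antimono_on_positive[OF noninc])
  have G_meas: "G \<in> borel_measurable borel"
    unfolding G_def using measurable_compose[OF measurable_is_norm[OF N] f_meas[of L]] by simp
  have G0: "0 \<le> G x" for x using Lf by (simp add: G_def)
  have layers: "ennreal (G x) = (\<integral>\<^sup>+s. ennreal (h s / s ^ m) * indicator {s. 0 < s \<and> N x \<le> s} s \<partial>lborel)"
    if x: "x \<noteq> 0" for x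
  proof -
    have "{s. 0 < s \<and> N x \<le> s} = {N x..}" using Npos[OF x] by auto
    then show ?thesis using tail[OF Npos[OF x]] Npos[OF x] by (simp add: G_def)
  qed
  have dim: "DIM(real ^ 'n) = Suc m" by (simp add: card)
  have h_neg: "h s = 0" if "s \<le> 0" for s using that by (simp add: h_def)
  note radial = N dim h_anti h_nonneg h_neg h fin G_meas G0 layers
  show ?thesis
  proof (rule positive_definite_constant_plus_integrable[OF _ L0, of _ G])
    have "(\<lambda>x. f (body_norm K x)) = (\<lambda>x. if 0 < N x then f (N x) else f 0)"
      using is_norm_nonneg[OF N] by (auto simp: fun_eq_iff body_norm not_less intro: arg_cong[of _ _ f] antisym)
    also have "\<dots> \<in> borel_measurable borel"
      using measurable_compose[OF measurable_is_norm[OF N] f_meas[of "f 0"]] by simp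
    finally show "(\<lambda>x. f (body_norm K x)) \<in> borel_measurable borel" .
    have "AE x in lborel. x \<noteq> (0 :: real ^ 'n)" by (rule AE_lborel_singleton)
    then show "AE x in lborel. f (body_norm K x) = L + G x"
      by eventually_elim (simp add: body_norm G_def Npos)
    show "integrable lborel G" by (rule integrable_radial_layers[OF radial])
    show "G (- x) = G x" for x by (simp add: G_def is_norm_minus[OF N])
    show "0 \<le> (LINT x|lborel. G x * cos (x \<bullet> \<xi>))" for \<xi>
      by (rule fourier_radial_layers_nonneg[OF radial])
  qed
qed

end
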